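(* Let $\{\xi_j\}_{j=-\infty}^{\infty}$ be a family, indexed by $j\in\mathbb{Z}$, of independent identically distributed real random variables with mean $0$ and variance $1$, defined on some probability space $(\Omega,\mathcal{F},P)$. Define a stochastic process $X=(X_t)_{t\in\mathbb{R}}$ by $X_t(\omega)=\xi_{[t]}(\omega)$, where $[t]$ denotes the greatest integer not exceeding $t$, and for each integer $n\ge 1$ set $$X^{(n)}_t(\omega)=\sqrt{n}\,X_{nt}(\omega),\qquad t\in\mathbb{R}.$$ Let $P_n$ be the probability measure on $\mathscr{S}'$ induced by $X^{(n)}$. Then $\{P_n\}$ converges weakly to the white noise measure on $\mathscr{S}'$.
   Context: $\mathscr{S}=\mathscr{S}(\mathbb{R})$ is the Schwartz space of real-valued rapidly decreasing smooth functions on $\mathbb{R}$, and $\mathscr{S}'$ is its dual, the space of tempered distributions, equipped with the strong topology (uniform convergence on bounded subsets of $\mathscr{S}$) and its Borel $\sigma$-algebra. The measure $P_n$ is the law of the $\mathscr{S}'$-valued random variable (defined $P$-almost surely) given by $\langle X^{(n)}(\omega),\varphi\rangle=\int_{-\infty}^{\infty}X^{(n)}_t(\omega)\varphi(t)\,dt$ for $\varphi\in\mathscr{S}$. The white noise measure is the unique probability measure $\mu$ on $\mathscr{S}'$ whose characteristic function is $\int_{\mathscr{S}'}\exp(i\langle x,\varphi\rangle)\,d\mu(x)=\exp\left(-\frac12\int_{-\infty}^{\infty}\varphi(t)^2\,dt\right)$ for all $\varphi\in\mathscr{S}$. Weak convergence of probability measures means convergence of integrals of every bounded continuous function on $\mathscr{S}'$.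 *)

theory Defs
  imports "HOL-Probability.Probability"
begin

section \<open>The Schwartz space\<close>

definition is_schwartz :: "(real \<Rightarrow> real) \<Rightarrow> bool" where
  "is_schwartz f \<longleftrightarrow>
     (\<forall>k x. (deriv ^^ k) f field_differentiable (at x)) \<and>
     (\<forall>m k. bounded (range (\<lambda>x. x ^ m * (deriv ^^ k) f x)))"

lemma higher_deriv_linear:
  fixes f g :: "real \<Rightarrow> real"
  assumes "\<And>k x. (deriv ^^ k) f field_differentiable (at x)"
    and "\<And>k x. (deriv ^^ k) g field_differentiable (at x)"
  shows "(deriv ^^ k) (\<lambda>x. a * f x + b * g x) = (\<lambda>x. a * (deriv ^^ k) f x + b * (deriv ^^ k) g x)"
proof (induction k)
  case (Suc k)
  have "deriv (\<lambda>x. a * (deriv ^^ k) f x + b * (deriv ^^ k) g x) x =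
        a * deriv ((deriv ^^ k) f) x + b * deriv ((deriv ^^ k) g) x" for x
    using assms
    by (intro DERIV_imp_deriv DERIV_add DERIV_cmult) (simp_all add: DERIV_deriv_iff_field_differentiable)
  then show ?case
    by (simp add: Suc fun_eq_iff)
qed simp

lemma is_schwartz_linear:
  assumes "is_schwartz f" "is_schwartz g"
  shows "is_schwartz (\<lambda>x. a * f x + b * g x)"
proof -
  have D: "(deriv ^^ k) (\<lambda>x. a * f x + b * g x) =
      (\<lambda>x. a * (deriv ^^ k) f x + b * (deriv ^^ k) g x)" for k
    using assms by (intro higher_deriv_linear) (auto simp: is_schwartz_def)
  have "bounded (range (\<lambda>x. a *\<^sub>R (x ^ m * (deriv ^^ k) f x) + b *\<^sub>R (x ^ m * (deriv ^^ k) g x)))" for m k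
    using assms by (intro bounded_plus_comp bounded_scaleR_comp) (auto simp: is_schwartz_def)
  then have "bounded (range (\<lambda>x. x ^ m * (a * (deriv ^^ k) f x + b * (deriv ^^ k) g x)))" for m k
    by (simp add: algebra_simps)
  moreover have "(\<lambda>x. a * (deriv ^^ k) f x + b * (deriv ^^ k) g x) field_differentiable (at x)" for k x
    using assms by (intro derivative_intros) (auto simp: is_schwartz_def)
  ultimately show ?thesis
    by (simp add: is_schwartz_def D)
qed

lemma is_schwartz_zero: "is_schwartz (\<lambda>x. 0)"
proof -
  have "(deriv ^^ k) (\<lambda>x::real. 0::real) = (\<lambda>x. 0)" for k
    by (induction k) simp_all
  then show ?thesis
    by (simp add: is_schwartz_def image_constant_conv)
qed

typedef schwartz = "{f. is_schwartz f}"
  morphisms schwartz_fun Abs_schwartz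
  using is_schwartz_zero by blast

setup_lifting type_definition_schwartz

instantiation schwartz :: real_vector
begin

lift_definition zero_schwartz :: schwartz is "\<lambda>x. 0"
  by (rule is_schwartz_zero)

lift_definition plus_schwartz :: "schwartz \<Rightarrow> schwartz \<Rightarrow> schwartz" is "\<lambda>f g x. f x + g x"
  using is_schwartz_linear[of _ _ 1 1] by simp

lift_definition minus_schwartz :: "schwartz \<Rightarrow> schwartz \<Rightarrow> schwartz" is "\<lambda>f g x. f x - g x"
  using is_schwartz_linear[of _ _ 1 "-1"] by simp

lift_definition uminus_schwartz :: "schwartz \<Rightarrow> schwartz" is "\<lambda>f x. - f x"
  using is_schwartz_linear[of _ _ "-1" 0] by simp

lift_definition scaleR_schwartz :: "real \<Rightarrow> schwartz \<Rightarrow> schwartz" is "\<lambda>a f x. a * f x"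
  using is_schwartz_linear[of _ _ _ 0] by simp

instance
  by standard (transfer, simp add: fun_eq_iff algebra_simps)+

end

definition schwartz_seminorm :: "nat \<Rightarrow> nat \<Rightarrow> schwartz \<Rightarrow> real" where
  "schwartz_seminorm m k \<phi> = (SUP x. \<bar>x ^ m * (deriv ^^ k) (schwartz_fun \<phi>) x\<bar>)"

text \<open>The locally convex topology generated by the seminorms: a basic neighbourhood of a point
  restricts finitely many of them.\<close>

instantiation schwartz :: topological_space
begin

definition open_schwartz :: "schwartz set \<Rightarrow> bool" where
  "open_schwartz U \<longleftrightarrow>
     (\<forall>\<phi>\<in>U. \<exists>N e. e > 0 \<and>
        {\<psi>. \<forall>m\<le>N. \<forall>k\<le>N. schwartz_seminorm m k (\<psi> - \<phi>) < e} \<subseteq> U)"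

instance
proof
  show "open (UNIV :: schwartz set)"
    by (auto simp: open_schwartz_def intro: exI[of _ 1])
next
  fix U V :: "schwartz set"
  assume U: "open U" and V: "open V"
  show "open (U \<inter> V)"
    unfolding open_schwartz_def
  proof
    fix \<phi> assume \<phi>: "\<phi> \<in> U \<inter> V"
    obtain N e where 1: "e > 0"
        "{\<psi>. \<forall>m\<le>N. \<forall>k\<le>N. schwartz_seminorm m k (\<psi> - \<phi>) < e} \<subseteq> U"
      using U \<phi> unfolding open_schwartz_def by blast
    obtain N' e' where 2: "e' > 0"
        "{\<psi>. \<forall>m\<le>N'. \<forall>k\<le>N'. schwartz_seminorm m k (\<psi> - \<phi>) < e'} \<subseteq> V"
      using V \<phi> unfolding open_schwartz_def by blast
    have "{\<psi>. \<forall>m\<le>max N N'. \<forall>k\<le>max N N'. schwartz_seminorm m k (\<psi> - \<phi>) < min e e'} \<subseteq>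
          U \<inter> V"
      by (rule order_trans[OF _ Int_mono[OF 1(2) 2(2)]]) auto
    moreover have "min e e' > 0"
      using 1 2 by simp
    ultimately show "\<exists>N e. e > 0 \<and>
        {\<psi>. \<forall>m\<le>N. \<forall>k\<le>N. schwartz_seminorm m k (\<psi> - \<phi>) < e} \<subseteq> U \<inter> V"
      by blast
  qed
next
  fix K :: "schwartz set set"
  assume *: "\<forall>U\<in>K. open U"
  show "open (\<Union>K)"
    unfolding open_schwartz_def
  proof
    fix \<phi> assume "\<phi> \<in> \<Union>K"
    then obtain U where U: "U \<in> K" "\<phi> \<in> U" by blast
    with * obtain N e where "e > 0"
        "{\<psi>. \<forall>m\<le>N. \<forall>k\<le>N. schwartz_seminorm m k (\<psi> - \<phi>) < e} \<subseteq> U"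
      unfolding open_schwartz_def by meson
    with U show "\<exists>N e. e > 0 \<and>
        {\<psi>. \<forall>m\<le>N. \<forall>k\<le>N. schwartz_seminorm m k (\<psi> - \<phi>) < e} \<subseteq> \<Union>K"
      by (intro exI[of _ N] exI[of _ e]) blast
  qed
qed

end

text \<open>Boundedness in the locally convex space: every defining seminorm is bounded on the set.\<close>

definition schwartz_bounded :: "schwartz set \<Rightarrow> bool" where
  "schwartz_bounded B \<longleftrightarrow> (\<forall>m k. \<exists>C. \<forall>\<phi>\<in>B. schwartz_seminorm m k \<phi> \<le> C)"

lemma schwartz_bounded_Un:
  assumes "schwartz_bounded A" "schwartz_bounded B"
  shows "schwartz_bounded (A \<union> B)"
  unfolding schwartz_bounded_def
proof (intro allI)
  fix m k
  obtain C where C: "\<forall>\<phi>\<in>A. schwartz_seminorm m k \<phi> \<le> C"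
    using assms(1) unfolding schwartz_bounded_def by blast
  obtain D where D: "\<forall>\<phi>\<in>B. schwartz_seminorm m k \<phi> \<le> D"
    using assms(2) unfolding schwartz_bounded_def by blast
  with C show "\<exists>C. \<forall>\<phi>\<in>A \<union> B. schwartz_seminorm m k \<phi> \<le> C"
    by (intro exI[of _ "max C D"]) (auto simp: le_max_iff_disj)
qed

section \<open>Tempered distributions\<close>

typedef tempered = "{T :: schwartz \<Rightarrow> real. linear T \<and> continuous_on UNIV T}"
  morphisms pairing Abs_tempered
proof
  show "(\<lambda>\<phi>. 0) \<in> {T :: schwartz \<Rightarrow> real. linear T \<and> continuous_on UNIV T}"
    by (simp add: linear_iff)
qed

setup_lifting type_definition_tempered

instantiation tempered :: zero
begin

lift_definition zero_tempered :: tempered is "\<lambda>\<phi>. 0"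
  by (simp add: linear_iff)

instance ..

end

text \<open>The strong topology. Since finite unions of bounded sets are bounded, a single bounded set
  suffices in a basic neighbourhood.\<close>

instantiation tempered :: topological_space
begin

definition open_tempered :: "tempered set \<Rightarrow> bool" where
  "open_tempered U \<longleftrightarrow>
     (\<forall>x\<in>U. \<exists>B e. schwartz_bounded B \<and> e > 0 \<and>
        {y. \<forall>\<phi>\<in>B. \<bar>pairing y \<phi> - pairing x \<phi>\<bar> < e} \<subseteq> U)"

instance
proof
  have "schwartz_bounded {}"
    by (simp add: schwartz_bounded_def)
  then show "open (UNIV :: tempered set)"
    unfolding open_tempered_def using zero_less_one by blast
next
  fix U V :: "tempered set"
  assume U: "open U" and V: "open V"
  show "open (U \<inter> V)"
    unfolding open_tempered_def
  proof
    fix x assume x: "x \<in> U \<inter> V"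
    obtain B e where 1: "schwartz_bounded B" "e > 0"
        "{y. \<forall>\<phi>\<in>B. \<bar>pairing y \<phi> - pairing x \<phi>\<bar> < e} \<subseteq> U"
      using U x unfolding open_tempered_def by blast
    obtain B' e' where 2: "schwartz_bounded B'" "e' > 0"
        "{y. \<forall>\<phi>\<in>B'. \<bar>pairing y \<phi> - pairing x \<phi>\<bar> < e'} \<subseteq> V"
      using V x unfolding open_tempered_def by blast
    have "{y. \<forall>\<phi>\<in>B \<union> B'. \<bar>pairing y \<phi> - pairing x \<phi>\<bar> < min e e'} \<subseteq> U \<inter> V"
      using 1(3) 2(3) by auto
    moreover have "schwartz_bounded (B \<union> B')" "min e e' > 0"
      using 1 2 by (auto intro: schwartz_bounded_Un)
    ultimately show "\<exists>B e. schwartz_bounded B \<and> e > 0 \<and>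
        {y. \<forall>\<phi>\<in>B. \<bar>pairing y \<phi> - pairing x \<phi>\<bar> < e} \<subseteq> U \<inter> V"
      by blast
  qed
next
  fix K :: "tempered set set"
  assume *: "\<forall>U\<in>K. open U"
  show "open (\<Union>K)"
    unfolding open_tempered_def
  proof
    fix x assume "x \<in> \<Union>K"
    then obtain U where U: "U \<in> K" "x \<in> U" by blast
    with * obtain B e where "schwartz_bounded B" "e > 0"
        "{y. \<forall>\<phi>\<in>B. \<bar>pairing y \<phi> - pairing x \<phi>\<bar> < e} \<subseteq> U"
      unfolding open_tempered_def by meson
    with U show "\<exists>B e. schwartz_bounded B \<and> e > 0 \<and>
        {y. \<forall>\<phi>\<in>B. \<bar>pairing y \<phi> - pairing x \<phi>\<bar> < e} \<subseteq> \<Union>K"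
      by blast
  qed
qed

end

section \<open>Distributions given by functions, and laws of processes\<close>

definition represents :: "tempered \<Rightarrow> (real \<Rightarrow> real) \<Rightarrow> bool" where
  "represents x f \<longleftrightarrow>
     (\<forall>\<phi>. integrable lborel (\<lambda>t. f t * schwartz_fun \<phi> t) \<and>
          pairing x \<phi> = (LBINT t. f t * schwartz_fun \<phi> t))"

text \<open>At most one distribution represents a given function. The value 0 is assigned to functions
  that define no tempered distribution; for random paths this concerns only a null set.\<close>

definition distribution_of :: "(real \<Rightarrow> real) \<Rightarrow> tempered" where
  "distribution_of f = (if \<exists>x. represents x f then THE x. represents x f else 0)"

definition induced_measure :: "'a measure \<Rightarrow> (real \<Rightarrow> 'a \<Rightarrow> real) \<Rightarrow> tempered measure" where
  "induced_measure M X = distr M borel (\<lambda>\<omega>. distribution_of (\<lambda>t. X t \<omega>))"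

lemma distribution_of_eq:
  assumes "represents x f"
  shows "distribution_of f = x"
proof -
  have "y = x" if "represents y f" for y
    using that assms by (auto simp: represents_def fun_eq_iff simp flip: pairing_inject)
  with assms have "(THE x. represents x f) = x"
    by (rule the_equality)
  with assms show ?thesis
    unfolding distribution_of_def by metis
qed

definition white_noise_measure :: "tempered measure \<Rightarrow> bool" where
  "white_noise_measure \<mu> \<longleftrightarrow> prob_space \<mu> \<and> sets \<mu> = sets borel \<and>
     (\<forall>\<phi>. (\<integral>x. exp (\<i> * complex_of_real (pairing x \<phi>)) \<partial>\<mu>) =
          complex_of_real (exp (- (1 / 2) * (LBINT t. (schwartz_fun \<phi> t)\<^sup>2))))"

definition converges_weakly :: "(nat \<Rightarrow> 'a::topological_space measure) \<Rightarrow> 'a measure \<Rightarrow> bool" where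
  "converges_weakly P \<mu> \<longleftrightarrow>
     (\<forall>f :: 'a \<Rightarrow> real. continuous_on UNIV f \<and> bounded (range f) \<longrightarrow>
        (\<lambda>n. \<integral>x. f x \<partial>P n) \<longlonglongrightarrow> (\<integral>x. f x \<partial>\<mu>))"

end

theory Submission
  imports Defs
begin

text \<open>A functional bounded by a multiple of a Schwartz norm satisfies \<open>\<bar>x \<phi>\<bar> \<le> q \<parallel>\<phi>\<parallel>\<^sub>q\<close> for some \<open>q\<close>, and the set
  of all such functionals for a fixed \<open>q\<close> (a polar) is strongly compact, because bounded sets of test
  functions are totally bounded in each norm. On a polar, a continuous function is therefore uniformly
  approximated by trigonometric polynomials of the pairings (Stone--Weierstrass), so tightness on polars
  together with convergence of the characteristic functions gives weak convergence.

  The pairing of the step process with \<open>\<phi>\<close> is \<open>\<Sum>\<^sub>k \<xi>\<^sub>k b\<^sub>k\<close>, where \<open>b\<^sub>k\<close> is \<open>sqrt n\<close> times the integral of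
  \<open>\<phi>\<close> over \<open>[k/n, (k+1)/n)\<close>. Since \<open>\<Sum>\<^sub>k b\<^sub>k\<^sup>2\<close> tends to the integral of \<open>\<phi>\<^sup>2\<close> and the \<open>b\<^sub>k\<close> are uniformly
  small, the characteristic functions converge as in the central limit theorem. Summation by parts
  bounds the pairing by weighted partial sums of the \<open>\<xi>\<^sub>k\<close> times a Schwartz norm of \<open>\<phi>\<close>, and the
  expectation of these weighted sums is bounded in \<open>n\<close>; this is tightness.

  Borel measurability for the strong topology holds because, on a polar, every open set is a countable
  union of cylinder sets, while the representable step functions are exactly those of polynomial growth.\<close>

section \<open>Seminorms on the Schwartz space\<close>

text \<open>The strong topology is not metrizable, so the metric criteria for weak convergence do
  not apply directly; compact polars take their place. Convergence of characteristic functions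
  concerns one test function at a time, whereas tightness needs an event of large probability, not
  depending on the test function, on which all pairings are bounded at once. A termwise bound cannot
  give this uniformly in n: the sum of the absolute coefficients \<open>\<bar>b k\<bar>\<close> is
  of order sqrt n. Summation by parts exploits the cancellation in partial sums and separates the
  randomness (weighted partial sums, free of the test function) from the test function (decay of its
  cell integrals and of their differences). Every identity for the pairing is first proved for the
  finitely many cells with index in \<open>{- int L..<int L}\<close>; the limit in L is taken for
  fixed n, and n tends to infinity only afterwards, in explicit error bounds.\<close>

abbreviation sderiv :: "nat \<Rightarrow> schwartz \<Rightarrow> real \<Rightarrow> real" where
  "sderiv k \<phi> \<equiv> (deriv ^^ k) (schwartz_fun \<phi>)"

lemma is_schwartz_schwartz_fun: "is_schwartz (schwartz_fun \<phi>)"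
  using schwartz_fun[of \<phi>] by simp

lemma sderiv_DERIV: "(sderiv k \<phi> has_field_derivative sderiv (Suc k) \<phi> x) (at x)"
  using is_schwartz_schwartz_fun[of \<phi>]
  by (simp add: is_schwartz_def DERIV_deriv_iff_field_differentiable)

lemma continuous_on_sderiv: "continuous_on A (sderiv k \<phi>)"
  by (meson sderiv_DERIV DERIV_isCont continuous_at_imp_continuous_on)

lemma sderiv_measurable [measurable]: "sderiv k \<phi> \<in> borel_measurable borel"
  by (intro borel_measurable_continuous_onI continuous_on_sderiv)

lemma schwartz_fun_measurable [measurable]: "schwartz_fun \<phi> \<in> borel_measurable borel"
  using sderiv_measurable[of 0 \<phi>] by simp

lemma bdd_above_schwartz: "bdd_above (range (\<lambda>x. \<bar>x ^ m * sderiv k \<phi> x\<bar>))"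
proof -
  have "bounded (range (\<lambda>x. x ^ m * sderiv k \<phi> x))"
    using is_schwartz_schwartz_fun by (auto simp: is_schwartz_def)
  then obtain C where "\<forall>y\<in>range (\<lambda>x. x ^ m * sderiv k \<phi> x). norm y \<le> C"
    unfolding bounded_iff by blast
  then show ?thesis
    by (intro bdd_aboveI[of _ C]) auto
qed

lemma schwartz_seminorm_ge: "\<bar>x ^ m * sderiv k \<phi> x\<bar> \<le> schwartz_seminorm m k \<phi>"
  unfolding schwartz_seminorm_def by (rule cSUP_upper[OF UNIV_I bdd_above_schwartz])

lemma schwartz_seminorm_least:
  assumes "\<And>x. \<bar>x ^ m * sderiv k \<phi> x\<bar> \<le> C"
  shows "schwartz_seminorm m k \<phi> \<le> C"
  unfolding schwartz_seminorm_def using assms by (intro cSUP_least) auto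

lemma schwartz_seminorm_nonneg: "0 \<le> schwartz_seminorm m k \<phi>"
  using schwartz_seminorm_ge[of 0 m k \<phi>] by linarith

lemma sderiv_linear: "sderiv k (a *\<^sub>R \<phi> + b *\<^sub>R \<psi>) x = a * sderiv k \<phi> x + b * sderiv k \<psi> x"
proof -
  have "schwartz_fun (a *\<^sub>R \<phi> + b *\<^sub>R \<psi>) = (\<lambda>x. a * schwartz_fun \<phi> x + b * schwartz_fun \<psi> x)"
    by (simp add: plus_schwartz.rep_eq scaleR_schwartz.rep_eq)
  then show ?thesis
    using higher_deriv_linear[of "schwartz_fun \<phi>" "schwartz_fun \<psi>" k a b]
      is_schwartz_schwartz_fun[of \<phi>] is_schwartz_schwartz_fun[of \<psi>]
    by (simp add: is_schwartz_def)
qed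

lemma sderiv_add: "sderiv k (\<phi> + \<psi>) x = sderiv k \<phi> x + sderiv k \<psi> x"
  using sderiv_linear[of k 1 \<phi> 1 \<psi>] by simp

lemma sderiv_scaleR: "sderiv k (a *\<^sub>R \<phi>) x = a * sderiv k \<phi> x"
  using sderiv_linear[of k a \<phi> 0 \<phi>] by simp

lemma sderiv_diff: "sderiv k (\<phi> - \<psi>) x = sderiv k \<phi> x - sderiv k \<psi> x"
  using sderiv_linear[of k 1 \<phi> "-1" \<psi>] by simp

lemma schwartz_seminorm_triangle:
  "schwartz_seminorm m k (\<phi> + \<psi>) \<le> schwartz_seminorm m k \<phi> + schwartz_seminorm m k \<psi>"
proof (rule schwartz_seminorm_least)
  fix x
  have "\<bar>x ^ m * sderiv k (\<phi> + \<psi>) x\<bar> \<le> \<bar>x ^ m * sderiv k \<phi> x\<bar> + \<bar>x ^ m * sderiv k \<psi> x\<bar>"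
    unfolding sderiv_add distrib_left by (rule abs_triangle_ineq)
  then show "\<bar>x ^ m * sderiv k (\<phi> + \<psi>) x\<bar> \<le> schwartz_seminorm m k \<phi> + schwartz_seminorm m k \<psi>"
    using schwartz_seminorm_ge[of x m k \<phi>] schwartz_seminorm_ge[of x m k \<psi>] by linarith
qed

lemma schwartz_seminorm_scaleR_le: "schwartz_seminorm m k (a *\<^sub>R \<phi>) \<le> \<bar>a\<bar> * schwartz_seminorm m k \<phi>"
proof (rule schwartz_seminorm_least)
  fix x
  have "\<bar>x ^ m * sderiv k (a *\<^sub>R \<phi>) x\<bar> = \<bar>a\<bar> * \<bar>x ^ m * sderiv k \<phi> x\<bar>"
    by (simp add: sderiv_scaleR abs_mult)
  also have "\<dots> \<le> \<bar>a\<bar> * schwartz_seminorm m k \<phi>"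
    by (intro mult_left_mono schwartz_seminorm_ge) simp
  finally show "\<bar>x ^ m * sderiv k (a *\<^sub>R \<phi>) x\<bar> \<le> \<bar>a\<bar> * schwartz_seminorm m k \<phi>" .
qed

text \<open>One index bounds both the power and the order of the derivative. This turns the double
  family of seminorms into a single increasing sequence, so continuity and boundedness involve one
  index only.\<close>

definition schwartz_norm :: "nat \<Rightarrow> schwartz \<Rightarrow> real" where
  "schwartz_norm N \<phi> = (\<Sum>m\<le>N. \<Sum>k\<le>N. schwartz_seminorm m k \<phi>)"

lemma schwartz_norm_nonneg: "0 \<le> schwartz_norm N \<phi>"
  unfolding schwartz_norm_def by (intro sum_nonneg schwartz_seminorm_nonneg)

lemma schwartz_seminorm_le_norm:
  assumes "m \<le> N" "k \<le> N"
  shows "schwartz_seminorm m k \<phi> \<le> schwartz_norm N \<phi>"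
proof -
  have "schwartz_seminorm m k \<phi> \<le> (\<Sum>k\<le>N. schwartz_seminorm m k \<phi>)"
    using assms by (intro member_le_sum) (auto intro: schwartz_seminorm_nonneg)
  also have "\<dots> \<le> schwartz_norm N \<phi>"
    unfolding schwartz_norm_def using assms
    by (intro member_le_sum) (auto intro: schwartz_seminorm_nonneg sum_nonneg)
  finally show ?thesis .
qed

lemma schwartz_norm_mono:
  assumes "N \<le> N'"
  shows "schwartz_norm N \<phi> \<le> schwartz_norm N' \<phi>"
proof -
  have "schwartz_norm N \<phi> \<le> (\<Sum>m\<le>N. \<Sum>k\<le>N'. schwartz_seminorm m k \<phi>)"
    unfolding schwartz_norm_def using assms
    by (intro sum_mono sum_mono2) (auto intro: schwartz_seminorm_nonneg)
  also have "\<dots> \<le> schwartz_norm N' \<phi>"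
    unfolding schwartz_norm_def using assms
    by (intro sum_mono2) (auto intro: schwartz_seminorm_nonneg sum_nonneg)
  finally show ?thesis .
qed

lemma schwartz_norm_least:
  assumes "\<And>m k. m \<le> N \<Longrightarrow> k \<le> N \<Longrightarrow> schwartz_seminorm m k \<phi> \<le> C"
  shows "schwartz_norm N \<phi> \<le> (real N + 1)\<^sup>2 * C"
proof -
  have "schwartz_norm N \<phi> \<le> (\<Sum>m\<le>N. \<Sum>k\<le>N. C)"
    unfolding schwartz_norm_def using assms by (intro sum_mono) auto
  then show ?thesis
    by (simp add: power2_eq_square algebra_simps)
qed

lemma schwartz_norm_scaleR_le: "schwartz_norm N (a *\<^sub>R \<phi>) \<le> \<bar>a\<bar> * schwartz_norm N \<phi>"
  unfolding schwartz_norm_def sum_distrib_left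
  by (intro sum_mono schwartz_seminorm_scaleR_le)

lemma schwartz_norm_triangle: "schwartz_norm N (\<phi> + \<psi>) \<le> schwartz_norm N \<phi> + schwartz_norm N \<psi>"
  unfolding schwartz_norm_def sum.distrib[symmetric]
  by (intro sum_mono schwartz_seminorm_triangle)

lemma schwartz_bounded_iff: "schwartz_bounded B \<longleftrightarrow> (\<forall>N. \<exists>C. \<forall>\<phi>\<in>B. schwartz_norm N \<phi> \<le> C)"
proof
  assume B: "schwartz_bounded B"
  show "\<forall>N. \<exists>C. \<forall>\<phi>\<in>B. schwartz_norm N \<phi> \<le> C"
  proof
    fix N
    obtain C where C: "\<And>m k \<phi>. \<phi> \<in> B \<Longrightarrow> schwartz_seminorm m k \<phi> \<le> C m k"
      using B unfolding schwartz_bounded_def by metis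
    have "\<forall>\<phi>\<in>B. schwartz_norm N \<phi> \<le> (\<Sum>m\<le>N. \<Sum>k\<le>N. C m k)"
      unfolding schwartz_norm_def by (auto intro!: sum_mono C)
    then show "\<exists>C. \<forall>\<phi>\<in>B. schwartz_norm N \<phi> \<le> C" ..
  qed
next
  assume "\<forall>N. \<exists>C. \<forall>\<phi>\<in>B. schwartz_norm N \<phi> \<le> C"
  then show "schwartz_bounded B"
    unfolding schwartz_bounded_def
    by (meson schwartz_seminorm_le_norm order_trans max.cobounded1 max.cobounded2)
qed

lemma schwartz_bounded_singleton: "schwartz_bounded {\<phi>}"
  by (auto simp: schwartz_bounded_def)

lemma continuous_linear_schwartz_bound:
  assumes "linear T" "continuous_on UNIV (T :: schwartz \<Rightarrow> real)"
  obtains N C where "C \<ge> 0" "\<And>\<phi>. \<bar>T \<phi>\<bar> \<le> C * schwartz_norm N \<phi>"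
proof -
  interpret linear T by fact
  have "open (T -` {-1<..<1})"
    using assms(2) by (intro open_vimage) auto
  moreover have "0 \<in> T -` {-1<..<1}"
    by (simp add: zero)
  ultimately obtain N e where e: "e > 0"
      "{\<psi>. \<forall>m\<le>N. \<forall>k\<le>N. schwartz_seminorm m k (\<psi> - 0) < e} \<subseteq> T -` {-1<..<1}"
    unfolding open_schwartz_def by blast
  have small: "\<bar>T \<psi>\<bar> < 1" if "schwartz_norm N \<psi> < e" for \<psi>
  proof -
    have "\<psi> \<in> T -` {-1<..<1}"
      using that by (intro e(2)[THEN subsetD]) (auto intro: le_less_trans[OF schwartz_seminorm_le_norm])
    then show ?thesis by (auto simp: abs_less_iff)
  qed
  have "\<bar>T \<phi>\<bar> \<le> (2 / e) * schwartz_norm N \<phi>" for \<phi>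
  proof (cases "T \<phi> = 0")
    case True
    then show ?thesis using e(1) schwartz_norm_nonneg[of N \<phi>] by simp
  next
    case False
    show ?thesis
    proof (rule ccontr)
      assume "\<not> ?thesis"
      then have *: "2 * schwartz_norm N \<phi> < e * \<bar>T \<phi>\<bar>"
        using e(1) by (simp add: field_simps)
      \<comment> \<open>Rescaling makes the value of \<open>T\<close> equal to 2, which is
        incompatible with the bound 1 on the ball of radius \<open>e\<close>.\<close>
      have "schwartz_norm N ((2 / T \<phi>) *\<^sub>R \<phi>) \<le> \<bar>2 / T \<phi>\<bar> * schwartz_norm N \<phi>"
        by (rule schwartz_norm_scaleR_le)
      also have "\<dots> < e"
        using * False by (simp add: field_simps)
      finally have "\<bar>T ((2 / T \<phi>) *\<^sub>R \<phi>)\<bar> < 1"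
        by (rule small)
      then show False
        using False by (simp add: scale)
    qed
  qed
  then show thesis
    using e(1) by (intro that[of "2 / e" N]) auto
qed

lemma bounded_linear_schwartz_continuous:
  assumes "linear T" "\<And>\<phi>. \<bar>T \<phi>\<bar> \<le> C * schwartz_norm N \<phi>"
  shows "continuous_on UNIV (T :: schwartz \<Rightarrow> real)"
proof -
  interpret linear T by fact
  have "open (T -` U)" if "open U" for U
    unfolding open_schwartz_def
  proof
    fix \<phi> assume "\<phi> \<in> T -` U"
    then obtain d where d: "d > 0" "\<And>y. \<bar>y - T \<phi>\<bar> < d \<Longrightarrow> y \<in> U"
      using \<open>open U\<close> by (auto simp: open_dist dist_real_def)
    \<comment> \<open>There are (N+1)^2 seminorms in the norm; \<open>\<bar>C\<bar> + 1\<close>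
      allows for a zero or negative \<open>C\<close>.\<close>
    define e where "e = d / ((real N + 1)\<^sup>2 * (\<bar>C\<bar> + 1))"
    have "e > 0"
      using d by (auto simp: e_def intro!: divide_pos_pos mult_pos_pos)
    have "\<psi> \<in> T -` U" if \<psi>: "\<forall>m\<le>N. \<forall>k\<le>N. schwartz_seminorm m k (\<psi> - \<phi>) < e" for \<psi>
    proof -
      have "\<bar>T \<psi> - T \<phi>\<bar> = \<bar>T (\<psi> - \<phi>)\<bar>" by (simp add: diff)
      also have "\<dots> \<le> C * schwartz_norm N (\<psi> - \<phi>)" by (rule assms)
      also have "\<dots> \<le> \<bar>C\<bar> * schwartz_norm N (\<psi> - \<phi>)"
        by (intro mult_right_mono schwartz_norm_nonneg) auto
      also have "\<dots> \<le> \<bar>C\<bar> * ((real N + 1)\<^sup>2 * e)"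
        using \<psi> by (intro mult_left_mono schwartz_norm_least) (auto intro: less_imp_le)
      also have "\<dots> < (\<bar>C\<bar> + 1) * ((real N + 1)\<^sup>2 * e)"
        using \<open>e > 0\<close> by (intro mult_strict_right_mono) auto
      also have "\<dots> = d"
        using add_pos_nonneg[of 1 "\<bar>C\<bar>"] by (auto simp: e_def)
      finally show ?thesis using d by auto
    qed
    then show "\<exists>N e. e > 0 \<and> {\<psi>. \<forall>m\<le>N. \<forall>k\<le>N. schwartz_seminorm m k (\<psi> - \<phi>) < e} \<subseteq> T -` U"
      using \<open>e > 0\<close> by blast
  qed
  then show ?thesis
    by (simp add: continuous_on_open_vimage)
qed

section \<open>Polars of the Schwartz norms\<close>

lemma linear_pairing: "linear (pairing x)"
  using pairing[of x] by simp

lemma continuous_pairing: "continuous_on UNIV (pairing x)"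
  using pairing[of x] by simp

lemmas pairing_add = linear_add[OF linear_pairing]
  and pairing_diff = linear_diff[OF linear_pairing]
  and pairing_scaleR = linear_scale[OF linear_pairing]
  and pairing_zero = linear_0[OF linear_pairing]

lemma continuous_pairing_left: "continuous_on UNIV (\<lambda>x. pairing x \<phi>)"
proof -
  have "open ((\<lambda>x. pairing x \<phi>) -` U)" if "open U" for U
    unfolding open_tempered_def
  proof
    fix x assume "x \<in> (\<lambda>x. pairing x \<phi>) -` U"
    then obtain d where "d > 0" "\<And>y. \<bar>y - pairing x \<phi>\<bar> < d \<Longrightarrow> y \<in> U"
      using \<open>open U\<close> by (auto simp: open_dist dist_real_def)
    then show "\<exists>B e. schwartz_bounded B \<and> e > 0 \<and>
        {y. \<forall>\<psi>\<in>B. \<bar>pairing y \<psi> - pairing x \<psi>\<bar> < e} \<subseteq> (\<lambda>x. pairing x \<phi>) -` U"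
      by (intro exI[of _ "{\<phi>}"] exI[of _ d]) (auto intro: schwartz_bounded_singleton)
  qed
  then show ?thesis
    by (simp add: continuous_on_open_vimage)
qed

lemma pairing_measurable [measurable]: "(\<lambda>x. pairing x \<phi>) \<in> borel_measurable borel"
  by (rule borel_measurable_continuous_onI[OF continuous_pairing_left])

lemma tempered_eqI: "(\<And>\<phi>. pairing x \<phi> = pairing y \<phi>) \<Longrightarrow> x = y"
  by (simp add: fun_eq_iff flip: pairing_inject)

text \<open>The Stone--Weierstrass theorem, applied on polars below, is stated for Hausdorff types.
  Single pairings already separate points.\<close>

instance tempered :: t2_space
proof
  fix x y :: tempered assume "x \<noteq> y"
  then obtain \<phi> where "pairing x \<phi> \<noteq> pairing y \<phi>"
    using tempered_eqI by blast
  then obtain U V where UV: "open U" "open V" "pairing x \<phi> \<in> U" "pairing y \<phi> \<in> V" "U \<inter> V = {}"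
    by (metis hausdorff)
  show "\<exists>U V. open U \<and> open V \<and> x \<in> U \<and> y \<in> V \<and> U \<inter> V = {}"
    using UV by (intro exI[of _ "(\<lambda>x. pairing x \<phi>) -` U"] exI[of _ "(\<lambda>x. pairing x \<phi>) -` V"])
      (auto intro!: open_vimage continuous_pairing_left)
qed

text \<open>Up to scaling, the polar of the unit ball of \<open>schwartz_norm q\<close>. The same
  \<open>q\<close> serves as constant and as index of the norm, so that these sets form one
  increasing sequence that exhausts the dual.\<close>

definition polar :: "nat \<Rightarrow> tempered set" where
  "polar q = {x. \<forall>\<phi>. \<bar>pairing x \<phi>\<bar> \<le> real q * schwartz_norm q \<phi>}"

lemma closed_polar: "closed (polar q)"
  unfolding polar_def Collect_all_eq
  by (intro closed_INT ballI closed_Collect_le continuous_intros continuous_pairing_left)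

lemma mem_polarI:
  assumes "\<And>\<phi>. \<bar>pairing x \<phi>\<bar> \<le> C * schwartz_norm N \<phi>" "N \<le> q" "C \<le> real q"
  shows "x \<in> polar q"
  unfolding polar_def
proof (intro CollectI allI)
  fix \<phi>
  have "\<bar>pairing x \<phi>\<bar> \<le> C * schwartz_norm N \<phi>" by fact
  also have "\<dots> \<le> real q * schwartz_norm q \<phi>"
    using assms by (intro mult_mono schwartz_norm_mono schwartz_norm_nonneg) auto
  finally show "\<bar>pairing x \<phi>\<bar> \<le> real q * schwartz_norm q \<phi>" .
qed

lemma incseq_polar: "incseq polar"
  by (intro monoI subsetI mem_polarI) (auto simp: polar_def)

lemma UN_polar: "(\<Union>q. polar q) = UNIV"
proof -
  have "\<exists>q. x \<in> polar q" for x
  proof -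
    obtain N C where "C \<ge> 0" "\<And>\<phi>. \<bar>pairing x \<phi>\<bar> \<le> C * schwartz_norm N \<phi>"
      using continuous_linear_schwartz_bound[OF linear_pairing continuous_pairing] by metis
    then have "x \<in> polar (max N (nat \<lceil>C\<rceil>))"
      by (intro mem_polarI) (auto intro: order_trans[OF real_nat_ceiling_ge])
    then show ?thesis ..
  qed
  then show ?thesis by auto
qed

section \<open>Compactness\<close>

lemma sderiv_lipschitz:
  assumes "\<And>x. \<bar>sderiv (Suc k) \<phi> x\<bar> \<le> R"
  shows "\<bar>sderiv k \<phi> x - sderiv k \<phi> y\<bar> \<le> R * \<bar>x - y\<bar>"
proof -
  have "norm (sderiv k \<phi> x - sderiv k \<phi> y) \<le> R * norm (x - y)"
    by (rule field_differentiable_bound[where S = UNIV and f' = "sderiv (Suc k) \<phi>"])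
      (use assms sderiv_DERIV in auto)
  then show ?thesis by simp
qed

lemma abs_power_sderiv_le_norm:
  assumes "m \<le> N" "k \<le> N"
  shows "\<bar>x ^ m * sderiv k \<phi> x\<bar> \<le> schwartz_norm N \<phi>"
  using schwartz_seminorm_ge schwartz_seminorm_le_norm[OF assms] by (rule order_trans)

text \<open>Elements of a ball of one norm are classified, up to a small error in the next weaker norm, by
  the rounded values of their derivatives on a grid: the extra derivative controls the values between
  grid points, and the extra power of \<open>x\<close> the values outside the grid.\<close>

lemma schwartz_finite_classes:
  assumes "e > 0"
  obtains c :: "schwartz \<Rightarrow> nat \<times> int \<Rightarrow> int"
  where "finite (c ` {\<phi>. schwartz_norm (Suc p) \<phi> \<le> R})"
    and "\<And>\<phi> \<psi>. schwartz_norm (Suc p) \<phi> \<le> R \<Longrightarrow> schwartz_norm (Suc p) \<psi> \<le> R \<Longrightarrow> c \<phi> = c \<psi> \<Longrightarrow>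
           schwartz_norm p (\<phi> - \<psi>) < e"
proof -
  \<comment> \<open>An equal share for each of the (p+1)^2 seminorms; the factor 2 yields the strict
    inequality at the end.\<close>
  define e' where "e' = e / (2 * (real p + 1)\<^sup>2)"
  have "e' > 0" using assms by (auto simp: e'_def intro!: divide_pos_pos mult_pos_pos)
  \<comment> \<open>Beyond \<open>\<bar>x\<bar> > L\<close> the extra power of \<open>x\<close>
    gains a factor 1/L on the bound \<open>2 * R\<close> for a difference of two elements of the
    ball.\<close>
  obtain L0 :: nat where L0: "2 * R / e' < real L0" using reals_Archimedean2 by blast
  define L where "L = max 1 L0"
  have L: "L \<ge> 1" "2 * R \<le> real L * e'"
  proof -
    have "2 * R / e' \<le> real L" using L0 by (simp add: L_def)
    then show "2 * R \<le> real L * e'" using \<open>e' > 0\<close> by (simp add: field_simps)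
  qed (simp add: L_def)
  \<comment> \<open>In \<open>(1 + 2 * R) / h\<close> the 1 comes from rounding values to multiples
    of 1/h and \<open>2 * R\<close> from the Lipschitz bound across a grid step of length at most
    1/h; \<open>L ^ p\<close> bounds the power of \<open>x\<close> on the grid.\<close>
  obtain h0 :: nat where h0: "real L ^ p * (1 + 2 * R) / e' < real h0" using reals_Archimedean2 by blast
  define h where "h = max 1 h0"
  have h: "h \<ge> 1" "real L ^ p * ((1 + 2 * R) / h) \<le> e'"
  proof -
    have "real L ^ p * (1 + 2 * R) / e' \<le> real h" using h0 by (simp add: h_def)
    then show "real L ^ p * ((1 + 2 * R) / h) \<le> e'" using \<open>e' > 0\<close> by (simp add: h_def field_simps)
  qed (simp add: h_def)
  define A where "A = {..p} \<times> {- (int L * int h)..int L * int h}"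
  \<comment> \<open>The number \<open>h\<close> is at once the fineness of the grid and the
    precision of the rounding. Restricting to the finite set \<open>A\<close> places all classes in
    a finite product of integer intervals.\<close>
  define c :: "schwartz \<Rightarrow> nat \<times> int \<Rightarrow> int"
    where "c \<phi> = restrict (\<lambda>(k, i). \<lfloor>real h * sderiv k \<phi> (real_of_int i / real h)\<rfloor>) A" for \<phi>
  show thesis
  proof
    have "c ` {\<phi>. schwartz_norm (Suc p) \<phi> \<le> R} \<subseteq> PiE A (\<lambda>_. {\<lfloor>- (real h * R)\<rfloor>..\<lfloor>real h * R\<rfloor>})"
    proof (rule image_subsetI)
      fix \<phi> assume "\<phi> \<in> {\<phi>. schwartz_norm (Suc p) \<phi> \<le> R}"
      then have \<phi>: "schwartz_norm (Suc p) \<phi> \<le> R" by simp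
      show "c \<phi> \<in> PiE A (\<lambda>_. {\<lfloor>- (real h * R)\<rfloor>..\<lfloor>real h * R\<rfloor>})"
      proof (rule PiE_I)
        fix z assume z: "z \<in> A"
        obtain k i where ki: "z = (k, i)" "k \<le> p" using z by (auto simp: A_def)
        have "\<bar>sderiv k \<phi> (real_of_int i / real h)\<bar> \<le> R"
          using abs_power_sderiv_le_norm[of 0 "Suc p" k "real_of_int i / real h" \<phi>] ki \<phi> by simp
        then have "\<bar>real h * sderiv k \<phi> (real_of_int i / real h)\<bar> \<le> real h * R"
          by (simp add: abs_mult mult_left_mono)
        then show "c \<phi> z \<in> {\<lfloor>- (real h * R)\<rfloor>..\<lfloor>real h * R\<rfloor>}"
          using z unfolding ki c_def by (auto intro!: floor_mono simp: abs_le_iff)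
      qed (simp add: c_def)
    qed
    moreover have "finite (PiE A (\<lambda>_. {\<lfloor>- (real h * R)\<rfloor>..\<lfloor>real h * R\<rfloor>}))"
      by (intro finite_PiE) (auto simp: A_def)
    ultimately show "finite (c ` {\<phi>. schwartz_norm (Suc p) \<phi> \<le> R})"
      by (rule finite_subset)
  next
    fix \<phi> \<psi> assume bd: "schwartz_norm (Suc p) \<phi> \<le> R" "schwartz_norm (Suc p) \<psi> \<le> R"
      and eq: "c \<phi> = c \<psi>"
    define \<eta> where "\<eta> = \<phi> - \<psi>"
    have \<eta>: "\<bar>x ^ m * sderiv k \<eta> x\<bar> \<le> 2 * R" if "m \<le> Suc p" "k \<le> Suc p" for m k x
      using abs_power_sderiv_le_norm[OF that, of x \<phi>] abs_power_sderiv_le_norm[OF that, of x \<psi>] bd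
      unfolding \<eta>_def sderiv_diff right_diff_distrib by linarith
    have grid: "\<bar>sderiv k \<eta> (i / h)\<bar> \<le> 1 / h" if "k \<le> p" "i \<in> {- (int L * int h)..int L * int h}" for k i
    proof -
      have "\<lfloor>h * sderiv k \<phi> (i / h)\<rfloor> = \<lfloor>h * sderiv k \<psi> (i / h)\<rfloor>"
        using fun_cong[OF eq, of "(k, i)"] that by (simp add: c_def A_def)
      then have "\<bar>h * sderiv k \<phi> (i / h) - h * sderiv k \<psi> (i / h)\<bar> \<le> 1"
        by linarith
      then have "h * \<bar>sderiv k \<eta> (i / h)\<bar> \<le> 1"
        unfolding \<eta>_def sderiv_diff by (metis abs_mult abs_of_nat right_diff_distrib)
      then show ?thesis using h by (simp add: field_simps)
    qed
    have "schwartz_norm p \<eta> \<le> (real p + 1)\<^sup>2 * e'"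
    proof (intro schwartz_norm_least schwartz_seminorm_least)
      fix m k x assume mk: "m \<le> p" "k \<le> p"
      show "\<bar>x ^ m * sderiv k \<eta> x\<bar> \<le> e'"
      proof (cases "\<bar>x\<bar> \<le> real L")
        case True
        define i where "i = \<lfloor>real h * x\<rfloor>"
        have "\<bar>real h * x\<bar> \<le> real (L * h)" using True by (simp add: abs_mult mult.commute mult_right_mono)
        then have i: "i \<in> {- (int L * int h)..int L * int h}"
          unfolding i_def by (auto simp: le_floor_iff floor_le_iff abs_le_iff)
        have "\<bar>h * x - i\<bar> \<le> 1" unfolding i_def by linarith
        then have "\<bar>x - i / h\<bar> \<le> 1 / h"
        proof -
          have "\<bar>x - i / h\<bar> = \<bar>h * x - i\<bar> / h" using h(1) by (simp add: field_simps abs_divide[symmetric])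
          then show ?thesis using \<open>\<bar>h * x - i\<bar> \<le> 1\<close> by (simp add: divide_right_mono)
        qed
        have R: "R \<ge> 0" using bd(1) schwartz_norm_nonneg order_trans by blast
        have "\<bar>sderiv k \<eta> x - sderiv k \<eta> (i / h)\<bar> \<le> (2 * R) * \<bar>x - i / h\<bar>"
          using \<eta>[of 0 "Suc k"] mk by (intro sderiv_lipschitz) simp
        also have "\<dots> \<le> (2 * R) * (1 / h)" using R \<open>\<bar>x - i / h\<bar> \<le> 1 / h\<close> by (intro mult_left_mono) auto
        finally have "\<bar>sderiv k \<eta> x\<bar> \<le> (1 + 2 * R) / h"
          using grid[OF mk(2) i] by (simp add: add_divide_distrib)
        moreover have "\<bar>x ^ m\<bar> \<le> real L ^ p"
        proof -
          have "\<bar>x ^ m\<bar> \<le> real L ^ m" using True by (simp add: power_abs power_mono)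
          also have "\<dots> \<le> real L ^ p" using mk L by (intro power_increasing) auto
          finally show ?thesis .
        qed
        ultimately have "\<bar>x ^ m\<bar> * \<bar>sderiv k \<eta> x\<bar> \<le> real L ^ p * ((1 + 2 * R) / h)"
          by (intro mult_mono) auto
        then show ?thesis using h(2) by (simp add: abs_mult)
      next
        case False
        have "real L * \<bar>x ^ m * sderiv k \<eta> x\<bar> \<le> \<bar>x\<bar> * \<bar>x ^ m * sderiv k \<eta> x\<bar>"
          using False by (intro mult_right_mono) auto
        also have "\<dots> = \<bar>x ^ Suc m * sderiv k \<eta> x\<bar>" by (simp add: abs_mult)
        also have "\<dots> \<le> 2 * R" using mk by (intro \<eta>) auto
        also have "\<dots> \<le> real L * e'" by (rule L)
        finally show ?thesis using L(1) by simp
      qed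
    qed
    also have "\<dots> = e / 2"
    proof -
      have "(real p + 1)\<^sup>2 \<noteq> 0" by auto
      then show ?thesis unfolding e'_def by (simp add: field_simps)
    qed
    finally show "schwartz_norm p (\<phi> - \<psi>) < e" using assms by (simp add: \<eta>_def)
  qed
qed

text \<open>Total boundedness: one representative in \<open>B\<close> is kept for each of the
  finitely many classes.\<close>

lemma schwartz_bounded_finite_net:
  assumes "schwartz_bounded B" "e > 0"
  obtains F where "finite F" "F \<subseteq> B" "\<And>\<phi>. \<phi> \<in> B \<Longrightarrow> \<exists>\<psi>\<in>F. schwartz_norm p (\<phi> - \<psi>) < e"
proof -
  obtain R where R: "\<And>\<phi>. \<phi> \<in> B \<Longrightarrow> schwartz_norm (Suc p) \<phi> \<le> R"
    using assms(1) unfolding schwartz_bounded_iff by blast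
  obtain c where c: "finite (c ` {\<phi>. schwartz_norm (Suc p) \<phi> \<le> R})"
    "\<And>\<phi> \<psi>. schwartz_norm (Suc p) \<phi> \<le> R \<Longrightarrow> schwartz_norm (Suc p) \<psi> \<le> R \<Longrightarrow>
       c \<phi> = (c \<psi> :: nat \<times> int \<Rightarrow> int) \<Longrightarrow> schwartz_norm p (\<phi> - \<psi>) < e"
    using schwartz_finite_classes[OF assms(2), of p R] by metis
  have "finite (c ` B)"
    by (rule finite_subset[OF _ c(1)]) (use R in auto)
  then obtain F where "F \<subseteq> B" "finite F" "c ` B = c ` F"
    using finite_subset_image[of "c ` B" c B] by auto
  show thesis
  proof (rule that[of F])
    fix \<phi> assume "\<phi> \<in> B"
    then obtain \<psi> where \<psi>: "\<psi> \<in> F" "c \<phi> = c \<psi>"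
      using \<open>c ` B = c ` F\<close> by (metis imageE imageI)
    then have "schwartz_norm p (\<phi> - \<psi>) < e"
      using R \<open>\<phi> \<in> B\<close> \<open>F \<subseteq> B\<close> by (intro c(2)) auto
    with \<psi> show "\<exists>\<psi>\<in>F. schwartz_norm p (\<phi> - \<psi>) < e" by blast
  qed fact+
qed

text \<open>Finite nets of the balls of integer radius, with precision 1/(l+1), are united over all
  norms, radii and precisions, so that one countable set is dense for all norms
  simultaneously.\<close>

lemma schwartz_separable:
  obtains D where "countable D" "\<And>p e \<phi>. e > 0 \<Longrightarrow> \<exists>\<psi>\<in>D. schwartz_norm p (\<phi> - \<psi>) < e"
proof -
  have "\<exists>F. finite F \<and> (\<forall>\<phi>. schwartz_norm (Suc p) \<phi> \<le> real j \<longrightarrow>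
      (\<exists>\<psi>\<in>F. schwartz_norm p (\<phi> - \<psi>) < 1 / real (Suc l)))" for p j l :: nat
  proof -
    let ?B = "{\<phi>. schwartz_norm (Suc p) \<phi> \<le> real j}"
    have "1 / real (Suc l) > 0" by simp
    from schwartz_finite_classes[OF this, of p "real j"]
    obtain c where c: "finite (c ` ?B)"
      "\<And>\<phi> \<psi>. schwartz_norm (Suc p) \<phi> \<le> real j \<Longrightarrow> schwartz_norm (Suc p) \<psi> \<le> real j \<Longrightarrow>
       c \<phi> = (c \<psi> :: nat \<times> int \<Rightarrow> int) \<Longrightarrow> schwartz_norm p (\<phi> - \<psi>) < 1 / real (Suc l)"
      by metis
    obtain F where F: "F \<subseteq> ?B" "finite F" "c ` ?B = c ` F"
      using finite_subset_image[OF c(1), of c ?B] by auto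
    have "\<exists>\<psi>\<in>F. schwartz_norm p (\<phi> - \<psi>) < 1 / real (Suc l)" if B: "\<phi> \<in> ?B" for \<phi>
    proof -
      obtain \<psi> where \<psi>: "\<psi> \<in> F" "c \<phi> = c \<psi>"
        using imageI[OF B, of c] unfolding F(3) by auto
      then have "schwartz_norm p (\<phi> - \<psi>) < 1 / real (Suc l)"
        using that F(1) by (intro c(2)) auto
      with \<psi> show ?thesis by blast
    qed
    then show ?thesis using F(2) by blast
  qed
  then obtain F where F: "\<And>p j l. finite (F p j l)"
    "\<And>p j l \<phi>. schwartz_norm (Suc p) \<phi> \<le> real j \<Longrightarrow>
      \<exists>\<psi>\<in>F p j l. schwartz_norm p (\<phi> - \<psi>) < 1 / real (Suc l)"
    by metis
  show thesis
  proof
    show "countable (\<Union>p. \<Union>j. \<Union>l. F p j l)"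
      by (intro countable_UN countableI_type countable_finite[OF F(1)])
    fix p and e :: real and \<phi> :: schwartz assume "e > 0"
    obtain j :: nat where "schwartz_norm (Suc p) \<phi> \<le> real j" using real_arch_simple by blast
    moreover obtain l where "1 / real (Suc l) < e"
      using \<open>e > 0\<close> by (metis nat_approx_posE)
    ultimately obtain \<psi> where "\<psi> \<in> F p j l" "schwartz_norm p (\<phi> - \<psi>) < e"
      using F(2)[of p \<phi> j l] by (auto intro: less_trans)
    then show "\<exists>\<psi>\<in>(\<Union>p. \<Union>j. \<Union>l. F p j l). schwartz_norm p (\<phi> - \<psi>) < e"
      by blast
  qed
qed

text \<open>On a polar, the strong topology is that of pointwise convergence.\<close>

lemma pairing_diff_bound:
  assumes "x \<in> polar q" "y \<in> polar q"
  shows "\<bar>pairing y \<phi> - pairing x \<phi>\<bar> \<le>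
    \<bar>pairing y \<psi> - pairing x \<psi>\<bar> + 2 * (real q * schwartz_norm q (\<phi> - \<psi>))"
proof -
  have "\<bar>pairing y (\<phi> - \<psi>)\<bar> \<le> real q * schwartz_norm q (\<phi> - \<psi>)"
    "\<bar>pairing x (\<phi> - \<psi>)\<bar> \<le> real q * schwartz_norm q (\<phi> - \<psi>)"
    using assms by (auto simp: polar_def)
  then show ?thesis
    unfolding pairing_diff by linarith
qed

text \<open>Banach--Alaoglu, strengthened: the linear functionals with the pointwise bound form a
  closed subset of a compact product of intervals, and on that set the passage from the product
  topology to the strong topology is continuous because bounded sets of test functions have finite
  nets.\<close>

lemma compact_polar: "compact (polar q)"
proof -
  define Z where "Z = {T :: schwartz \<Rightarrow> real. linear T \<and>
      (\<forall>\<phi>. T \<phi> \<in> {- (real q * schwartz_norm q \<phi>)..real q * schwartz_norm q \<phi>})}"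
  let ?I = "\<lambda>\<phi>. {- (real q * schwartz_norm q \<phi>)..real q * schwartz_norm q \<phi>}"
  have "compact (PiE UNIV ?I)"
    using compactin_PiE[of "\<lambda>_::schwartz. euclideanreal" UNIV ?I]
    by (simp add: euclidean_product_topology)
  moreover have "closed {T :: schwartz \<Rightarrow> real. linear T}"
  proof -
    have "{T :: schwartz \<Rightarrow> real. linear T} =
        (\<Inter>\<phi>. \<Inter>\<psi>. {T. T (\<phi> + \<psi>) = T \<phi> + T \<psi>}) \<inter> (\<Inter>a. \<Inter>\<phi>. {T. T (a *\<^sub>R \<phi>) = a * T \<phi>})"
      by (auto simp: linear_iff)
    also have "closed \<dots>"
      by (intro closed_Int closed_INT ballI closed_Collect_eq continuous_intros
          continuous_on_product_coordinates)
    finally show ?thesis .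
  qed
  ultimately have "compact (PiE UNIV ?I \<inter> {T. linear T})"
    by (rule compact_Int_closed)
  also have "PiE UNIV ?I \<inter> {T. linear T} = Z"
    by (auto simp: Z_def PiE_def Pi_def)
  finally have "compact Z" .
  have Z: "pairing (Abs_tempered T) = T" if "T \<in> Z" for T
  proof (rule Abs_tempered_inverse)
    have "linear T" "\<And>\<phi>. \<bar>T \<phi>\<bar> \<le> real q * schwartz_norm q \<phi>"
      using that by (auto simp: Z_def abs_le_iff minus_le_iff)
    then show "T \<in> {T. linear T \<and> continuous_on UNIV T}"
      using bounded_linear_schwartz_continuous by blast
  qed
  have polar: "polar q = Abs_tempered ` Z"
  proof
    show "polar q \<subseteq> Abs_tempered ` Z"
    proof
      fix x assume "x \<in> polar q"
      then have "pairing x \<in> Z"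
        by (auto simp: Z_def polar_def linear_pairing abs_le_iff minus_le_iff)
      then show "x \<in> Abs_tempered ` Z"
        by (metis image_eqI pairing_inverse)
    qed
    show "Abs_tempered ` Z \<subseteq> polar q"
    proof safe
      fix T assume "T \<in> Z"
      then show "Abs_tempered T \<in> polar q"
        using Z[OF \<open>T \<in> Z\<close>] by (auto simp: polar_def Z_def abs_le_iff minus_le_iff)
    qed
  qed
  have "continuous_on Z Abs_tempered"
    unfolding continuous_on_topological
  proof (intro ballI allI impI)
    fix T U assume T: "T \<in> Z" and "open U" "Abs_tempered T \<in> U"
    then obtain B e where B: "schwartz_bounded B" "e > 0"
      "{y. \<forall>\<phi>\<in>B. \<bar>pairing y \<phi> - pairing (Abs_tempered T) \<phi>\<bar> < e} \<subseteq> U"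
      unfolding open_tempered_def by blast
    \<comment> \<open>Replacing a test function by a point of the net costs at most
      \<open>2 * q * d\<close>, hence at most e/2; the coordinates in \<open>F\<close> cost e/4. The
      summand 1 covers \<open>q = 0\<close>.\<close>
    define d where "d = e / (4 * (real q + 1))"
    have d: "d > 0" using B by (auto simp: d_def)
    obtain F where F: "finite F" "\<And>\<phi>. \<phi> \<in> B \<Longrightarrow> \<exists>\<psi>\<in>F. schwartz_norm q (\<phi> - \<psi>) < d"
      using schwartz_bounded_finite_net[OF B(1) d] by metis
    define A where "A = (\<Inter>\<psi>\<in>F. {S :: schwartz \<Rightarrow> real. \<bar>S \<psi> - T \<psi>\<bar> < e / 4})"
    have "open A"
      unfolding A_def
      by (intro open_INT F ballI open_Collect_less continuous_intros continuous_on_product_coordinates)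
    moreover have "T \<in> A" using B by (auto simp: A_def)
    moreover have "Abs_tempered S \<in> U" if S: "S \<in> Z" "S \<in> A" for S
    proof (intro subsetD[OF B(3)] CollectI ballI)
      fix \<phi> assume "\<phi> \<in> B"
      then obtain \<psi> where \<psi>: "\<psi> \<in> F" "schwartz_norm q (\<phi> - \<psi>) < d" using F by blast
      have "\<bar>pairing (Abs_tempered S) \<phi> - pairing (Abs_tempered T) \<phi>\<bar> \<le>
          \<bar>pairing (Abs_tempered S) \<psi> - pairing (Abs_tempered T) \<psi>\<bar> + 2 * (real q * schwartz_norm q (\<phi> - \<psi>))"
        using S T by (intro pairing_diff_bound) (auto simp: polar)
      moreover have "real q * schwartz_norm q (\<phi> - \<psi>) \<le> (real q + 1) * d"
        using \<psi> by (intro mult_mono) (auto intro: schwartz_norm_nonneg)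
      moreover have "(real q + 1) * d = e / 4" unfolding d_def by (simp add: field_simps)
      moreover have "\<bar>S \<psi> - T \<psi>\<bar> < e / 4" using S \<psi> by (auto simp: A_def)
      ultimately show "\<bar>pairing (Abs_tempered S) \<phi> - pairing (Abs_tempered T) \<phi>\<bar> < e"
        unfolding Z[OF S(1)] Z[OF T] by linarith
    qed
    ultimately show "\<exists>A. open A \<and> T \<in> A \<and> (\<forall>S\<in>Z. S \<in> A \<longrightarrow> Abs_tempered S \<in> U)" by blast
  qed
  then show ?thesis
    unfolding polar using \<open>compact Z\<close> by (rule compact_continuous_image)
qed

section \<open>The cylinder sigma-algebra\<close>

text \<open>Measurability into this sigma-algebra can be checked one pairing at a time.
  \<open>open_polar_cylinder\<close> then leads from it to strongly open sets.\<close>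

definition cylinder_algebra :: "tempered measure" where
  "cylinder_algebra = sigma UNIV {(\<lambda>x. pairing x \<phi>) -` S | \<phi> S. S \<in> sets borel}"

lemma pairing_cylinder_measurable [measurable]:
  "(\<lambda>x. pairing x \<phi>) \<in> borel_measurable cylinder_algebra"
  unfolding cylinder_algebra_def
  by (rule measurableI) (auto simp: sets_measure_of space_measure_of_conv intro!: sigma_sets.Basic)

lemma measurable_cylinder_algebraI:
  assumes "\<And>\<phi>. (\<lambda>\<omega>. pairing (V \<omega>) \<phi>) \<in> borel_measurable M"
  shows "V \<in> measurable M cylinder_algebra"
  unfolding cylinder_algebra_def
proof (rule measurable_measure_of)
  fix A assume "A \<in> {(\<lambda>x. pairing x \<phi>) -` S | \<phi> S. S \<in> sets borel}"
  then obtain \<phi> S where A: "A = (\<lambda>x. pairing x \<phi>) -` S" "S \<in> sets borel" by blast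
  have "(\<lambda>\<omega>. pairing (V \<omega>) \<phi>) -` S \<inter> space M \<in> sets M"
    using assms A by (intro measurable_sets)
  then show "V -` A \<inter> space M \<in> sets M" by (simp add: A vimage_def)
qed auto

text \<open>The sets \<open>C ld\<close> with test functions in a countable dense set and rational
  data are countably many. Those whose trace on the polar lies in \<open>U\<close> already cover
  \<open>U \<inter> polar q\<close>.\<close>

lemma open_polar_cylinder:
  assumes "open U"
  obtains W where "W \<in> sets cylinder_algebra" "U \<inter> polar q = W \<inter> polar q"
proof -
  obtain D where D: "countable D" "\<And>p e \<phi>. e > 0 \<Longrightarrow> \<exists>\<psi>\<in>D. schwartz_norm p (\<phi> - \<psi>) < e"
    using schwartz_separable by blast
  \<comment> \<open>The list \<open>l\<close> holds pairs of a test function and the rational centre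
    for its pairing; \<open>d\<close> is a common rational radius.\<close>
  define C where "C = (\<lambda>(l, d). {y. \<forall>(\<psi>, r)\<in>set l. \<bar>pairing y \<psi> - of_rat r\<bar> < of_rat d})"
  define J where "J = {ld. ld \<in> lists (D \<times> UNIV) \<times> (UNIV :: rat set) \<and> C ld \<inter> polar q \<subseteq> U}"
  have "countable J"
    by (rule countable_subset[of _ "lists (D \<times> UNIV) \<times> UNIV"]) (auto simp: J_def D)
  have "C ld \<in> sets cylinder_algebra" for ld
  proof -
    have "{y \<in> space cylinder_algebra. \<forall>z\<in>set (fst ld). \<bar>pairing y (fst z) - of_rat (snd z)\<bar> < of_rat (snd ld)}
        \<in> sets cylinder_algebra"
      by measurable
    then show ?thesis
      by (simp add: C_def case_prod_beta' cylinder_algebra_def space_measure_of_conv)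
  qed
  then have "(\<Union>ld\<in>J. C ld) \<in> sets cylinder_algebra"
    using \<open>countable J\<close> by (intro sets.countable_UN') auto
  moreover have "U \<inter> polar q \<subseteq> (\<Union>ld\<in>J. C ld)"
  proof
    fix x assume x: "x \<in> U \<inter> polar q"
    then obtain B e where B: "schwartz_bounded B" "e > 0"
      "{y. \<forall>\<phi>\<in>B. \<bar>pairing y \<phi> - pairing x \<phi>\<bar> < e} \<subseteq> U"
      using assms unfolding open_tempered_def by blast
    \<comment> \<open>A member of \<open>B\<close> is within \<open>d\<close> of the net, and the
      net within \<open>d\<close> of the dense set. This total distance \<open>2 * d\<close> costs
      at most e/4 in the pairing; the rational approximations add less than e/4 and e/8, and the sum
      stays below e.\<close>
    define d where "d = e / (16 * (real q + 1))"
    have d: "d > 0" using B by (auto simp: d_def)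
    obtain F where F: "finite F" "\<And>\<phi>. \<phi> \<in> B \<Longrightarrow> \<exists>\<psi>\<in>F. schwartz_norm q (\<phi> - \<psi>) < d"
      using schwartz_bounded_finite_net[OF B(1) d] by metis
    obtain n where n: "\<And>\<phi>. n \<phi> \<in> D" "\<And>\<phi>. schwartz_norm q (\<phi> - n \<phi>) < d"
      using D(2)[OF d] by metis
    from finite_list[OF finite_imageI[OF F(1), of n]] obtain fs where fs: "set fs = n ` F" ..
    obtain r where r: "\<And>\<psi>. \<bar>pairing x \<psi> - of_rat (r \<psi>)\<bar> < e / 8"
    proof -
      have "\<exists>s. \<bar>pairing x \<psi> - of_rat s\<bar> < e / 8" for \<psi>
      proof -
        obtain s where "pairing x \<psi> - e / 8 < of_rat s" "of_rat s < pairing x \<psi> + e / 8"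
          using of_rat_dense[of "pairing x \<psi> - e / 8" "pairing x \<psi> + e / 8"] B(2) by auto
        then have "\<bar>pairing x \<psi> - of_rat s\<bar> < e / 8" by linarith
        then show ?thesis ..
      qed
      then show ?thesis using that by metis
    qed
    obtain d' where d': "e / 8 < of_rat d'" "of_rat d' < e / 4"
      using of_rat_dense[of "e / 8" "e / 4"] B(2) by auto
    define ld where "ld = (map (\<lambda>\<psi>. (\<psi>, r \<psi>)) fs, d')"
    have "x \<in> C ld"
      using less_trans[OF r d'(1)] by (auto simp: C_def ld_def)
    moreover have "y \<in> U" if y: "y \<in> C ld" "y \<in> polar q" for y
    proof (intro subsetD[OF B(3)] CollectI ballI)
      fix \<phi> assume "\<phi> \<in> B"
      then obtain \<psi> where \<psi>: "\<psi> \<in> F" "schwartz_norm q (\<phi> - \<psi>) < d" using F by blast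
      have 1: "schwartz_norm q (\<phi> - n \<psi>) \<le> 2 * d"
        using schwartz_norm_triangle[of q "\<phi> - \<psi>" "\<psi> - n \<psi>"] \<psi> n(2)[of \<psi>] by simp
      have "\<bar>pairing y \<phi> - pairing x \<phi>\<bar> \<le>
          \<bar>pairing y (n \<psi>) - pairing x (n \<psi>)\<bar> + 2 * (real q * schwartz_norm q (\<phi> - n \<psi>))"
        using x y by (intro pairing_diff_bound) auto
      moreover have "real q * schwartz_norm q (\<phi> - n \<psi>) \<le> (real q + 1) * (2 * d)"
        using 1 by (intro mult_mono) (auto intro: schwartz_norm_nonneg)
      moreover have "(real q + 1) * (2 * d) = e / 8" unfolding d_def by (simp add: field_simps)
      moreover have "\<bar>pairing y (n \<psi>) - of_rat (r (n \<psi>))\<bar> < of_rat d'"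
      proof -
        have "\<forall>z\<in>set fs. \<bar>pairing y z - of_rat (r z)\<bar> < of_rat d'"
          using y(1) by (auto simp: C_def ld_def)
        then show ?thesis using \<psi>(1) fs by auto
      qed
      with d' have 2: "\<bar>pairing y (n \<psi>) - of_rat (r (n \<psi>))\<bar> < e / 4"
        by linarith
      ultimately show "\<bar>pairing y \<phi> - pairing x \<phi>\<bar> < e"
        using r[of "n \<psi>"] B(2) 2 by linarith
    qed
    moreover have "ld \<in> lists (D \<times> UNIV) \<times> UNIV"
      using n fs by (auto simp: ld_def)
    ultimately show "x \<in> (\<Union>ld\<in>J. C ld)"
      unfolding J_def by blast
  qed
  moreover have "(\<Union>ld\<in>J. C ld) \<inter> polar q \<subseteq> U"
    by (auto simp: J_def)
  ultimately show thesis
    by (intro that[of "\<Union>ld\<in>J. C ld"]) auto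
qed

section \<open>Weak convergence on tempered distributions\<close>

text \<open>The complex linear span of the characters of the dual. It is an algebra because
  characters multiply by adding test functions, and convergence of integrals passes to it by
  linearity.\<close>

inductive_set trig :: "(tempered \<Rightarrow> complex) set" where
  trig_exp: "(\<lambda>x. c * exp (\<i> * complex_of_real (pairing x \<phi>))) \<in> trig"
| trig_add: "f \<in> trig \<Longrightarrow> g \<in> trig \<Longrightarrow> (\<lambda>x. f x + g x) \<in> trig"

lemma trig_const: "(\<lambda>x. c) \<in> trig"
  using trig_exp[of c 0] by (simp add: pairing_zero)

lemma trig_mult_exp:
  assumes "f \<in> trig"
  shows "(\<lambda>x. f x * (c * exp (\<i> * complex_of_real (pairing x \<phi>)))) \<in> trig"
  using assms
proof induction
  case (trig_exp d \<psi>)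
  have "(\<lambda>x. d * exp (\<i> * complex_of_real (pairing x \<psi>)) * (c * exp (\<i> * complex_of_real (pairing x \<phi>)))) =
      (\<lambda>x. (d * c) * exp (\<i> * complex_of_real (pairing x (\<psi> + \<phi>))))"
    by (simp add: pairing_add distrib_left exp_add mult_ac)
  then show ?case by (metis trig.trig_exp)
qed (auto simp: distrib_right intro: trig.intros)

lemma trig_mult:
  assumes "f \<in> trig" "g \<in> trig"
  shows "(\<lambda>x. f x * g x) \<in> trig"
  using assms(2,1)
  by induction (auto simp: distrib_left intro: trig.intros trig_mult_exp)

lemma trig_continuous:
  assumes "f \<in> trig"
  shows "continuous_on UNIV f"
  using assms by induction (intro continuous_intros continuous_pairing_left; assumption)+

lemma trig_bounded:
  assumes "f \<in> trig"
  obtains C where "\<And>x. norm (f x) \<le> C"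
proof -
  have "\<exists>C. \<forall>x. norm (f x) \<le> C"
    using assms
  proof induction
    case (trig_exp c \<phi>)
    then show ?case by (intro exI[of _ "norm c"]) (simp add: norm_mult)
  next
    case (trig_add f g)
    then show ?case by (meson add_mono norm_triangle_le order_trans norm_triangle_ineq)
  qed
  then show thesis using that by blast
qed

lemma borel_measurable_continuous:
  "continuous_on UNIV f \<Longrightarrow> sets Q = sets borel \<Longrightarrow> f \<in> borel_measurable Q"
  for f :: "tempered \<Rightarrow> 'b :: topological_space"
  using borel_measurable_continuous_onI measurable_cong_sets by blast

lemma trig_integrable:
  assumes "f \<in> trig" "prob_space Q" "sets Q = sets borel"
  shows "integrable Q f"
proof -
  interpret prob_space Q by fact
  obtain C where "\<And>x. norm (f x) \<le> C" using trig_bounded[OF assms(1)] by blast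
  then show ?thesis
    using borel_measurable_continuous[OF trig_continuous[OF assms(1)] assms(3)]
    by (intro integrable_const_bound[of _ C]) auto
qed

lemma trig_integral_tendsto:
  assumes f: "f \<in> trig"
    and P: "\<And>n. n \<ge> 1 \<Longrightarrow> prob_space (P n)" "\<And>n. n \<ge> 1 \<Longrightarrow> sets (P n) = sets borel"
    and \<mu>: "prob_space \<mu>" "sets \<mu> = sets borel"
    and char: "\<And>\<phi>. (\<lambda>n. \<integral>x. exp (\<i> * complex_of_real (pairing x \<phi>)) \<partial>P n) \<longlonglongrightarrow>
        (\<integral>x. exp (\<i> * complex_of_real (pairing x \<phi>)) \<partial>\<mu>)"
  shows "(\<lambda>n. \<integral>x. f x \<partial>P n) \<longlonglongrightarrow> (\<integral>x. f x \<partial>\<mu>)"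
  using f
proof induction
  case (trig_exp c \<phi>)
  then show ?case using char[of \<phi>] by (simp add: tendsto_mult_left)
next
  case (trig_add f g)
  have "(\<lambda>n. (\<integral>x. f x \<partial>P n) + (\<integral>x. g x \<partial>P n)) \<longlonglongrightarrow> (\<integral>x. f x \<partial>\<mu>) + (\<integral>x. g x \<partial>\<mu>)"
    using trig_add.IH by (intro tendsto_add)
  also have "(\<integral>x. f x \<partial>\<mu>) + (\<integral>x. g x \<partial>\<mu>) = (\<integral>x. f x + g x \<partial>\<mu>)"
    using trig_add.hyps \<mu> by (intro Bochner_Integration.integral_add[symmetric] trig_integrable)
  finally show ?case
  proof (rule Lim_transform_eventually)
    show "\<forall>\<^sub>F n in sequentially. (\<integral>x. f x \<partial>P n) + (\<integral>x. g x \<partial>P n) = (\<integral>x. f x + g x \<partial>P n)"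
      using eventually_ge_at_top[of 1]
      by eventually_elim
        (intro Bochner_Integration.integral_add[symmetric] trig_integrable trig_add.hyps P; assumption)
  qed
qed

definition trig_real :: "(tempered \<Rightarrow> real) set" where
  "trig_real = {h. (\<lambda>x. complex_of_real (h x)) \<in> trig}"

lemma trig_real_const: "(\<lambda>x. c) \<in> trig_real"
  and trig_real_add: "f \<in> trig_real \<Longrightarrow> g \<in> trig_real \<Longrightarrow> (\<lambda>x. f x + g x) \<in> trig_real"
  and trig_real_mult: "f \<in> trig_real \<Longrightarrow> g \<in> trig_real \<Longrightarrow> (\<lambda>x. f x * g x) \<in> trig_real"
  by (auto simp: trig_real_def intro: trig_const trig_add trig_mult)

lemma trig_real_continuous:
  assumes "f \<in> trig_real"
  shows "continuous_on UNIV f"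
proof -
  have "continuous_on UNIV (\<lambda>x. Re (complex_of_real (f x)))"
    using assms by (intro continuous_intros trig_continuous) (simp add: trig_real_def)
  then show ?thesis by simp
qed

lemma trig_real_sin: "(\<lambda>x. sin (pairing x \<phi>)) \<in> trig_real"
proof -
  have "(\<lambda>x. complex_of_real (sin (pairing x \<phi>))) =
     (\<lambda>x. (1 / (2 * \<i>)) * exp (\<i> * complex_of_real (pairing x \<phi>)) +
           (- 1 / (2 * \<i>)) * exp (\<i> * complex_of_real (pairing x (- \<phi>))))"
    by (simp add: fun_eq_iff linear_neg[OF linear_pairing] sin_of_real[symmetric] sin_exp_eq field_simps)
  then show ?thesis
    unfolding trig_real_def by (simp only: mem_Collect_eq) (intro trig.intros)
qed

text \<open>After scaling the test function, both pairings lie in [-1, 1], where the sine is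
  injective.\<close>

lemma trig_real_separates:
  assumes "x \<noteq> y"
  shows "\<exists>f\<in>trig_real. f x \<noteq> f y"
proof -
  obtain \<phi> where \<phi>: "pairing x \<phi> \<noteq> pairing y \<phi>" using assms tempered_eqI by blast
  define s where "s = 1 / (1 + \<bar>pairing x \<phi>\<bar> + \<bar>pairing y \<phi>\<bar>)"
  have s: "s > 0" "\<bar>s * pairing x \<phi>\<bar> \<le> 1" "\<bar>s * pairing y \<phi>\<bar> \<le> 1"
    by (auto simp: s_def abs_mult divide_simps)
  have "sin (s * pairing x \<phi>) \<noteq> sin (s * pairing y \<phi>)"
  proof
    assume "sin (s * pairing x \<phi>) = sin (s * pairing y \<phi>)"
    moreover have "1 \<le> pi / 2" using pi_ge_two by simp
    moreover have "- (pi / 2) \<le> s * pairing x \<phi>" "s * pairing x \<phi> \<le> pi / 2"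
      "- (pi / 2) \<le> s * pairing y \<phi>" "s * pairing y \<phi> \<le> pi / 2"
      using s(2,3) \<open>1 \<le> pi / 2\<close> by linarith+
    ultimately have "s * pairing x \<phi> = s * pairing y \<phi>"
      by (metis sin_inj_pi)
    then show False using \<phi> s by simp
  qed
  then have "sin (pairing x (s *\<^sub>R \<phi>)) \<noteq> sin (pairing y (s *\<^sub>R \<phi>))"
    by (simp add: pairing_scaleR)
  then show ?thesis by (intro bexI[OF _ trig_real_sin])
qed

lemma trig_real_polynomial:
  assumes "g \<in> trig_real" "real_polynomial_function r"
  shows "(\<lambda>x. r (g x)) \<in> trig_real"
  using assms(2)
proof induction
  case (linear r)
  have "r (g x) = r 1 * g x" for x
    using linear_scale[OF bounded_linear.linear[OF linear], of "g x" 1] by simp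
  then show ?case by (simp add: trig_real_mult trig_real_const assms(1))
qed (auto intro: trig_real_const trig_real_add trig_real_mult)

text \<open>Stone--Weierstrass on the polar gives \<open>g\<close>, but the global bound
  \<open>c\<close> of \<open>g\<close> depends on the approximation and would ruin tail estimates. A
  second approximation, of the truncation at height \<open>B\<close> on [-c, c], restores a global
  bound independent of \<open>q\<close>. Truncation does not increase the distance to
  \<open>f\<close>, since \<open>f\<close> takes values in [-B, B]; each approximation contributes
  one \<open>\<delta>\<close>.\<close>

lemma trig_real_approx:
  assumes f: "continuous_on UNIV f" and B: "\<And>x. \<bar>f x\<bar> \<le> B" and \<delta>: "\<delta> > (0::real)"
  obtains h where "h \<in> trig_real" "\<And>x. \<bar>h x\<bar> \<le> B + \<delta>" "\<And>x. x \<in> polar q \<Longrightarrow> \<bar>f x - h x\<bar> \<le> 2 * \<delta>"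
proof -
  have "\<exists>g. g \<in> trig_real \<and> (\<forall>x\<in>polar q. \<bar>f x - g x\<bar> < \<delta>)"
    by (rule Stone_Weierstrass_HOL[OF compact_polar])
      (auto intro: trig_real_const trig_real_add trig_real_mult trig_real_separates[unfolded Bex_def] \<delta>
        continuous_on_subset[OF trig_real_continuous] continuous_on_subset[OF f])
  then obtain g where g: "g \<in> trig_real" "\<And>x. x \<in> polar q \<Longrightarrow> \<bar>f x - g x\<bar> < \<delta>" by blast
  obtain c where c: "\<And>x. \<bar>g x\<bar> \<le> c"
    using trig_bounded[of "\<lambda>x. complex_of_real (g x)"] g(1) by (auto simp: trig_real_def)
  define clamp where "clamp y = max (- B) (min B y)" for y :: real
  have "continuous_on {-c..c} clamp"
    unfolding clamp_def by (intro continuous_intros)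
  then obtain r where r: "real_polynomial_function r" "\<And>y. y \<in> {-c..c} \<Longrightarrow> \<bar>clamp y - r y\<bar> < \<delta>"
    using Stone_Weierstrass_real_polynomial_function[OF compact_Icc _ \<delta>, of "-c" c clamp] by metis
  have r': "\<bar>clamp (g x) - r (g x)\<bar> < \<delta>" for x
    using c[of x] by (intro r) (auto simp: abs_le_iff)
  show thesis
  proof
    show "(\<lambda>x. r (g x)) \<in> trig_real" by (rule trig_real_polynomial[OF g(1) r(1)])
    fix x
    have "\<bar>clamp (g x)\<bar> \<le> B"
      using B[of x] unfolding clamp_def by linarith
    then show "\<bar>r (g x)\<bar> \<le> B + \<delta>" using r'[of x] by linarith
    assume "x \<in> polar q"
    then have "\<bar>f x - clamp (g x)\<bar> < \<delta>"
      using g(2)[of x] B[of x] unfolding clamp_def by linarith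
    then show "\<bar>f x - r (g x)\<bar> \<le> 2 * \<delta>" using r'[of x] by linarith
  qed
qed

text \<open>On the polar the integrand is at most \<open>2 * \<delta>\<close>; off it the crude
  bound \<open>2 * B + \<delta>\<close> is paid on a set of measure at most
  \<open>\<delta>\<close>.\<close>

lemma integral_diff_polar:
  assumes Q: "prob_space Q" "sets Q = sets borel" and tail: "measure Q (- polar q) \<le> \<delta>"
    and f: "continuous_on UNIV f" "\<And>x. \<bar>f x\<bar> \<le> B"
    and h: "continuous_on UNIV h" "\<And>x. \<bar>h x\<bar> \<le> B + \<delta>"
    and fh: "\<And>x. x \<in> polar q \<Longrightarrow> \<bar>f x - h x\<bar> \<le> 2 * \<delta>"
    and \<delta>: "\<delta> > (0::real)"
  shows "\<bar>(\<integral>x. f x \<partial>Q) - (\<integral>x. h x \<partial>Q)\<bar> \<le> 2 * \<delta> + (2 * B + \<delta>) * \<delta>"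
proof -
  interpret prob_space Q by fact
  have int: "integrable Q f" "integrable Q h"
    using integrable_const_bound[of f B] integrable_const_bound[of h "B + \<delta>"] f(2) h(2)
      borel_measurable_continuous[OF f(1) Q(2)] borel_measurable_continuous[OF h(1) Q(2)]
    by auto
  have [measurable]: "polar q \<in> sets Q" "- polar q \<in> sets Q"
    unfolding Q(2) using closed_polar by (auto intro: borel_closed)
  have B: "B \<ge> 0" using f(2)[of 0] by linarith
  have "\<bar>(\<integral>x. f x \<partial>Q) - (\<integral>x. h x \<partial>Q)\<bar> = \<bar>\<integral>x. f x - h x \<partial>Q\<bar>"
    using int by simp
  also have "\<dots> \<le> (\<integral>x. \<bar>f x - h x\<bar> \<partial>Q)" by (rule integral_abs_bound)
  also have "\<dots> \<le> (\<integral>x. 2 * \<delta> + (2 * B + \<delta>) * indicator (- polar q) x \<partial>Q)"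
  proof (rule integral_mono)
    show "integrable Q (\<lambda>x. \<bar>f x - h x\<bar>)" using int by simp
    show "integrable Q (\<lambda>x. 2 * \<delta> + (2 * B + \<delta>) * indicator (- polar q) x)"
      by (intro Bochner_Integration.integrable_add integrable_mult_right integrable_const) (auto simp: less_top[symmetric])
    fix x
    show "\<bar>f x - h x\<bar> \<le> 2 * \<delta> + (2 * B + \<delta>) * indicator (- polar q) x"
      using fh[of x] f(2)[of x] h(2)[of x] \<delta> B by (cases "x \<in> polar q") (auto simp: indicator_def)
  qed
  also have "\<dots> = 2 * \<delta> + (2 * B + \<delta>) * measure Q (- polar q)"
    by (subst Bochner_Integration.integral_add) (auto simp: less_top[symmetric] prob_space)
  also have "\<dots> \<le> 2 * \<delta> + (2 * B + \<delta>) * \<delta>"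
    using tail B \<delta> by (intro add_mono mult_left_mono) auto
  finally show ?thesis .
qed

text \<open>A single Borel probability measure is tight on polars automatically, because they
  increase to the whole space.\<close>

lemma polar_tail_tendsto:
  assumes "prob_space \<mu>" "sets \<mu> = sets borel" "\<delta> > (0::real)"
  shows "eventually (\<lambda>q. measure \<mu> (- polar q) \<le> \<delta>) sequentially"
proof -
  interpret prob_space \<mu> by fact
  have sets: "polar q \<in> sets \<mu>" for q
    unfolding assms(2) using closed_polar by (auto intro: borel_closed)
  have sp: "space \<mu> = UNIV" using sets_eq_imp_space_eq[OF assms(2)] by simp
  have "(\<lambda>q. measure \<mu> (polar q)) \<longlonglongrightarrow> measure \<mu> (\<Union>q. polar q)"
    using sets incseq_polar by (intro finite_Lim_measure_incseq) auto
  then have "(\<lambda>q. measure \<mu> (polar q)) \<longlonglongrightarrow> 1"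
    using prob_space by (simp add: UN_polar sp)
  then have "eventually (\<lambda>q. measure \<mu> (polar q) > 1 - \<delta>) sequentially"
    using assms(3) by (intro order_tendstoD) auto
  then show ?thesis
  proof eventually_elim
    case (elim q)
    then show ?case using prob_compl[OF sets[of q]] by (simp add: sp Compl_eq_Diff_UNIV)
  qed
qed

text \<open>The trigonometric polynomial approximating the test function on a compact polar is composed with
  a polynomial that approximates the truncation, so that it is under control outside the polar as well.\<close>

theorem converges_weakly_tempered:
  assumes P: "\<And>n. n \<ge> 1 \<Longrightarrow> prob_space (P n)" "\<And>n. n \<ge> 1 \<Longrightarrow> sets (P n) = sets borel"
    and \<mu>: "prob_space \<mu>" "sets \<mu> = sets borel"
    and char: "\<And>\<phi>. (\<lambda>n. \<integral>x. exp (\<i> * complex_of_real (pairing x \<phi>)) \<partial>P n) \<longlonglongrightarrow>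
        (\<integral>x. exp (\<i> * complex_of_real (pairing x \<phi>)) \<partial>\<mu>)"
    and tight: "\<And>\<delta>. \<delta> > 0 \<Longrightarrow> \<exists>q. \<forall>n\<ge>1. measure (P n) (- polar q) \<le> \<delta>"
  shows "converges_weakly P \<mu>"
  unfolding converges_weakly_def
proof (intro allI impI, elim conjE)
  fix f :: "tempered \<Rightarrow> real" assume f: "continuous_on UNIV f" "bounded (range f)"
  then obtain B where B: "\<And>x. \<bar>f x\<bar> \<le> B" by (auto simp: bounded_iff)
  then have "B \<ge> 0" using abs_ge_zero order_trans by blast
  show "(\<lambda>n. \<integral>x. f x \<partial>P n) \<longlonglongrightarrow> (\<integral>x. f x \<partial>\<mu>)"
  proof (rule LIMSEQ_I)
    fix e :: real assume e: "e > 0"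
    \<comment> \<open>Two applications of \<open>integral_diff_polar\<close> and one
      \<open>\<delta>\<close> for the trigonometric part add up to
      \<open>\<delta> * (7 + 4 * B)\<close>, once \<open>\<delta> \<le> 1\<close> is used to bound
      the quadratic term; 8 in place of 7 makes the inequality strict.\<close>
    define \<delta> where "\<delta> = min 1 (e / (8 + 4 * B))"
    have \<delta>: "\<delta> > 0" "\<delta> \<le> 1" using e \<open>B \<ge> 0\<close> by (auto simp: \<delta>_def)
    have \<delta>e: "\<delta> * (7 + 4 * B) < e"
    proof -
      have "\<delta> * (7 + 4 * B) < \<delta> * (8 + 4 * B)" using \<delta> by simp
      also have "\<dots> \<le> e / (8 + 4 * B) * (8 + 4 * B)"
        using \<open>B \<ge> 0\<close> by (intro mult_right_mono) (auto simp: \<delta>_def)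
      also have "\<dots> = e" using \<open>B \<ge> 0\<close> by simp
      finally show ?thesis .
    qed
    obtain q1 where q1: "\<And>n. n \<ge> 1 \<Longrightarrow> measure (P n) (- polar q1) \<le> \<delta>"
      using tight[OF \<delta>(1)] by blast
    obtain q where q: "q \<ge> q1" "measure \<mu> (- polar q) \<le> \<delta>"
      using polar_tail_tendsto[OF \<mu> \<delta>(1)] unfolding eventually_sequentially
      by (meson nat_le_linear order_refl order_trans max.cobounded1 max.cobounded2)
    have qP: "measure (P n) (- polar q) \<le> \<delta>" if "n \<ge> 1" for n
    proof -
      interpret prob_space "P n" by (rule P[OF that])
      have "measure (P n) (- polar q) \<le> measure (P n) (- polar q1)"
        using q(1) incseq_polar closed_polar P(2)[OF that]
        by (intro finite_measure_mono) (auto simp: mono_def intro: borel_closed)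
      then show ?thesis using q1[OF that] by linarith
    qed
    obtain h where h: "h \<in> trig_real" "\<And>x. \<bar>h x\<bar> \<le> B + \<delta>"
      "\<And>x. x \<in> polar q \<Longrightarrow> \<bar>f x - h x\<bar> \<le> 2 * \<delta>"
      using trig_real_approx[OF f(1) B \<delta>(1), of q] by blast
    have hc: "continuous_on UNIV h" by (rule trig_real_continuous[OF h(1)])
    have "(\<lambda>n. complex_of_real (\<integral>x. h x \<partial>P n)) \<longlonglongrightarrow> complex_of_real (\<integral>x. h x \<partial>\<mu>)"
      using trig_integral_tendsto[OF _ P \<mu> char, of "\<lambda>x. complex_of_real (h x)"] h(1)
      by (simp add: trig_real_def)
    then have "(\<lambda>n. \<integral>x. h x \<partial>P n) \<longlonglongrightarrow> (\<integral>x. h x \<partial>\<mu>)"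
      by (simp only: tendsto_of_real_iff)
    then obtain N where N: "\<And>n. n \<ge> N \<Longrightarrow> \<bar>(\<integral>x. h x \<partial>P n) - (\<integral>x. h x \<partial>\<mu>)\<bar> < \<delta>"
      using LIMSEQ_D[OF _ \<delta>(1)] by (metis real_norm_def)
    have "\<bar>(\<integral>x. f x \<partial>P n) - (\<integral>x. f x \<partial>\<mu>)\<bar> < e" if n: "n \<ge> max 1 N" for n
    proof -
      have "\<bar>(\<integral>x. f x \<partial>P n) - (\<integral>x. h x \<partial>P n)\<bar> \<le> 2 * \<delta> + (2 * B + \<delta>) * \<delta>"
        using n by (intro integral_diff_polar[OF P qP f(1) B hc h(2,3) \<delta>(1)]) auto
      moreover have "\<bar>(\<integral>x. f x \<partial>\<mu>) - (\<integral>x. h x \<partial>\<mu>)\<bar> \<le> 2 * \<delta> + (2 * B + \<delta>) * \<delta>"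
        by (intro integral_diff_polar[OF \<mu> q(2) f(1) B hc h(2,3) \<delta>(1)]) auto
      moreover have "\<bar>(\<integral>x. h x \<partial>P n) - (\<integral>x. h x \<partial>\<mu>)\<bar> < \<delta>" using n by (intro N) auto
      moreover have "(2 * B + \<delta>) * \<delta> \<le> (2 * B + 1) * \<delta>" using \<delta> by (intro mult_right_mono) auto
      ultimately have "\<bar>(\<integral>x. f x \<partial>P n) - (\<integral>x. f x \<partial>\<mu>)\<bar> < 5 * \<delta> + 2 * ((2 * B + 1) * \<delta>)"
        by linarith
      also have "\<dots> = \<delta> * (7 + 4 * B)" by (simp add: algebra_simps)
      finally show ?thesis using \<delta>e by linarith
    qed
    then show "\<exists>N. \<forall>n\<ge>N. norm ((\<integral>x. f x \<partial>P n) - (\<integral>x. f x \<partial>\<mu>)) < e"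
      by (intro exI[of _ "max 1 N"]) auto
  qed
qed

section \<open>A compactly supported smooth function\<close>

text \<open>Smoothness by closure: a family containing a derivative of each of its members consists
  of smooth functions.\<close>

lemma higher_deriv_closed:
  fixes F :: "(real \<Rightarrow> real) set"
  assumes F: "\<And>f. f \<in> F \<Longrightarrow> \<exists>f'\<in>F. \<forall>x. (f has_field_derivative f' x) (at x)" and "f \<in> F"
  shows "(deriv ^^ k) f \<in> F" "(deriv ^^ k) f field_differentiable (at x)"
proof -
  show *: "(deriv ^^ k) f \<in> F" for k
  proof (induction k)
    case (Suc k)
    obtain f' where f': "f' \<in> F" "\<And>x. ((deriv ^^ k) f has_field_derivative f' x) (at x)"
      using F[OF Suc] by blast
    then have "deriv ((deriv ^^ k) f) = f'" by (intro ext DERIV_imp_deriv)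
    then show ?case using f' by simp
  qed (simp add: assms)
  show "(deriv ^^ k) f field_differentiable (at x)"
    using F[OF *[of k]] field_differentiable_def by blast
qed

text \<open>The cutoff in use is \<open>bump 1 0\<close>; the polynomial \<open>p\<close> and the
  exponent \<open>m\<close> make the family closed under differentiation.\<close>

definition bump :: "real poly \<Rightarrow> nat \<Rightarrow> real \<Rightarrow> real" where
  "bump p m t = (if 0 < t \<and> t < 1 then poly p t / (t * (1 - t)) ^ m * exp (- 1 / (t * (1 - t))) else 0)"

text \<open>A single term of the exponential series at 1/u, that of order m+2, is at most exp(1/u).
  The two spare powers of \<open>u\<close> make every bump vanish quadratically at the ends of its
  support.\<close>

lemma exp_minus_inverse_le:
  assumes "0 < (u::real)"
  shows "exp (- 1 / u) / u ^ m \<le> fact (m + 2) * u\<^sup>2"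
proof -
  define F :: real where "F = fact (m + 2)"
  have "F > 0" unfolding F_def by (rule fact_gt_zero)
  have "inverse (fact (m + 2)) *\<^sub>R (1 / u) ^ (m + 2) \<le> (\<Sum>n. inverse (fact n) *\<^sub>R (1 / u) ^ n)"
    using assms sum_le_suminf[OF summable_exp_generic[of "1 / u"], of "{m + 2}"] by simp
  then have "inverse F * (1 / u) ^ (m + 2) \<le> exp (1 / u)"
    unfolding F_def exp_def by simp
  then have "exp (- 1 / u) / u ^ m \<le> F * u\<^sup>2"
    using assms \<open>F > 0\<close> by (simp add: field_simps exp_minus power2_eq_square)
  then show ?thesis unfolding F_def .
qed

text \<open>The quadratic estimate about any point \<open>a\<close> outside (0, 1) forces the
  derivative there to be zero, which settles differentiability at the endpoints.\<close>

lemma bump_le: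
  obtains C where "C \<ge> 0" "\<And>t. \<bar>bump p m t\<bar> \<le> C" "\<And>t a. a \<le> 0 \<or> 1 \<le> a \<Longrightarrow> \<bar>bump p m t\<bar> \<le> C * (t - a)\<^sup>2"
proof -
  have "bounded (poly p ` {0..1})"
    by (intro compact_imp_bounded compact_continuous_image continuous_intros) auto
  then obtain K where K: "\<And>t. t \<in> {0..1} \<Longrightarrow> \<bar>poly p t\<bar> \<le> K"
    unfolding bounded_iff by (metis imageI real_norm_def)
  have "K \<ge> 0" using K[of 0] by simp
  define C where "C = K * fact (m + 2)"
  have "C \<ge> 0" using \<open>K \<ge> 0\<close> by (simp add: C_def)
  have *: "\<bar>bump p m t\<bar> \<le> C * (t * (1 - t))\<^sup>2" if "0 < t" "t < 1" for t
  proof -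
    have "\<bar>bump p m t\<bar> = \<bar>poly p t\<bar> * (exp (- 1 / (t * (1 - t))) / (t * (1 - t)) ^ m)"
      using that by (simp add: bump_def abs_mult)
    also have "\<dots> \<le> K * (fact (m + 2) * (t * (1 - t))\<^sup>2)"
      using that \<open>K \<ge> 0\<close> by (intro mult_mono K exp_minus_inverse_le) auto
    finally show ?thesis by (simp add: C_def mult_ac)
  qed
  show thesis
  proof
    show "C \<ge> 0" by fact
  next
    fix t
    show "\<bar>bump p m t\<bar> \<le> C"
    proof (cases "0 < t \<and> t < 1")
      case True
      have "(t * (1 - t))\<^sup>2 \<le> 1"
        using True by (intro power_le_one mult_le_one) auto
      then have "C * (t * (1 - t))\<^sup>2 \<le> C"
        using \<open>C \<ge> 0\<close> mult_left_le by blast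
      then show ?thesis using * True by (meson order_trans)
    qed (use \<open>C \<ge> 0\<close> in \<open>auto simp: bump_def\<close>)
  next
    fix t a :: real assume a: "a \<le> 0 \<or> 1 \<le> a"
    show "\<bar>bump p m t\<bar> \<le> C * (t - a)\<^sup>2"
    proof (cases "0 < t \<and> t < 1")
      case True
      have "t * (1 - t) \<le> \<bar>t - a\<bar>"
        using a
      proof
        assume "a \<le> 0"
        have "t * (1 - t) \<le> t * 1" using True by (intro mult_left_mono) auto
        then show ?thesis using \<open>a \<le> 0\<close> by simp
      next
        assume "1 \<le> a"
        have "t * (1 - t) \<le> 1 * (1 - t)" using True by (intro mult_right_mono) auto
        then show ?thesis using \<open>1 \<le> a\<close> by simp
      qed
      then have "(t * (1 - t))\<^sup>2 \<le> \<bar>t - a\<bar>\<^sup>2"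
        using True by (intro power_mono) auto
      then have "C * (t * (1 - t))\<^sup>2 \<le> C * (t - a)\<^sup>2"
        using \<open>C \<ge> 0\<close> by (simp add: mult_left_mono)
      then show ?thesis using * True by (meson order_trans)
    qed (use \<open>C \<ge> 0\<close> in \<open>auto simp: bump_def\<close>)
  qed
qed

lemma DERIV_0_of_quadratic_bound:
  fixes f :: "real \<Rightarrow> real"
  assumes f: "\<And>t. \<bar>f t\<bar> \<le> C * (t - a)\<^sup>2"
  shows "(f has_field_derivative 0) (at a)"
proof -
  have "f a = 0" using f[of a] by simp
  have "((\<lambda>h. f (a + h) / h) \<longlongrightarrow> 0) (at 0)"
  proof (rule Lim_null_comparison)
    show "\<forall>\<^sub>F h in at 0. norm (f (a + h) / h) \<le> C * \<bar>h\<bar>"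
    proof (intro eventually_at_filter[THEN iffD2] always_eventually allI impI)
      fix h :: real assume "h \<noteq> 0"
      then show "norm (f (a + h) / h) \<le> C * \<bar>h\<bar>"
        using f[of "a + h"] by (simp add: divide_simps power2_eq_square mult.assoc)
    qed
    have "((\<lambda>h. C * \<bar>h\<bar>) \<longlongrightarrow> C * \<bar>0\<bar>) (at (0::real))" by (intro tendsto_intros)
    then show "((\<lambda>h. C * \<bar>h\<bar>) \<longlongrightarrow> 0) (at (0::real))" by simp
  qed
  then show ?thesis
    by (simp add: DERIV_def \<open>f a = 0\<close>)
qed

text \<open>With \<open>u = t (1 - t)\<close>, the derivative of \<open>p u\<^bsup>-m\<^esup> exp (-1/u)\<close> is
  \<open>(p' u\<^sup>2 + p u' (1 - m u)) u\<^bsup>-(m+2)\<^esup> exp (-1/u)\<close>.\<close>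

lemma bump_DERIV:
  "(bump p m has_field_derivative
    bump (pderiv p * [:0, 1, -1:]\<^sup>2 + p * [:1, -2:] * (1 - smult (of_nat m) [:0, 1, -1:])) (m + 2) t) (at t)"
  (is "(_ has_field_derivative bump ?q _ _) _")
proof (cases "0 < t \<and> t < 1")
  case True
  define u where "u = t * (1 - t)"
  have u: "u > 0" using True by (simp add: u_def)
  have du: "((\<lambda>t. t * (1 - t)) has_field_derivative 1 - 2 * t) (at t)"
    by (auto intro!: derivative_eq_intros)
  have "((\<lambda>t. poly p t / (t * (1 - t)) ^ m) has_field_derivative
      (poly (pderiv p) t * u ^ m - poly p t * (real m * (1 - 2 * t) * u ^ (m - 1))) / (u ^ m * u ^ m)) (at t)"
    using DERIV_divide[OF poly_DERIV[of p t] DERIV_power[OF du, of m]] True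
    by (simp add: u_def mult_ac)
  moreover have "((\<lambda>t. exp (- 1 / (t * (1 - t)))) has_field_derivative
      exp (- 1 / u) * ((1 - 2 * t) / (u * u))) (at t)"
    using DERIV_fun_exp[OF DERIV_divide[OF DERIV_const[of "-1"] du]] True
    by (simp add: u_def mult_ac)
  ultimately have "((\<lambda>t. poly p t / (t * (1 - t)) ^ m * exp (- 1 / (t * (1 - t)))) has_field_derivative
     (((poly (pderiv p) t * u ^ m - poly p t * (real m * (1 - 2 * t) * u ^ (m - 1))) / (u ^ m * u ^ m))
        * exp (- 1 / u) + exp (- 1 / u) * ((1 - 2 * t) / (u * u)) * (poly p t / u ^ m))) (at t)"
    unfolding u_def by (rule DERIV_mult)
  also have "((poly (pderiv p) t * u ^ m - poly p t * (real m * (1 - 2 * t) * u ^ (m - 1))) / (u ^ m * u ^ m))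
        * exp (- 1 / u) + exp (- 1 / u) * ((1 - 2 * t) / (u * u)) * (poly p t / u ^ m) =
     bump ?q (m + 2) t"
  proof -
    have 1: "(poly (pderiv p) t * u ^ m - poly p t * (real m * (1 - 2 * t) * u ^ (m - 1))) / (u ^ m * u ^ m)
       = (poly (pderiv p) t - poly p t * (1 - 2 * t) * real m / u) / u ^ m"
      using u by (cases m) (simp_all add: field_simps)
    have 2: "bump ?q (m + 2) t =
        (poly (pderiv p) t * u\<^sup>2 + poly p t * (1 - 2 * t) * (1 - real m * u)) / u ^ (m + 2) * exp (- 1 / u)"
      using True by (simp add: bump_def u_def algebra_simps)
    show ?thesis
      unfolding 1 2 using u by (simp add: field_simps power2_eq_square)
  qed
  finally have "((\<lambda>t. poly p t / (t * (1 - t)) ^ m * exp (- 1 / (t * (1 - t)))) has_field_derivative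
      bump ?q (m + 2) t) (at t)" .
  then show ?thesis
    by (rule has_field_derivative_transform_within_open[where S = "{0<..<1}"])
      (use True in \<open>auto simp: bump_def\<close>)
next
  case False
  obtain C where C: "\<And>s a. a \<le> 0 \<or> 1 \<le> a \<Longrightarrow> \<bar>bump p m s\<bar> \<le> C * (s - a)\<^sup>2"
    using bump_le[of p m] by metis
  \<comment> \<open>The point may be 0 or 1, where the function does not vanish on a neighbourhood;
    the quadratic bound covers these points as well.\<close>
  have "(bump p m has_field_derivative 0) (at t)"
    by (intro DERIV_0_of_quadratic_bound[of _ C] C) (use False in linarith)
  moreover have "bump ?q (m + 2) t = 0"
    using False unfolding bump_def by (rule if_not_P)
  ultimately show ?thesis by simp
qed

lemma bump_higher_deriv:
  obtains q j where "(deriv ^^ k) (bump p m) = bump q j"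
proof -
  have "(deriv ^^ k) (bump p m) \<in> range (\<lambda>(p, m). bump p m)"
  proof (rule higher_deriv_closed(1))
    fix f assume "f \<in> range (\<lambda>(p, m). bump p m)"
    then obtain p m where "f = bump p m" by auto
    with bump_DERIV[of p m] show "\<exists>f'\<in>range (\<lambda>(p, m). bump p m). \<forall>x. (f has_field_derivative f' x) (at x)"
      by (intro bexI) auto
  qed auto
  then show thesis using that by auto
qed

lemma bump_differentiable: "bump p m field_differentiable (at t)"
  using bump_DERIV field_differentiable_def by blast

lemma bump_eq_0: "t \<le> 0 \<or> 1 \<le> t \<Longrightarrow> bump p m t = 0"
  by (auto simp: bump_def)

text \<open>For \<open>n \<ge> 1\<close> it vanishes outside the cell [k/n, (k+1)/n), on which a
  step function is constant, so pairing with it reads off the value with index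
  \<open>k\<close>.\<close>

definition cell_bump :: "nat \<Rightarrow> int \<Rightarrow> real \<Rightarrow> real" where
  "cell_bump n k t = bump 1 0 (real n * t - real_of_int k)"

lemma cell_bump_higher_deriv:
  "(deriv ^^ j) (cell_bump n k) = (\<lambda>t. real n ^ j * (deriv ^^ j) (bump 1 0) (real n * t - k))"
  "(deriv ^^ j) (cell_bump n k) field_differentiable (at t)"
proof -
  have D: "((\<lambda>t. real n ^ j * (deriv ^^ j) (bump 1 0) (real n * t - k)) has_field_derivative
      real n ^ Suc j * (deriv ^^ Suc j) (bump 1 0) (real n * t - k)) (at t)" for t j
  proof -
    obtain q m where qm: "(deriv ^^ j) (bump 1 0) = bump q m" using bump_higher_deriv by blast
    have "((deriv ^^ j) (bump 1 0) has_field_derivative (deriv ^^ Suc j) (bump 1 0) s) (at s)" for s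
      using bump_differentiable[of q m s] by (simp add: qm DERIV_deriv_iff_field_differentiable)
    then have "((\<lambda>t. (deriv ^^ j) (bump 1 0) (real n * t - k)) has_field_derivative
        (deriv ^^ Suc j) (bump 1 0) (real n * t - k) * real n) (at t)"
      by (rule DERIV_chain2) (auto intro!: derivative_eq_intros)
    from DERIV_cmult[OF this, of "real n ^ j"] show ?thesis by (simp add: mult_ac)
  qed
  show 1: "(deriv ^^ j) (cell_bump n k) = (\<lambda>t. real n ^ j * (deriv ^^ j) (bump 1 0) (real n * t - k))" for j
  proof (induction j)
    case 0
    show ?case by (simp add: cell_bump_def fun_eq_iff)
  next
    case (Suc j)
    have "(deriv ^^ Suc j) (cell_bump n k) t = real n ^ Suc j * (deriv ^^ Suc j) (bump 1 0) (real n * t - k)" for t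
      using DERIV_imp_deriv[OF D[of j t]] Suc by simp
    then show ?case by blast
  qed
  show "(deriv ^^ j) (cell_bump n k) field_differentiable (at t)"
    unfolding 1 using D field_differentiable_def by blast
qed

text \<open>Each derivative brings out a factor \<open>n\<close>, and on the support
  \<open>\<bar>t\<bar> \<le> 1 + \<bar>k\<bar>\<close>. The growth in \<open>k\<close> is therefore
  polynomial, with a degree fixed by the norm.\<close>

lemma cell_bump_bound:
  obtains C where "C \<ge> 0" "\<And>n k m t. n \<ge> 1 \<Longrightarrow> m \<le> N \<Longrightarrow>
    \<bar>t ^ m * (deriv ^^ j) (cell_bump n k) t\<bar> \<le> C * real n ^ j * (1 + \<bar>real_of_int k\<bar>) ^ N"
proof -
  obtain q l where ql: "(deriv ^^ j) (bump 1 0) = bump q l" using bump_higher_deriv by blast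
  obtain C where C: "C \<ge> 0" "\<And>t. \<bar>bump q l t\<bar> \<le> C" using bump_le by metis
  have "\<bar>t ^ m * (deriv ^^ j) (cell_bump n k) t\<bar> \<le> C * real n ^ j * (1 + \<bar>real_of_int k\<bar>) ^ N"
    if "n \<ge> 1" "m \<le> N" for n k m t
  proof (cases "real n * t - k \<le> 0 \<or> 1 \<le> real n * t - k")
    case True
    then show ?thesis using C by (simp add: cell_bump_higher_deriv ql bump_eq_0)
  next
    case False
    have "\<bar>t\<bar> \<le> real n * \<bar>t\<bar>" using that mult_right_mono[of 1 "real n" "\<bar>t\<bar>"] by simp
    also have "\<dots> = \<bar>real n * t\<bar>" by (simp add: abs_mult)
    also have "\<dots> \<le> 1 + \<bar>real_of_int k\<bar>" using False by linarith
    finally have "\<bar>t\<bar> ^ m \<le> (1 + \<bar>real_of_int k\<bar>) ^ m" by (intro power_mono) auto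
    also have "\<dots> \<le> (1 + \<bar>real_of_int k\<bar>) ^ N" using that by (intro power_increasing) auto
    finally have "\<bar>t\<bar> ^ m * \<bar>bump q l (real n * t - k)\<bar> \<le> (1 + \<bar>real_of_int k\<bar>) ^ N * C"
      by (intro mult_mono C) auto
    then have "real n ^ j * (\<bar>t\<bar> ^ m * \<bar>bump q l (real n * t - k)\<bar>) \<le> real n ^ j * ((1 + \<bar>real_of_int k\<bar>) ^ N * C)"
      by (intro mult_left_mono) auto
    then show ?thesis
      by (simp add: cell_bump_higher_deriv ql abs_mult power_abs mult_ac)
  qed
  then show thesis using that C by blast
qed

lemma is_schwartz_cell_bump:
  assumes "n \<ge> 1"
  shows "is_schwartz (cell_bump n k)"
  unfolding is_schwartz_def
proof (intro conjI allI)
  fix m j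
  obtain C where "\<And>n k t. n \<ge> 1 \<Longrightarrow>
      \<bar>t ^ m * (deriv ^^ j) (cell_bump n k) t\<bar> \<le> C * real n ^ j * (1 + \<bar>real_of_int k\<bar>) ^ m"
    using cell_bump_bound[of m j] by (metis order_refl)
  then show "bounded (range (\<lambda>t. t ^ m * (deriv ^^ j) (cell_bump n k) t))"
    using assms unfolding bounded_iff by (intro exI) auto
qed (rule cell_bump_higher_deriv)

lemma cell_bump_norm:
  assumes "n \<ge> 1"
  obtains C where "C \<ge> 0" "\<And>k. schwartz_norm N (Abs_schwartz (cell_bump n k)) \<le> C * (1 + \<bar>real_of_int k\<bar>) ^ N"
proof -
  have "\<exists>C\<ge>0. \<forall>n k m t. n \<ge> 1 \<longrightarrow> m \<le> N \<longrightarrow>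
    \<bar>t ^ m * (deriv ^^ j) (cell_bump n k) t\<bar> \<le> C * real n ^ j * (1 + \<bar>real_of_int k\<bar>) ^ N" for j
    using cell_bump_bound[of N j] by metis
  then obtain C where C: "\<And>j. C j \<ge> 0" "\<And>j n k m t. n \<ge> 1 \<Longrightarrow> m \<le> N \<Longrightarrow>
    \<bar>t ^ m * (deriv ^^ j) (cell_bump n k) t\<bar> \<le> C j * real n ^ j * (1 + \<bar>real_of_int k\<bar>) ^ N"
    by metis
  define D where "D = (\<Sum>j\<le>N. C j * real n ^ j)"
  have "D \<ge> 0" using C by (auto simp: D_def intro!: sum_nonneg mult_nonneg_nonneg)
  have "schwartz_norm N (Abs_schwartz (cell_bump n k)) \<le> (real N + 1)\<^sup>2 * (D * (1 + \<bar>real_of_int k\<bar>) ^ N)" for k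
  proof (intro schwartz_norm_least schwartz_seminorm_least)
    fix m j t assume mj: "m \<le> N" "j \<le> N"
    have "\<bar>t ^ m * sderiv j (Abs_schwartz (cell_bump n k)) t\<bar> \<le> C j * real n ^ j * (1 + \<bar>real_of_int k\<bar>) ^ N"
      using C(2)[OF assms mj(1)] is_schwartz_cell_bump[OF assms, of k] by (simp add: Abs_schwartz_inverse)
    also have "\<dots> \<le> D * (1 + \<bar>real_of_int k\<bar>) ^ N"
      unfolding D_def using C(1) mj
      by (intro mult_right_mono member_le_sum) auto
    finally show "\<bar>t ^ m * sderiv j (Abs_schwartz (cell_bump n k)) t\<bar> \<le> D * (1 + \<bar>real_of_int k\<bar>) ^ N" .
  qed
  then show thesis using \<open>D \<ge> 0\<close> by (intro that[of "(real N + 1)\<^sup>2 * D"]) (auto simp: mult.assoc)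
qed

lemma cell_bump_integral:
  assumes "n \<ge> 1"
  shows "(LBINT t. cell_bump n k t) = (LBINT t. bump 1 0 t) / real n"
  using assms lborel_integral_real_affine[of "real n" "bump 1 0" "- real_of_int k"]
  by (simp add: cell_bump_def)

lemma bump_integral_pos: "0 < (LBINT t. bump 1 0 t)"
proof -
  have "continuous_on UNIV (bump 1 0)"
    by (meson bump_DERIV DERIV_isCont continuous_at_imp_continuous_on)
  then have meas [measurable]: "bump 1 0 \<in> borel_measurable borel"
    by (rule borel_measurable_continuous_onI)
  have bd: "0 \<le> bump 1 0 t" "bump 1 0 t \<le> indicator {0..1} t" for t
    by (auto simp: bump_def indicator_def)
  have int: "integrable lborel (bump 1 0)"
    by (rule Bochner_Integration.integrable_bound[of _ "indicator {0..1} :: real \<Rightarrow> real"])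
      (use bd in \<open>auto simp: abs_of_nonneg\<close>)
  \<comment> \<open>On [1/4, 3/4] one has t(1-t) at least 3/16, so the exponent is at least -16/3,
    which exceeds -6.\<close>
  have "exp (-6) * indicator {1/4..3/4} t \<le> bump 1 0 t" for t :: real
  proof (cases "t \<in> {1/4..3/4}")
    case True
    have "0 \<le> (t - 1/4) * (3/4 - t)" using True by auto
    then have "3 / 16 \<le> t * (1 - t)" by (simp add: field_simps)
    moreover from this have "1 / (t * (1 - t)) \<le> 1 / (3 / 16)" by (intro divide_left_mono) auto
    ultimately show ?thesis using True by (simp add: bump_def indicator_def)
  qed (use bd in auto)
  then have "(LBINT t. exp (-6::real) * indicator {1/4..3/4::real} t) \<le> (LBINT t. bump 1 0 t)"
    using int by (intro integral_mono integrable_mult_right)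
      (auto intro!: integrable_real_indicator simp: less_top[symmetric])
  moreover have "(LBINT t. exp (-6::real) * indicator {1/4..3/4::real} t) = exp (-6::real) / 2"
    by simp
  ultimately show ?thesis
    using exp_gt_zero[of "-6::real"] by linarith
qed

text \<open>A single natural number is both constant and degree, so polynomial growth is a countable
  union of conditions, each measurable in the values.\<close>

definition poly_bounded :: "nat \<Rightarrow> (int \<Rightarrow> real) \<Rightarrow> bool" where
  "poly_bounded p c \<longleftrightarrow> (\<forall>k. \<bar>c k\<bar> \<le> real p * (1 + \<bar>real_of_int k\<bar>) ^ p)"

text \<open>Pairing with the bump of cell \<open>k\<close> gives \<open>c k\<close> times a positive
  constant independent of \<open>k\<close>, while continuity of the distribution bounds this pairing
  by a Schwartz norm that grows polynomially in \<open>k\<close>.\<close>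

lemma poly_bounded_of_represents:
  assumes x: "represents x (\<lambda>t. c \<lfloor>real n * t\<rfloor>)" and n: "n \<ge> 1"
  obtains p where "poly_bounded p c"
proof -
  obtain N K where K: "K \<ge> 0" "\<And>\<phi>. \<bar>pairing x \<phi>\<bar> \<le> K * schwartz_norm N \<phi>"
    using continuous_linear_schwartz_bound[OF linear_pairing continuous_pairing] by metis
  obtain C where C: "C \<ge> 0"
    "\<And>k. schwartz_norm N (Abs_schwartz (cell_bump n k)) \<le> C * (1 + \<bar>real_of_int k\<bar>) ^ N"
    using cell_bump_norm[OF n] by metis
  define I where "I = (LBINT t. bump 1 0 t)"
  have "I > 0" unfolding I_def by (rule bump_integral_pos)
  have bd: "\<bar>c k\<bar> \<le> (K * C * n / I) * (1 + \<bar>real_of_int k\<bar>) ^ N" for k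
  proof -
    have eq: "c \<lfloor>real n * t\<rfloor> * cell_bump n k t = c k * cell_bump n k t" for t
    proof (cases "real n * t - k \<le> 0 \<or> 1 \<le> real n * t - k")
      case True
      then show ?thesis by (simp add: cell_bump_def bump_eq_0)
    next
      case False
      then have "\<lfloor>real n * t\<rfloor> = k" by (intro floor_unique) auto
      then show ?thesis by simp
    qed
    have "pairing x (Abs_schwartz (cell_bump n k)) = (LBINT t. c \<lfloor>real n * t\<rfloor> * cell_bump n k t)"
      using x is_schwartz_cell_bump[OF n, of k] by (simp add: represents_def Abs_schwartz_inverse)
    also have "\<dots> = c k * (I / n)"
      by (simp add: eq cell_bump_integral[OF n] I_def)
    finally have "\<bar>c k\<bar> * (I / n) \<le> K * schwartz_norm N (Abs_schwartz (cell_bump n k))"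
      using K(2)[of "Abs_schwartz (cell_bump n k)"] \<open>I > 0\<close> by (simp add: abs_mult)
    also have "\<dots> \<le> K * (C * (1 + \<bar>real_of_int k\<bar>) ^ N)"
      using C(2)[of k] K(1) by (rule mult_left_mono)
    finally show ?thesis using \<open>I > 0\<close> n by (simp add: field_simps)
  qed
  define p where "p = max N (nat \<lceil>K * C * n / I\<rceil>)"
  have "K * C * n / I \<le> real p"
    unfolding p_def by (meson max.cobounded2 of_nat_le_iff order_trans real_nat_ceiling_ge)
  have "poly_bounded p c"
    unfolding poly_bounded_def
  proof
    fix k
    have "(K * C * n / I) * (1 + \<bar>real_of_int k\<bar>) ^ N \<le> real p * (1 + \<bar>real_of_int k\<bar>) ^ p"
      using \<open>K * C * n / I \<le> real p\<close> by (intro mult_mono power_increasing) (auto simp: p_def)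
    then show "\<bar>c k\<bar> \<le> real p * (1 + \<bar>real_of_int k\<bar>) ^ p" using bd[of k] by linarith
  qed
  then show thesis by (rule that)
qed

section \<open>Distributions given by step functions\<close>

lemma integrable_inverse_quadratic: "integrable lborel (\<lambda>t::real. inverse (1 + t\<^sup>2))"
  using integrable_inverse_1_plus_square by (simp add: set_integrable_def einterval_eq)

lemma one_plus_abs_power_le: "(1 + \<bar>t\<bar>) ^ p \<le> 2 ^ p * (1 + \<bar>t :: real\<bar> ^ p)"
proof -
  have "(1 + \<bar>t\<bar>) ^ p \<le> (2 * max 1 \<bar>t\<bar>) ^ p" by (intro power_mono) auto
  also have "\<dots> \<le> 2 ^ p * (1 + \<bar>t\<bar> ^ p)"
    by (auto simp: power_mult_distrib max_def)
  finally show ?thesis .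
qed

lemma sderiv_decay:
  assumes "p \<le> N" "k \<le> N"
  shows "(1 + \<bar>t\<bar>) ^ p * \<bar>sderiv k \<phi> t\<bar> \<le> 2 ^ Suc p * schwartz_norm N \<phi>"
proof -
  have "(1 + \<bar>t\<bar>) ^ p * \<bar>sderiv k \<phi> t\<bar> \<le> 2 ^ p * (1 + \<bar>t\<bar> ^ p) * \<bar>sderiv k \<phi> t\<bar>"
    by (intro mult_right_mono one_plus_abs_power_le) auto
  also have "\<dots> = 2 ^ p * (\<bar>t ^ 0 * sderiv k \<phi> t\<bar> + \<bar>t ^ p * sderiv k \<phi> t\<bar>)"
    by (simp add: algebra_simps abs_mult power_abs)
  also have "\<dots> \<le> 2 ^ p * (schwartz_norm N \<phi> + schwartz_norm N \<phi>)"
    using assms by (intro mult_left_mono add_mono abs_power_sderiv_le_norm) auto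
  finally show ?thesis by simp
qed

text \<open>Two powers of decay beyond the growth of \<open>f\<close> are spent on the integrable
  factor \<open>inverse (1 + t\<^sup>2)\<close>.\<close>

lemma growth_times_schwartz_le:
  assumes f: "\<And>t. \<bar>f t\<bar> \<le> C * (1 + \<bar>t\<bar>) ^ p"
  shows "\<bar>f t * schwartz_fun \<phi> t\<bar> \<le> C * 2 ^ (p + 3) * schwartz_norm (p + 2) \<phi> * inverse (1 + t\<^sup>2)"
proof -
  have "C \<ge> 0" using f[of 0] by simp
  have "1 + t\<^sup>2 \<le> (1 + \<bar>t\<bar>)\<^sup>2" by (simp add: power2_eq_square algebra_simps)
  then have "\<bar>f t\<bar> * \<bar>schwartz_fun \<phi> t\<bar> * (1 + t\<^sup>2) \<le> (C * (1 + \<bar>t\<bar>) ^ p) * \<bar>schwartz_fun \<phi> t\<bar> * (1 + \<bar>t\<bar>)\<^sup>2"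
    using f[of t] \<open>C \<ge> 0\<close> by (intro mult_mono) auto
  also have "\<dots> = C * ((1 + \<bar>t\<bar>) ^ (p + 2) * \<bar>sderiv 0 \<phi> t\<bar>)"
    by (simp add: power_add power2_eq_square mult_ac)
  also have "\<dots> \<le> C * (2 ^ Suc (p + 2) * schwartz_norm (p + 2) \<phi>)"
    using \<open>C \<ge> 0\<close> by (intro mult_left_mono sderiv_decay) auto
  finally have "\<bar>f t * schwartz_fun \<phi> t\<bar> * (1 + t\<^sup>2) \<le> C * 2 ^ (p + 3) * schwartz_norm (p + 2) \<phi>"
    by (simp add: abs_mult mult_ac numeral_3_eq_3)
  moreover have "1 + t\<^sup>2 > 0" by (intro add_pos_nonneg) auto
  ultimately show ?thesis by (simp add: field_simps)
qed

lemma growth_times_schwartz_integrable: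
  assumes [measurable]: "f \<in> borel_measurable borel" and f: "\<And>t. \<bar>f t\<bar> \<le> C * (1 + \<bar>t\<bar>) ^ p"
  shows "integrable lborel (\<lambda>t. f t * schwartz_fun \<phi> t)"
    and "\<bar>LBINT t. f t * schwartz_fun \<phi> t\<bar> \<le>
      C * 2 ^ (p + 3) * (LBINT t::real. inverse (1 + t\<^sup>2)) * schwartz_norm (p + 2) \<phi>"
proof -
  let ?K = "C * 2 ^ (p + 3) * schwartz_norm (p + 2) \<phi>"
  have dom: "integrable lborel (\<lambda>t::real. ?K * inverse (1 + t\<^sup>2))"
    by (intro integrable_mult_right integrable_inverse_quadratic)
  show int: "integrable lborel (\<lambda>t. f t * schwartz_fun \<phi> t)"
    by (rule Bochner_Integration.integrable_bound[OF dom])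
      (auto intro!: AE_I2 order_trans[OF growth_times_schwartz_le[OF f]] abs_ge_self)
  have "\<bar>LBINT t. f t * schwartz_fun \<phi> t\<bar> \<le> (LBINT t. \<bar>f t * schwartz_fun \<phi> t\<bar>)"
    by (rule integral_abs_bound)
  also have "\<dots> \<le> (LBINT t::real. ?K * inverse (1 + t\<^sup>2))"
    using int dom by (intro integral_mono growth_times_schwartz_le[OF f]) auto
  also have "\<dots> = ?K * (LBINT t::real. inverse (1 + t\<^sup>2))" by simp
  finally show "\<bar>LBINT t. f t * schwartz_fun \<phi> t\<bar> \<le>
      C * 2 ^ (p + 3) * (LBINT t::real. inverse (1 + t\<^sup>2)) * schwartz_norm (p + 2) \<phi>"
    by (simp add: mult_ac)
qed

lemma schwartz_integrable: "integrable lborel (schwartz_fun \<phi>)"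
  using growth_times_schwartz_integrable(1)[of "\<lambda>_. 1" 1 0 \<phi>] by simp

lemma step_measurable [measurable]:
  fixes c :: "int \<Rightarrow> real"
  shows "(\<lambda>t. c \<lfloor>real n * t\<rfloor>) \<in> borel_measurable borel"
  by measurable

lemma step_growth:
  assumes "poly_bounded p c" "n \<ge> 1"
  shows "\<bar>c \<lfloor>real n * t\<rfloor>\<bar> \<le> real p * (2 * real n) ^ p * (1 + \<bar>t\<bar>) ^ p"
proof -
  have "1 + \<bar>real_of_int \<lfloor>real n * t\<rfloor>\<bar> \<le> 2 + \<bar>real n * t\<bar>" by linarith
  also have "\<dots> \<le> (2 * real n) * (1 + \<bar>t\<bar>)"
  proof -
    have "2 + \<bar>real n * t\<bar> \<le> 2 * real n + 2 * real n * \<bar>t\<bar>"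
      using assms(2) by (intro add_mono) (simp_all add: abs_mult mult_right_mono)
    then show ?thesis by (simp add: distrib_left)
  qed
  finally have "(1 + \<bar>real_of_int \<lfloor>real n * t\<rfloor>\<bar>) ^ p \<le> ((2 * real n) * (1 + \<bar>t\<bar>)) ^ p"
    by (intro power_mono) auto
  then have "real p * (1 + \<bar>real_of_int \<lfloor>real n * t\<rfloor>\<bar>) ^ p \<le> real p * ((2 * real n) ^ p * (1 + \<bar>t\<bar>) ^ p)"
    by (intro mult_left_mono) (auto simp: power_mult_distrib)
  moreover have "\<bar>c \<lfloor>real n * t\<rfloor>\<bar> \<le> real p * (1 + \<bar>real_of_int \<lfloor>real n * t\<rfloor>\<bar>) ^ p"
    using assms(1) by (auto simp: poly_bounded_def)
  ultimately show ?thesis by simp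
qed

text \<open>The order of the quantifiers matters: \<open>q\<close> depends on \<open>n\<close> and
  \<open>p\<close> but not on \<open>c\<close>, so all paths with the same growth bound land in one
  polar.\<close>

lemma represents_step:
  assumes "n \<ge> 1"
  obtains q where "\<And>c. poly_bounded p c \<Longrightarrow> \<exists>x\<in>polar q. represents x (\<lambda>t. c \<lfloor>real n * t\<rfloor>)"
proof -
  define K where "K = real p * (2 * real n) ^ p * 2 ^ (p + 3) * (LBINT t::real. inverse (1 + t\<^sup>2))"
  define q where "q = max (p + 2) (nat \<lceil>K\<rceil>)"
  have "\<exists>x\<in>polar q. represents x (\<lambda>t. c \<lfloor>real n * t\<rfloor>)" if c: "poly_bounded p c" for c
  proof -
    note g = growth_times_schwartz_integrable[OF step_measurable step_growth[OF c assms]]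
    define T where "T \<phi> = (LBINT t. c \<lfloor>real n * t\<rfloor> * schwartz_fun \<phi> t)" for \<phi>
    have T: "\<bar>T \<phi>\<bar> \<le> K * schwartz_norm (p + 2) \<phi>" for \<phi>
      using g(2)[of \<phi>] by (simp add: T_def K_def)
    have "linear T"
    proof (rule linearI)
      show "T (\<phi> + \<psi>) = T \<phi> + T \<psi>" for \<phi> \<psi>
        unfolding T_def plus_schwartz.rep_eq distrib_left
        by (intro Bochner_Integration.integral_add g)
      show "T (r *\<^sub>R \<phi>) = r *\<^sub>R T \<phi>" for r \<phi>
        unfolding T_def scaleR_schwartz.rep_eq by (simp add: mult.left_commute)
    qed
    then have T': "pairing (Abs_tempered T) = T"
      using bounded_linear_schwartz_continuous[OF _ T] by (intro Abs_tempered_inverse) auto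
    have "Abs_tempered T \<in> polar q"
      by (rule mem_polarI[where N = "p + 2" and C = K])
        (use T in \<open>auto simp: T' q_def intro: order_trans[OF real_nat_ceiling_ge]\<close>)
    moreover have "represents (Abs_tempered T) (\<lambda>t. c \<lfloor>real n * t\<rfloor>)"
      unfolding represents_def T' using g by (auto simp: T_def)
    ultimately show ?thesis by blast
  qed
  then show thesis by (rule that)
qed

lemma represents_step_iff:
  assumes "n \<ge> 1"
  shows "(\<exists>x. represents x (\<lambda>t. c \<lfloor>real n * t\<rfloor>)) \<longleftrightarrow> (\<exists>p. poly_bounded p c)"
  using poly_bounded_of_represents[OF _ assms] represents_step[OF assms] by meson

section \<open>Decomposition of integrals over the cells of a mesh\<close>

definition cell :: "nat \<Rightarrow> int \<Rightarrow> real set" where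
  "cell n k = {t. \<lfloor>real n * t\<rfloor> = k}"

lemma cell_measurable [measurable]: "cell n k \<in> sets borel"
proof -
  have "(\<lambda>t::real. \<lfloor>real n * t\<rfloor>) -` {k} \<inter> space borel \<in> sets borel"
    by (rule measurable_sets[of _ _ "count_space UNIV"]) auto
  then show ?thesis by (simp add: cell_def vimage_def)
qed

definition cell_integral :: "nat \<Rightarrow> (real \<Rightarrow> real) \<Rightarrow> int \<Rightarrow> real" where
  "cell_integral n h k = (LBINT t. indicator (cell n k) t * h t)"

lemma integrable_cell: "integrable lborel h \<Longrightarrow> integrable lborel (\<lambda>t. indicator (cell n k) t * h t :: real)"
  using integrable_real_mult_indicator[of "cell n k" lborel h] by (simp add: mult.commute)

lemma sum_cell_integral:
  assumes "integrable lborel h" "finite K"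
  shows "(\<Sum>k\<in>K. cell_integral n h k) = (LBINT t. indicator {t. \<lfloor>real n * t\<rfloor> \<in> K} t * h t)"
proof -
  have *: "(\<Sum>k\<in>K. indicator (cell n k) t * h t) = indicator {t. \<lfloor>real n * t\<rfloor> \<in> K} t * h t" for t
  proof (cases "\<lfloor>real n * t\<rfloor> \<in> K")
    case True
    have "(\<Sum>k\<in>K. indicator (cell n k) t * h t) = (\<Sum>k\<in>{\<lfloor>real n * t\<rfloor>}. indicator (cell n k) t * h t)"
      using True assms(2) by (intro sum.mono_neutral_right) (auto simp: cell_def)
    then show ?thesis using True by (simp add: cell_def)
  next
    case False
    then show ?thesis by (auto intro!: sum.neutral simp: cell_def indicator_def)
  qed
  have "(\<Sum>k\<in>K. cell_integral n h k) = (LBINT t. (\<Sum>k\<in>K. indicator (cell n k) t * h t))"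
    unfolding cell_integral_def
    by (intro Bochner_Integration.integral_sum[symmetric] integrable_cell assms)
  then show ?thesis by (simp only: *)
qed

lemma sum_cell_integral_tendsto:
  assumes "integrable lborel h"
  shows "(\<lambda>L. \<Sum>k\<in>{- int L..<int L}. cell_integral n h k) \<longlonglongrightarrow> (LBINT t. h t)"
proof -
  have [measurable]: "h \<in> borel_measurable borel" using assms by auto
  have meas: "{t. \<lfloor>real n * t\<rfloor> \<in> {- int L..<int L}} \<in> sets borel" for L
  proof -
    have "(\<lambda>t::real. \<lfloor>real n * t\<rfloor>) -` {- int L..<int L} \<inter> space borel \<in> sets borel"
      by (rule measurable_sets[of _ _ "count_space UNIV"]) auto
    then show ?thesis by (simp add: vimage_def)
  qed
  have "(\<lambda>L. LBINT t. indicator {t. \<lfloor>real n * t\<rfloor> \<in> {- int L..<int L}} t * h t) \<longlonglongrightarrow> (LBINT t. h t)"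
  proof (rule integral_dominated_convergence[where w = "\<lambda>t. \<bar>h t\<bar>"])
    show "(\<lambda>t. indicator {t. \<lfloor>real n * t\<rfloor> \<in> {- int L..<int L}} t * h t) \<in> borel_measurable lborel" for L
      using meas[of L] by measurable
    show "AE t in lborel. (\<lambda>L. indicator {t. \<lfloor>real n * t\<rfloor> \<in> {- int L..<int L}} t * h t) \<longlonglongrightarrow> h t"
    proof (rule AE_I2, rule tendsto_eventually)
      fix t
      show "\<forall>\<^sub>F L in sequentially. indicator {t. \<lfloor>real n * t\<rfloor> \<in> {- int L..<int L}} t * h t = h t"
        using eventually_gt_at_top[of "nat \<bar>\<lfloor>real n * t\<rfloor>\<bar>"] by eventually_elim (auto simp: indicator_def)
    qed
  qed (use assms in \<open>auto simp: indicator_def\<close>)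
  then show ?thesis
    using assms by (simp add: sum_cell_integral)
qed

text \<open>Expresses the pairing as a limit of finite linear combinations of the step values.
  Measurability, tightness and the characteristic functions all start from this.\<close>

lemma pairing_step_tendsto:
  assumes "represents x (\<lambda>t. c \<lfloor>real n * t\<rfloor>)"
  shows "(\<lambda>L. \<Sum>k\<in>{- int L..<int L}. c k * cell_integral n (schwartz_fun \<phi>) k) \<longlonglongrightarrow> pairing x \<phi>"
proof -
  have "cell_integral n (\<lambda>t. c \<lfloor>real n * t\<rfloor> * schwartz_fun \<phi> t) k = c k * cell_integral n (schwartz_fun \<phi>) k" for k
  proof -
    have *: "indicator (cell n k) t * (c \<lfloor>real n * t\<rfloor> * schwartz_fun \<phi> t) =
        c k * (indicator (cell n k) t * schwartz_fun \<phi> t)" for t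
      by (auto simp: cell_def indicator_def)
    show ?thesis unfolding cell_integral_def * by simp
  qed
  then show ?thesis
    using sum_cell_integral_tendsto[of "\<lambda>t. c \<lfloor>real n * t\<rfloor> * schwartz_fun \<phi> t" n] assms
    by (simp add: represents_def)
qed

text \<open>The measure need not be complete, so the exceptional paths matter: the set of representable
  paths must be shown to be measurable.\<close>

lemma distribution_of_step_measurable:
  fixes c :: "int \<Rightarrow> 'a \<Rightarrow> real"
  assumes [measurable]: "\<And>k. c k \<in> borel_measurable M" and n: "n \<ge> 1"
  shows "(\<lambda>\<omega>. distribution_of (\<lambda>t. c \<lfloor>real n * t\<rfloor> \<omega>)) \<in> borel_measurable M"
proof -
  define V where "V \<omega> = distribution_of (\<lambda>t. c \<lfloor>real n * t\<rfloor> \<omega>)" for \<omega>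
  define G where "G p = {\<omega> \<in> space M. poly_bounded p (\<lambda>k. c k \<omega>)}" for p
  have G [measurable]: "G p \<in> sets M" for p
    unfolding G_def poly_bounded_def by measurable
  \<comment> \<open>One polar is fixed for each growth bound \<open>p\<close>, valid for all paths
    with that bound.\<close>
  define q where "q p = (SOME q. \<forall>c. poly_bounded p c \<longrightarrow>
      (\<exists>x\<in>polar q. represents x (\<lambda>t. c \<lfloor>real n * t\<rfloor>)))" for p
  have q: "\<exists>x\<in>polar (q p). represents x (\<lambda>t. c \<lfloor>real n * t\<rfloor>)" if "poly_bounded p c" for p c
  proof -
    have "\<exists>q. \<forall>c. poly_bounded p c \<longrightarrow> (\<exists>x\<in>polar q. represents x (\<lambda>t. c \<lfloor>real n * t\<rfloor>))"
      using represents_step[OF n] by metis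
    from someI_ex[OF this] show ?thesis using that unfolding q_def by blast
  qed
  have V: "V \<omega> \<in> polar (q p)" "represents (V \<omega>) (\<lambda>t. c \<lfloor>real n * t\<rfloor> \<omega>)" if "\<omega> \<in> G p" for \<omega> p
    using q[of p "\<lambda>k. c k \<omega>"] that distribution_of_eq by (auto simp: V_def G_def)
  \<comment> \<open>Outside all \<open>G p\<close> no distribution represents the path, so
    \<open>distribution_of\<close> takes its default value 0.\<close>
  have V0: "V \<omega> = 0" if "\<omega> \<in> space M" "\<omega> \<notin> (\<Union>p. G p)" for \<omega>
    using that represents_step_iff[OF n, of "\<lambda>k. c k \<omega>"] by (simp add: V_def G_def distribution_of_def)
  have cyl: "V \<in> measurable M cylinder_algebra"
  proof (rule measurable_cylinder_algebraI)
    fix \<phi>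
    have "(\<lambda>\<omega>. if \<omega> \<in> (\<Union>p. G p) then lim (\<lambda>L. \<Sum>k\<in>{- int L..<int L}. c k \<omega> * cell_integral n (schwartz_fun \<phi>) k) else 0)
        \<in> borel_measurable M"
      by measurable
    also have "?this \<longleftrightarrow> (\<lambda>\<omega>. pairing (V \<omega>) \<phi>) \<in> borel_measurable M"
    proof (rule measurable_cong)
      fix \<omega> assume "\<omega> \<in> space M"
      then show "(if \<omega> \<in> (\<Union>p. G p) then lim (\<lambda>L. \<Sum>k\<in>{- int L..<int L}. c k \<omega> * cell_integral n (schwartz_fun \<phi>) k) else 0)
          = pairing (V \<omega>) \<phi>"
        using V0[of \<omega>] limI[OF pairing_step_tendsto[OF V(2)]] by (auto simp: zero_tempered.rep_eq)
    qed
    finally show "(\<lambda>\<omega>. pairing (V \<omega>) \<phi>) \<in> borel_measurable M" .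
  qed
  have "V \<in> borel_measurable M"
  proof (rule borel_measurableI)
    fix U :: "tempered set" assume "open U"
    then have "\<exists>W. W \<in> sets cylinder_algebra \<and> U \<inter> polar (q p) = W \<inter> polar (q p)" for p
      using open_polar_cylinder by metis
    then obtain W where W: "\<And>p. W p \<in> sets cylinder_algebra" "\<And>p. U \<inter> polar (q p) = W p \<inter> polar (q p)"
      by metis
    \<comment> \<open>On \<open>G p\<close> the values of \<open>V\<close> lie in
      \<open>polar (q p)\<close>, where \<open>U\<close> may be exchanged for the cylinder set
      \<open>W p\<close>; on the exceptional set \<open>V\<close> is the constant 0.\<close>
    have "V -` U \<inter> space M = (\<Union>p. (V -` W p \<inter> space M) \<inter> G p) \<union> (if 0 \<in> U then space M - (\<Union>p. G p) else {})"
      (is "?A = ?B")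
    proof (intro set_eqI)
      fix \<omega>
      show "\<omega> \<in> ?A \<longleftrightarrow> \<omega> \<in> ?B"
      proof (cases "\<omega> \<in> (\<Union>p. G p)")
        case True
        have "V \<omega> \<in> U \<longleftrightarrow> V \<omega> \<in> W p" if "\<omega> \<in> G p" for p
          using V(1)[OF that] W(2)[of p] by blast
        moreover have "\<omega> \<in> space M" using True by (auto simp: G_def)
        ultimately show ?thesis using True by auto
      next
        case False
        then show ?thesis using V0[of \<omega>] by auto
      qed
    qed
    moreover have "V -` W p \<inter> space M \<in> sets M" for p
      by (rule measurable_sets[OF cyl W(1)])
    ultimately show "V -` U \<inter> space M \<in> sets M" by auto
  qed
  then show ?thesis by (simp add: V_def[abs_def])
qed

section \<open>Averages of Schwartz functions over cells\<close>

lemma cell_eq: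
  assumes "n \<ge> 1"
  shows "cell n k = {real_of_int k / real n..<(real_of_int k + 1) / real n}"
  using assms by (auto simp: cell_def floor_eq_iff field_simps)

lemma integral_indicator_cell:
  assumes "n \<ge> 1"
  shows "integrable lborel (indicator (cell n k) :: real \<Rightarrow> real)"
    and "(LBINT t. indicator (cell n k) t) = 1 / real n"
  using assms by (auto simp: cell_eq field_simps intro!: integrable_real_indicator)

lemma cell_bounded_integrable:
  assumes "n \<ge> 1" and [measurable]: "h \<in> borel_measurable borel"
    and B: "\<And>t. t \<in> cell n k \<Longrightarrow> \<bar>h t\<bar> \<le> B"
  shows "integrable lborel (\<lambda>t. indicator (cell n k) t * h t)"
    and "\<bar>cell_integral n h k\<bar> \<le> B / real n"
proof -
  have dom: "integrable lborel (\<lambda>t. B * indicator (cell n k) t)"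
    by (intro integrable_mult_right integral_indicator_cell assms(1))
  have le: "\<bar>indicator (cell n k) t * h t\<bar> \<le> B * indicator (cell n k) t" for t
    using B[of t] by (auto simp: indicator_def)
  show int: "integrable lborel (\<lambda>t. indicator (cell n k) t * h t)"
    by (rule Bochner_Integration.integrable_bound[OF dom])
      (auto intro!: AE_I2 order_trans[OF le] abs_ge_self)
  have "\<bar>cell_integral n h k\<bar> \<le> (LBINT t. \<bar>indicator (cell n k) t * h t\<bar>)"
    unfolding cell_integral_def by (rule integral_abs_bound)
  also have "\<dots> \<le> (LBINT t. B * indicator (cell n k) t)"
    using int dom le by (intro integral_mono) auto
  also have "\<dots> = B / real n" using integral_indicator_cell(2)[OF assms(1)] by simp
  finally show "\<bar>cell_integral n h k\<bar> \<le> B / real n" .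
qed

text \<open>\<open>n\<close> times the cell integral is the mean over a cell of length 1/n, and the
  function is Lipschitz with constant \<open>D\<close>.\<close>

lemma cell_integral_average:
  assumes "n \<ge> 1" and D: "\<And>t. \<bar>sderiv 1 \<phi> t\<bar> \<le> D" and s: "s \<in> cell n k"
  shows "\<bar>schwartz_fun \<phi> s - real n * cell_integral n (schwartz_fun \<phi>) k\<bar> \<le> D / real n"
proof -
  have "D \<ge> 0" using D[of 0] by linarith
  have "\<bar>schwartz_fun \<phi> s - schwartz_fun \<phi> t\<bar> \<le> D / real n" if "t \<in> cell n k" for t
  proof -
    have "\<bar>sderiv 0 \<phi> s - sderiv 0 \<phi> t\<bar> \<le> D * \<bar>s - t\<bar>"
      using D by (intro sderiv_lipschitz) simp
    moreover have "\<bar>s - t\<bar> \<le> 1 / real n"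
    proof -
      have "k / n \<le> s" "s < k / n + 1 / n" "k / n \<le> t" "t < k / n + 1 / n"
        using s that by (simp_all add: cell_eq[OF assms(1)] add_divide_distrib)
      then show ?thesis by linarith
    qed
    then have "D * \<bar>s - t\<bar> \<le> D * (1 / real n)"
      using \<open>D \<ge> 0\<close> by (rule mult_left_mono)
    ultimately show ?thesis by simp
  qed
  then have "\<bar>cell_integral n (\<lambda>t. schwartz_fun \<phi> s - schwartz_fun \<phi> t) k\<bar> \<le> D / real n / real n"
    by (intro cell_bounded_integrable(2)[OF assms(1)]) auto
  moreover have "cell_integral n (\<lambda>t. schwartz_fun \<phi> s - schwartz_fun \<phi> t) k =
      schwartz_fun \<phi> s / real n - cell_integral n (schwartz_fun \<phi>) k"
    unfolding cell_integral_def right_diff_distrib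
    using integral_indicator_cell[OF assms(1)] integrable_cell[OF schwartz_integrable]
    by simp
  ultimately have "real n * \<bar>schwartz_fun \<phi> s / real n - cell_integral n (schwartz_fun \<phi>) k\<bar> \<le> D / real n"
    using assms(1) by (simp add: field_simps)
  moreover have "real n * \<bar>schwartz_fun \<phi> s / real n - cell_integral n (schwartz_fun \<phi>) k\<bar> =
     \<bar>schwartz_fun \<phi> s - real n * cell_integral n (schwartz_fun \<phi>) k\<bar>"
    using assms(1) by (simp add: abs_mult_pos' right_diff_distrib)
  ultimately show ?thesis by simp
qed

lemma sderiv_bounded: obtains B where "B \<ge> 0" "\<And>t. \<bar>sderiv k \<phi> t\<bar> \<le> B"
  using abs_power_sderiv_le_norm[of 0 k k _ \<phi>] schwartz_norm_nonneg[of k \<phi>] that by auto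

lemma schwartz_square_integrable: "integrable lborel (\<lambda>t. (schwartz_fun \<phi> t)\<^sup>2)"
proof -
  obtain B where B: "B \<ge> 0" "\<And>t. \<bar>sderiv 0 \<phi> t\<bar> \<le> B" using sderiv_bounded by blast
  show ?thesis
  proof (rule Bochner_Integration.integrable_bound[of _ "\<lambda>t. B * \<bar>schwartz_fun \<phi> t\<bar>"])
    show "integrable lborel (\<lambda>t. B * \<bar>schwartz_fun \<phi> t\<bar>)"
      by (intro integrable_mult_right integrable_abs schwartz_integrable)
    show "AE t in lborel. norm ((schwartz_fun \<phi> t)\<^sup>2) \<le> norm (B * \<bar>schwartz_fun \<phi> t\<bar>)"
    proof (rule AE_I2)
      fix t
      have "\<bar>schwartz_fun \<phi> t\<bar> * \<bar>schwartz_fun \<phi> t\<bar> \<le> B * \<bar>schwartz_fun \<phi> t\<bar>"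
        using B(2)[of t] by (intro mult_right_mono) auto
      then show "norm ((schwartz_fun \<phi> t)\<^sup>2) \<le> norm (B * \<bar>schwartz_fun \<phi> t\<bar>)"
        using B(1) by (simp add: power2_eq_square abs_mult)
    qed
  qed auto
qed

text \<open>With \<open>a\<close> the cell integral of the function, the difference is the integral
  over the cell of the function times its deviation from the mean \<open>n * a\<close>. Keeping the
  absolute value of the function inside the bound makes the errors summable over all cells.\<close>

lemma cell_integral_square:
  assumes "n \<ge> 1" and D: "\<And>t. \<bar>sderiv 1 \<phi> t\<bar> \<le> D"
  shows "\<bar>cell_integral n (\<lambda>t. (schwartz_fun \<phi> t)\<^sup>2) k - real n * (cell_integral n (schwartz_fun \<phi>) k)\<^sup>2\<bar>
    \<le> D / real n * cell_integral n (\<lambda>t. \<bar>schwartz_fun \<phi> t\<bar>) k"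
proof -
  define a where "a = cell_integral n (schwartz_fun \<phi>) k"
  let ?h = "\<lambda>t. indicator (cell n k) t * (schwartz_fun \<phi> t)\<^sup>2 - (real n * a) * (indicator (cell n k) t * schwartz_fun \<phi> t)"
  have int: "integrable lborel ?h"
    by (intro Bochner_Integration.integrable_diff integrable_mult_right integrable_cell
        schwartz_integrable schwartz_square_integrable)
  have eq: "cell_integral n (\<lambda>t. (schwartz_fun \<phi> t)\<^sup>2) k - real n * a\<^sup>2 = (LBINT t. ?h t)"
    using integrable_cell[OF schwartz_integrable, of n k \<phi>]
      integrable_cell[OF schwartz_square_integrable, of n k \<phi>]
    by (simp add: cell_integral_def[symmetric] a_def[symmetric] power2_eq_square)
  have "\<bar>cell_integral n (\<lambda>t. (schwartz_fun \<phi> t)\<^sup>2) k - real n * a\<^sup>2\<bar> \<le> (LBINT t. \<bar>?h t\<bar>)"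
    unfolding eq by (rule integral_abs_bound)
  also have "\<dots> \<le> (LBINT t. D / real n * (indicator (cell n k) t * \<bar>schwartz_fun \<phi> t\<bar>))"
  proof (rule integral_mono)
    show "integrable lborel (\<lambda>t. \<bar>?h t\<bar>)" using int by (rule integrable_abs)
    show "integrable lborel (\<lambda>t. D / real n * (indicator (cell n k) t * \<bar>schwartz_fun \<phi> t\<bar>))"
      by (intro integrable_mult_right integrable_cell integrable_abs schwartz_integrable)
    fix t
    show "\<bar>?h t\<bar> \<le> D / real n * (indicator (cell n k) t * \<bar>schwartz_fun \<phi> t\<bar>)"
    proof (cases "t \<in> cell n k")
      case True
      have "\<bar>?h t\<bar> = \<bar>schwartz_fun \<phi> t - real n * a\<bar> * \<bar>schwartz_fun \<phi> t\<bar>"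
        using True by (simp add: abs_mult[symmetric] algebra_simps power2_eq_square)
      also have "\<dots> \<le> D / real n * \<bar>schwartz_fun \<phi> t\<bar>"
        unfolding a_def by (intro mult_right_mono cell_integral_average[OF assms True]) auto
      finally show ?thesis using True by simp
    qed simp
  qed
  also have "\<dots> = D / real n * cell_integral n (\<lambda>t. \<bar>schwartz_fun \<phi> t\<bar>) k"
    unfolding cell_integral_def by simp
  finally show ?thesis by (simp add: a_def)
qed

text \<open>Translating by 1/n brings both integrals to the same cell, and the mean value theorem
  applies to the integrand. The intermediate points stay within the two cells, hence the interval up
  to (k+2)/n.\<close>

lemma cell_integral_diff:
  assumes n: "n \<ge> 1" and B: "\<And>z. k / n \<le> z \<Longrightarrow> z \<le> (k + 2) / n \<Longrightarrow> \<bar>sderiv 1 \<phi> z\<bar> \<le> B"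
  shows "\<bar>cell_integral n (schwartz_fun \<phi>) k - cell_integral n (schwartz_fun \<phi>) (k + 1)\<bar> \<le> B / (real n)\<^sup>2"
proof -
  let ?g = "\<lambda>t. schwartz_fun \<phi> (t + 1 / n)"
  have shift: "indicator (cell n (k + 1)) (t + 1 / n) = (indicator (cell n k) t :: real)" for t
    using n by (auto simp: cell_eq add_divide_distrib indicator_def)
  have "integrable lborel (\<lambda>t. indicator (cell n (k + 1)) (1 / n + 1 * t) * schwartz_fun \<phi> (1 / n + 1 * t))"
    by (rule lborel_integrable_real_affine[OF integrable_cell[OF schwartz_integrable]]) simp
  then have int: "integrable lborel (\<lambda>t. indicator (cell n k) t * ?g t)"
    by (simp add: shift add.commute[of "1 / n"])
  have eq: "cell_integral n (schwartz_fun \<phi>) (k + 1) = (LBINT t. indicator (cell n k) t * ?g t)"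
    unfolding cell_integral_def
    using lborel_integral_real_affine[of 1 "\<lambda>t. indicator (cell n (k + 1)) t * schwartz_fun \<phi> t" "1 / n"]
    by (simp add: shift add.commute[of "1 / n"])
  have eq': "cell_integral n (schwartz_fun \<phi>) k - cell_integral n (schwartz_fun \<phi>) (k + 1) =
      cell_integral n (\<lambda>t. schwartz_fun \<phi> t - ?g t) k"
    unfolding eq unfolding cell_integral_def right_diff_distrib
    by (rule Bochner_Integration.integral_diff[symmetric, OF integrable_cell[OF schwartz_integrable] int])
  have "\<bar>cell_integral n (\<lambda>t. schwartz_fun \<phi> t - ?g t) k\<bar> \<le> (B / n) / n"
  proof (rule cell_bounded_integrable(2)[OF n])
    fix t assume t: "t \<in> cell n k"
    have "t < t + 1 / n" using n by simp
    then obtain z where z: "t < z" "z < t + 1 / n" "?g t - schwartz_fun \<phi> t = (t + 1 / n - t) * sderiv 1 \<phi> z"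
      using MVT2[of t "t + 1 / n" "sderiv 0 \<phi>" "sderiv 1 \<phi>"] sderiv_DERIV[of 0 \<phi>] by auto
    have "\<bar>sderiv 1 \<phi> z\<bar> \<le> B"
      using z(1,2) t n by (intro B) (auto simp: cell_eq add_divide_distrib)
    then have "\<bar>?g t - schwartz_fun \<phi> t\<bar> \<le> B / n"
      unfolding z(3) by (simp add: abs_mult divide_right_mono)
    then show "\<bar>schwartz_fun \<phi> t - ?g t\<bar> \<le> B / n" by (simp add: abs_minus_commute)
  qed simp
  then show ?thesis unfolding eq' by (simp add: power2_eq_square)
qed

text \<open>The constant 32 is 2^5, the worst case \<open>p = 4\<close> of
  \<open>sderiv_decay\<close>.\<close>

lemma sderiv_le_inverse_power:
  assumes "p \<le> 4" "k \<le> 4" "(0::real) \<le> y" "y \<le> \<bar>t\<bar>"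
  shows "\<bar>sderiv k \<phi> t\<bar> \<le> 32 * schwartz_norm 4 \<phi> / (1 + y) ^ p"
proof -
  have "(1 + y) ^ p * \<bar>sderiv k \<phi> t\<bar> \<le> (1 + \<bar>t\<bar>) ^ p * \<bar>sderiv k \<phi> t\<bar>"
    using assms by (intro mult_right_mono power_mono) auto
  also have "\<dots> \<le> 2 ^ Suc p * schwartz_norm 4 \<phi>" by (intro sderiv_decay assms)
  also have "\<dots> \<le> 2 ^ 5 * schwartz_norm 4 \<phi>"
    using assms by (intro mult_right_mono power_increasing schwartz_norm_nonneg) auto
  finally show ?thesis using assms by (simp add: field_simps)
qed

text \<open>The index \<open>j\<close> numbers the cells of either half-line outwards: cells
  \<open>j\<close> and \<open>-j-1\<close> both lie at distance at least j/n from the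
  origin.\<close>

lemma cell_integral_decay:
  assumes n: "n \<ge> 1" and k: "k = int j \<or> k = - int j - 1"
  shows "\<bar>cell_integral n (schwartz_fun \<phi>) k\<bar> \<le> 32 * schwartz_norm 4 \<phi> / (1 + j / n) ^ 4 / n"
proof (rule cell_bounded_integrable(2)[OF n])
  fix t assume t: "t \<in> cell n k"
  have "j / n \<le> \<bar>t\<bar>"
    using k
  proof
    assume "k = int j"
    then show ?thesis using t n by (auto simp: cell_eq)
  next
    assume "k = - int j - 1"
    then have "t < - (j / n)" using t n by (auto simp: cell_eq)
    then show ?thesis by linarith
  qed
  then show "\<bar>schwartz_fun \<phi> t\<bar> \<le> 32 * schwartz_norm 4 \<phi> / (1 + j / n) ^ 4"
    using sderiv_le_inverse_power[of 4 0 "j / n" t \<phi>] by simp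
qed simp

text \<open>On the negative side the pair consists of cells \<open>-j-2\<close> and
  \<open>-j-1\<close>; the one nearer to the origin ends at -j/n, whence the offset 2.\<close>

lemma cell_integral_diff_decay:
  assumes n: "n \<ge> 1" and k: "k = int j \<or> k = - int j - 2"
  shows "\<bar>cell_integral n (schwartz_fun \<phi>) k - cell_integral n (schwartz_fun \<phi>) (k + 1)\<bar>
    \<le> 32 * schwartz_norm 4 \<phi> / (1 + j / n) ^ 3 / (real n)\<^sup>2"
proof (rule cell_integral_diff[OF n])
  fix z assume z: "k / n \<le> z" "z \<le> (k + 2) / n"
  have "j / n \<le> \<bar>z\<bar>"
    using k
  proof
    assume "k = int j"
    then show ?thesis using z by auto
  next
    assume "k = - int j - 2"
    then have "z \<le> - (j / n)" using z by auto
    then show ?thesis by linarith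
  qed
  then show "\<bar>sderiv 1 \<phi> z\<bar> \<le> 32 * schwartz_norm 4 \<phi> / (1 + j / n) ^ 3"
    using sderiv_le_inverse_power[of 3 1 "j / n" z \<phi>] by simp
qed

section \<open>Summation by parts\<close>

lemma abel_summation:
  fixes \<zeta> b :: "nat \<Rightarrow> real"
  shows "(\<Sum>j<L. \<zeta> j * b j) = (\<Sum>i<L. \<zeta> i) * b L + (\<Sum>j<L. (\<Sum>i<Suc j. \<zeta> i) * (b j - b (Suc j)))"
  by (induction L) (simp_all add: algebra_simps)

text \<open>The terms are n/(n+j)^2, the later ones dominated by a telescoping sum with total at
  most 1; the first term 1/n accounts for the other unit.\<close>

lemma sum_inverse_square_le:
  assumes "n \<ge> (1::nat)"
  shows "(\<Sum>j<J. 1 / real n / (1 + real j / real n)\<^sup>2) \<le> 2"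
proof -
  have *: "1 / real n / (1 + real j / real n)\<^sup>2 = real n / (real n + real j)\<^sup>2" for j
    using assms by (simp add: field_simps power2_eq_square)
  have "(\<Sum>j<Suc J. real n / (real n + real j)\<^sup>2) \<le> 2 - real n / (real n + real J)" for J
  proof (induction J)
    case 0
    then show ?case using assms by (simp add: power2_eq_square)
  next
    case (Suc J)
    define x where "x = real n + real J"
    have x: "x > 0" using assms by (simp add: x_def)
    have "real n / (x + 1)\<^sup>2 \<le> real n / (x * (x + 1))"
      using x by (intro divide_left_mono) (auto simp: power2_eq_square)
    also have "\<dots> = real n / x - real n / (x + 1)"
      using x by (simp add: field_simps)
    finally show ?case using Suc by (simp add: x_def add_ac)
  qed
  then have "(\<Sum>j<Suc J. real n / (real n + real j)\<^sup>2) \<le> 2" for J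
    by (rule order_trans) simp
  then show ?thesis unfolding * by (cases J) auto
qed

text \<open>Any one term of the weighted sum bounds its partial sum by
  \<open>R * (1 + L/n) ^ 3\<close>. The coefficients decay with exponent 4, one more than the
  weights, so the boundary term keeps a factor 1/(1 + L/n) and vanishes in the limit.\<close>

lemma abel_summation_bound:
  fixes \<zeta> b :: "nat \<Rightarrow> real"
  assumes n: "n \<ge> (1::nat)" and A: "A \<ge> 0" and R: "R \<ge> 0"
    and SR: "\<And>J. (\<Sum>j<J. \<bar>\<Sum>i<Suc j. \<zeta> i\<bar> / (1 + j / n) ^ 3) \<le> R"
    and b: "\<And>j. \<bar>b j\<bar> \<le> A / (1 + j / n) ^ 4 / n"
    and db: "\<And>j. \<bar>b j - b (Suc j)\<bar> \<le> A / (1 + j / n) ^ 3 / (real n)\<^sup>2"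
  shows "\<bar>\<Sum>j<Suc L. \<zeta> j * b j\<bar> \<le> A * R / n / (1 + L / n) + A * R / (real n)\<^sup>2"
proof -
  have "\<bar>\<Sum>i<Suc L. \<zeta> i\<bar> / (1 + L / n) ^ 3 \<le> (\<Sum>j<Suc L. \<bar>\<Sum>i<Suc j. \<zeta> i\<bar> / (1 + j / n) ^ 3)"
    by (intro member_le_sum[of L]) auto
  then have "\<bar>\<Sum>i<Suc L. \<zeta> i\<bar> / (1 + L / n) ^ 3 \<le> R" using SR[of "Suc L"] by linarith
  moreover have "0 < (1 + L / n) ^ 3" by (intro zero_less_power add_pos_nonneg) auto
  ultimately have S: "\<bar>\<Sum>i<Suc L. \<zeta> i\<bar> \<le> R * (1 + L / n) ^ 3" by (simp only: pos_divide_le_eq)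
  have "A / (1 + Suc L / n) ^ 4 / n \<le> A / (1 + L / n) ^ 4 / n"
    using A n by (intro divide_right_mono divide_left_mono power_mono add_mono)
      (auto intro!: add_pos_nonneg divide_right_mono mult_pos_pos zero_less_power)
  then have bL: "\<bar>b (Suc L)\<bar> \<le> A / (1 + L / n) ^ 4 / n" using b[of "Suc L"] by linarith
  have "\<bar>(\<Sum>i<Suc L. \<zeta> i) * b (Suc L)\<bar> \<le> (R * (1 + L / n) ^ 3) * (A / (1 + L / n) ^ 4 / n)"
    unfolding abs_mult using S bL R by (intro mult_mono) auto
  also have "\<dots> = A * R / n / (1 + L / n)"
  proof -
    have "y \<noteq> 0 \<Longrightarrow> (R * y ^ 3) * (A / y ^ 4 / n) = A * R / n / y" for y :: real
      by (simp add: field_simps power3_eq_cube power4_eq_xxxx)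
    moreover have "1 + real L / n \<noteq> 0" by (smt (verit) divide_nonneg_nonneg of_nat_0_le_iff)
    ultimately show ?thesis by blast
  qed
  finally have 1: "\<bar>(\<Sum>i<Suc L. \<zeta> i) * b (Suc L)\<bar> \<le> A * R / n / (1 + L / n)" .
  have "\<bar>\<Sum>j<Suc L. (\<Sum>i<Suc j. \<zeta> i) * (b j - b (Suc j))\<bar> \<le>
      (\<Sum>j<Suc L. \<bar>\<Sum>i<Suc j. \<zeta> i\<bar> * (A / (1 + j / n) ^ 3 / (real n)\<^sup>2))"
    by (rule order_trans[OF sum_abs]) (auto simp only: abs_mult intro!: sum_mono mult_left_mono db)
  also have "\<dots> = A / (real n)\<^sup>2 * (\<Sum>j<Suc L. \<bar>\<Sum>i<Suc j. \<zeta> i\<bar> / (1 + j / n) ^ 3)"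
    unfolding sum_distrib_left by (intro sum.cong refl) (simp add: field_simps)
  also have "\<dots> \<le> A / (real n)\<^sup>2 * R"
    using A by (intro mult_left_mono SR) auto
  finally have 2: "\<bar>\<Sum>j<Suc L. (\<Sum>i<Suc j. \<zeta> i) * (b j - b (Suc j))\<bar> \<le> A * R / (real n)\<^sup>2" by simp
  show ?thesis unfolding abel_summation[of \<zeta> b "Suc L"] using 1 2 by linarith
qed

lemma tendsto_divide_linear:
  assumes "n \<ge> (1::nat)"
  shows "(\<lambda>L. c / (1 + real L / real n)) \<longlonglongrightarrow> 0"
proof -
  have "filterlim (\<lambda>L. 1 + (1 / real n) * real L) at_top sequentially"
    using assms by (intro filterlim_tendsto_add_at_top[OF tendsto_const]
        filterlim_tendsto_pos_mult_at_top[OF tendsto_const _ filterlim_real_sequentially]) auto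
  then show ?thesis
    by (intro real_tendsto_divide_at_top[OF tendsto_const]) simp
qed

section \<open>Tightness\<close>

lemma sum_symmetric_int:
  "(\<Sum>k\<in>{- int L..<int L}. g k) = (\<Sum>j<L. g (int j)) + (\<Sum>j<L. g (- int j - 1) :: real)"
proof (induction L)
  case (Suc L)
  have "{- int (Suc L)..<int (Suc L)} = insert (int L) (insert (- int L - 1) {- int L..<int L})"
    by auto
  then show ?case using Suc by simp
qed simp

section \<open>Moments and weighted partial sums of the random sequence\<close>

locale iid_standardized = prob_space M for M :: "'a measure" +
  fixes \<xi> :: "int \<Rightarrow> 'a \<Rightarrow> real"
  assumes indep: "indep_vars (\<lambda>_. borel) \<xi> UNIV"
    and ident: "\<And>i j. distr M borel (\<xi> i) = distr M borel (\<xi> j)"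
    and mean: "\<And>j. integrable M (\<xi> j)" "\<And>j. expectation (\<xi> j) = 0"
    and var: "\<And>j. integrable M (\<lambda>\<omega>. (\<xi> j \<omega>)\<^sup>2)" "\<And>j. variance (\<xi> j) = 1"
begin

lemma rv [measurable]: "\<xi> k \<in> borel_measurable M"
  using mean(1) by (rule borel_measurable_integrable)

lemma second_moment: "expectation (\<lambda>\<omega>. (\<xi> k \<omega>)\<^sup>2) = 1"
  using var(2)[of k] mean(2)[of k] by simp

lemma mixed_moment:
  shows "integrable M (\<lambda>\<omega>. \<xi> i \<omega> * \<xi> j \<omega>)"
    and "expectation (\<lambda>\<omega>. \<xi> i \<omega> * \<xi> j \<omega>) = (if i = j then 1 else 0)"
proof -
  have "integrable M (\<lambda>\<omega>. \<xi> i \<omega> * \<xi> j \<omega>) \<and> expectation (\<lambda>\<omega>. \<xi> i \<omega> * \<xi> j \<omega>) = (if i = j then 1 else 0)"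
  proof (cases "i = j")
    case True
    then show ?thesis using var(1)[of j] second_moment[of j] by (simp add: power2_eq_square)
  next
    case False
    have ind: "indep_vars (\<lambda>_. borel) \<xi> {i, j}" by (rule indep_vars_subset[OF indep]) auto
    show ?thesis
      using indep_vars_lebesgue_integral[OF _ ind mean(1)] indep_vars_integrable[OF _ ind mean(1)] False
      by (simp add: mean(2))
  qed
  then show "integrable M (\<lambda>\<omega>. \<xi> i \<omega> * \<xi> j \<omega>)"
    "expectation (\<lambda>\<omega>. \<xi> i \<omega> * \<xi> j \<omega>) = (if i = j then 1 else 0)" by auto
qed

text \<open>The variables are orthonormal in L2, so the second moment of the sum is
  \<open>card F\<close>; nonnegativity of the variance of its absolute value gives the L1
  bound.\<close>

lemma expectation_abs_sum_le:
  assumes "finite F"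
  shows "expectation (\<lambda>\<omega>. \<bar>\<Sum>k\<in>F. \<xi> k \<omega>\<bar>) \<le> sqrt (card F)"
proof -
  let ?S = "\<lambda>\<omega>. \<Sum>k\<in>F. \<xi> k \<omega>"
  have eq: "(?S \<omega>)\<^sup>2 = (\<Sum>i\<in>F. \<Sum>j\<in>F. \<xi> i \<omega> * \<xi> j \<omega>)" for \<omega>
    by (simp add: power2_eq_square sum_product)
  have int2: "integrable M (\<lambda>\<omega>. (?S \<omega>)\<^sup>2)"
    unfolding eq by (intro Bochner_Integration.integrable_sum mixed_moment)
  have "expectation (\<lambda>\<omega>. (?S \<omega>)\<^sup>2) = (\<Sum>i\<in>F. \<Sum>j\<in>F. if i = j then 1 else 0)"
    unfolding eq by (simp add: mixed_moment)
  also have "\<dots> = card F" using assms by simp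
  finally have E2: "expectation (\<lambda>\<omega>. (?S \<omega>)\<^sup>2) = card F" .
  have "0 \<le> variance (\<lambda>\<omega>. \<bar>?S \<omega>\<bar>)" by (rule variance_positive)
  also have "variance (\<lambda>\<omega>. \<bar>?S \<omega>\<bar>) = card F - (expectation (\<lambda>\<omega>. \<bar>?S \<omega>\<bar>))\<^sup>2"
    using int2 by (subst variance_eq) (auto simp: E2 mean)
  finally show ?thesis by (simp add: real_le_rsqrt)
qed

text \<open>The weight \<open>(1 + j/n)\<^bsup>-3\<^esup>\<close> is light enough for the expectation to be of order \<open>n\<^bsup>3/2\<^esup>\<close>
  (\<open>path_sum\<close> is not normalised by this factor), and is matched by the decay of the differences of
  consecutive cell integrals.\<close>

definition path_sum :: "nat \<Rightarrow> (nat \<Rightarrow> int) \<Rightarrow> 'a \<Rightarrow> ennreal" where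
  "path_sum n f \<omega> = (\<Sum>j. ennreal (\<bar>\<Sum>i<Suc j. \<xi> (f i) \<omega>\<bar> / (1 + real j / real n) ^ 3))"

lemma path_sum_measurable [measurable]: "path_sum n f \<in> borel_measurable M"
  unfolding path_sum_def by measurable

text \<open>With y = 1 + j/n, the estimate sqrt(j+1) \<le> sqrt n * y gives up half a power of y, so
  that after division by y^3 the summable weight y^(-2) remains. Injectivity of \<open>f\<close>
  makes the summed variables distinct.\<close>

lemma nn_integral_path_sum:
  assumes "inj f" "n \<ge> 1"
  shows "(\<integral>\<^sup>+\<omega>. path_sum n f \<omega> \<partial>M) \<le> ennreal (2 * (real n * sqrt n))"
proof -
  have le: "(\<integral>\<^sup>+\<omega>. ennreal (\<bar>\<Sum>i<Suc j. \<xi> (f i) \<omega>\<bar> / (1 + real j / real n) ^ 3) \<partial>M)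
      \<le> ennreal ((real n * sqrt n) * (1 / real n / (1 + real j / real n)\<^sup>2))" for j
  proof -
    define y where "y = 1 + real j / real n"
    have y: "y \<ge> 1" by (simp add: y_def)
    have "(\<Sum>i<Suc j. \<xi> (f i) \<omega>) = (\<Sum>k\<in>f ` {..<Suc j}. \<xi> k \<omega>)" for \<omega>
      using assms(1) by (subst sum.reindex) (auto intro: inj_on_subset)
    moreover have "card (f ` {..<Suc j}) = Suc j"
      using assms(1) by (subst card_image) (auto intro: inj_on_subset)
    ultimately have E: "expectation (\<lambda>\<omega>. \<bar>\<Sum>i<Suc j. \<xi> (f i) \<omega>\<bar>) \<le> sqrt (Suc j)"
      using expectation_abs_sum_le[of "f ` {..<Suc j}"] by simp
    have "real (Suc j) \<le> real n * y" using assms(2) by (simp add: y_def field_simps)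
    also have "\<dots> \<le> real n * y\<^sup>2"
      using y by (intro mult_left_mono) (auto simp: power2_eq_square)
    finally have "sqrt (Suc j) \<le> sqrt (real n * y\<^sup>2)" by (rule real_sqrt_le_mono)
    also have "\<dots> = sqrt n * y" using y by (simp add: real_sqrt_mult)
    finally have "sqrt (Suc j) \<le> sqrt n * y" .
    then have "expectation (\<lambda>\<omega>. \<bar>\<Sum>i<Suc j. \<xi> (f i) \<omega>\<bar>) / y ^ 3 \<le> sqrt n * y / y ^ 3"
      using E y by (intro divide_right_mono) auto
    also have "\<dots> = (real n * sqrt n) * (1 / real n / y\<^sup>2)"
      using y assms(2) by (simp add: power3_eq_cube power2_eq_square)
    finally have "expectation (\<lambda>\<omega>. \<bar>\<Sum>i<Suc j. \<xi> (f i) \<omega>\<bar> / y ^ 3) \<le> (real n * sqrt n) * (1 / real n / y\<^sup>2)"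
      by simp
    moreover have "(\<integral>\<^sup>+\<omega>. ennreal (\<bar>\<Sum>i<Suc j. \<xi> (f i) \<omega>\<bar> / y ^ 3) \<partial>M) =
        ennreal (expectation (\<lambda>\<omega>. \<bar>\<Sum>i<Suc j. \<xi> (f i) \<omega>\<bar> / y ^ 3))"
      using y mean by (intro nn_integral_eq_integral)
        (auto simp del: sum.lessThan_Suc intro!: integrable_divide_zero integrable_abs Bochner_Integration.integrable_sum)
    ultimately show ?thesis unfolding y_def by (simp add: ennreal_leI)
  qed
  have "(\<integral>\<^sup>+\<omega>. path_sum n f \<omega> \<partial>M) =
      (\<Sum>j. \<integral>\<^sup>+\<omega>. ennreal (\<bar>\<Sum>i<Suc j. \<xi> (f i) \<omega>\<bar> / (1 + real j / real n) ^ 3) \<partial>M)"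
    unfolding path_sum_def by (rule nn_integral_suminf) measurable
  also have "\<dots> \<le> (\<Sum>j. ennreal ((real n * sqrt n) * (1 / real n / (1 + real j / real n)\<^sup>2)))"
    by (intro suminf_le le) auto
  also have "\<dots> \<le> ennreal (2 * (real n * sqrt n))"
    unfolding suminf_eq_SUP
  proof (rule SUP_least)
    fix J
    have "(\<Sum>j<J. (real n * sqrt n) * (1 / real n / (1 + real j / real n)\<^sup>2)) \<le> (real n * sqrt n) * 2"
      unfolding sum_distrib_left[symmetric]
      by (intro mult_left_mono sum_inverse_square_le assms) auto
    then show "(\<Sum>j<J. ennreal ((real n * sqrt n) * (1 / real n / (1 + real j / real n)\<^sup>2)))
        \<le> ennreal (2 * (real n * sqrt n))"
      by (subst sum_ennreal) (auto intro!: ennreal_leI simp: mult.commute)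
  qed
  finally show ?thesis .
qed

lemma path_sum_leD:
  assumes "path_sum n f \<omega> \<le> ennreal R" "R \<ge> 0"
  shows "(\<Sum>j<J. \<bar>\<Sum>i<Suc j. \<xi> (f i) \<omega>\<bar> / (1 + real j / real n) ^ 3) \<le> R"
proof -
  have "(\<Sum>j<J. ennreal (\<bar>\<Sum>i<Suc j. \<xi> (f i) \<omega>\<bar> / (1 + real j / real n) ^ 3)) \<le> path_sum n f \<omega>"
    unfolding path_sum_def by (intro sum_le_suminf) auto
  with assms(1) have "(\<Sum>j<J. ennreal (\<bar>\<Sum>i<Suc j. \<xi> (f i) \<omega>\<bar> / (1 + real j / real n) ^ 3)) \<le> ennreal R"
    by (rule order_trans[rotated])
  then show ?thesis
    using assms(2) by (subst (asm) sum_ennreal) (auto simp: ennreal_le_iff)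
qed

lemma path_sum_finite:
  assumes "inj f" "n \<ge> 1"
  shows "AE \<omega> in M. path_sum n f \<omega> < \<infinity>"
proof -
  have "(\<integral>\<^sup>+\<omega>. path_sum n f \<omega> \<partial>M) \<noteq> \<infinity>"
    using nn_integral_path_sum[OF assms] by (auto simp: top_unique)
  from nn_integral_PInf_AE[OF path_sum_measurable this] show ?thesis
    by (simp add: less_top)
qed

text \<open>A single variable is the difference of two consecutive partial sums, each bounded by the
  path sum times its inverse weight; this doubles the constant.\<close>

lemma path_sum_growth:
  assumes "path_sum 1 f \<omega> < \<infinity>"
  obtains R where "R \<ge> 0" "\<And>j. \<bar>\<xi> (f j) \<omega>\<bar> \<le> R * (1 + real j) ^ 3"
proof -
  obtain R where R: "R \<ge> 0" "path_sum 1 f \<omega> = ennreal R"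
    using assms by (cases "path_sum 1 f \<omega>") auto
  have S: "\<bar>\<Sum>i<Suc j. \<xi> (f i) \<omega>\<bar> \<le> R * (1 + real j) ^ 3" for j
  proof -
    have "\<bar>\<Sum>i<Suc j. \<xi> (f i) \<omega>\<bar> / (1 + real j) ^ 3 \<le>
        (\<Sum>j<Suc j. \<bar>\<Sum>i<Suc j. \<xi> (f i) \<omega>\<bar> / (1 + real j) ^ 3)"
      by (intro member_le_sum[of j]) auto
    also have "\<dots> \<le> R" using path_sum_leD[of 1 f \<omega> R "Suc j"] R by simp
    finally have *: "\<bar>\<Sum>i<Suc j. \<xi> (f i) \<omega>\<bar> / (1 + real j) ^ 3 \<le> R" .
    have "0 < (1 + real j) ^ 3" by (intro zero_less_power) auto
    with * show ?thesis by (simp only: pos_divide_le_eq)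
  qed
  have "\<bar>\<xi> (f j) \<omega>\<bar> \<le> (2 * R) * (1 + real j) ^ 3" for j
  proof (cases j)
    case 0
    then show ?thesis using S[of 0] R by simp
  next
    case (Suc i)
    have "\<xi> (f j) \<omega> = (\<Sum>i<Suc j. \<xi> (f i) \<omega>) - (\<Sum>i<j. \<xi> (f i) \<omega>)" by simp
    moreover have "R * (1 + real i) ^ 3 \<le> R * (1 + real j) ^ 3"
      using R Suc by (intro mult_left_mono power_mono) auto
    ultimately show ?thesis
      using S[of j] S[of i] unfolding Suc by linarith
  qed
  then show thesis using R by (intro that[of "2 * R"]) auto
qed

text \<open>Path sums with mesh 1 are almost surely finite along both half-lines, which gives cubic
  growth of the whole sequence.\<close>

lemma AE_poly_bounded: "AE \<omega> in M. \<exists>p. poly_bounded p (\<lambda>k. a * \<xi> k \<omega>)"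
proof -
  have "AE \<omega> in M. path_sum 1 int \<omega> < \<infinity>" "AE \<omega> in M. path_sum 1 (\<lambda>j. - int j - 1) \<omega> < \<infinity>"
    by (rule path_sum_finite; simp add: inj_def)+
  then show ?thesis
  proof eventually_elim
    case (elim \<omega>)
    obtain R1 where R1: "R1 \<ge> 0" "\<And>j. \<bar>\<xi> (int j) \<omega>\<bar> \<le> R1 * (1 + real j) ^ 3"
      using path_sum_growth[OF elim(1)] by blast
    obtain R2 where R2: "R2 \<ge> 0" "\<And>j. \<bar>\<xi> (- int j - 1) \<omega>\<bar> \<le> R2 * (1 + real j) ^ 3"
      using path_sum_growth[OF elim(2)] by blast
    define p where "p = max 3 (nat \<lceil>\<bar>a\<bar> * max R1 R2\<rceil>)"
    have p: "\<bar>a\<bar> * max R1 R2 \<le> real p"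
      unfolding p_def by (meson max.cobounded2 of_nat_le_iff order_trans real_nat_ceiling_ge)
    have "poly_bounded p (\<lambda>k. a * \<xi> k \<omega>)"
      unfolding poly_bounded_def
    proof
      fix k
      have *: "\<bar>\<xi> k \<omega>\<bar> \<le> max R1 R2 * (1 + \<bar>real_of_int k\<bar>) ^ 3"
      proof (cases "k \<ge> 0")
        case True
        then have "\<bar>\<xi> k \<omega>\<bar> \<le> R1 * (1 + \<bar>real_of_int k\<bar>) ^ 3" using R1(2)[of "nat k"] by simp
        also have "\<dots> \<le> max R1 R2 * (1 + \<bar>real_of_int k\<bar>) ^ 3" by (intro mult_right_mono) auto
        finally show ?thesis .
      next
        case False
        define j where "j = nat (- k - 1)"
        have k: "k = - int j - 1" using False by (simp add: j_def)
        have "\<bar>\<xi> k \<omega>\<bar> \<le> R2 * (1 + real j) ^ 3" unfolding k by (rule R2)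
        also have "\<dots> \<le> max R1 R2 * (1 + \<bar>real_of_int k\<bar>) ^ 3"
          using R2 by (intro mult_mono power_mono) (auto simp: k)
        finally show ?thesis .
      qed
      have "\<bar>a * \<xi> k \<omega>\<bar> \<le> \<bar>a\<bar> * (max R1 R2 * (1 + \<bar>real_of_int k\<bar>) ^ 3)"
        unfolding abs_mult using * by (rule mult_left_mono) simp
      also have "\<dots> = (\<bar>a\<bar> * max R1 R2) * (1 + \<bar>real_of_int k\<bar>) ^ 3" by simp
      also have "\<dots> \<le> real p * (1 + \<bar>real_of_int k\<bar>) ^ p"
        using p by (intro mult_mono power_increasing) (auto simp: p_def)
      finally show "\<bar>a * \<xi> k \<omega>\<bar> \<le> real p * (1 + \<bar>real_of_int k\<bar>) ^ p" .
    qed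
    then show ?case ..
  qed
qed

section \<open>The random distributions and their concentration on polars\<close>

definition dist_path :: "nat \<Rightarrow> 'a \<Rightarrow> tempered" where
  "dist_path n \<omega> = distribution_of (\<lambda>t. sqrt n * \<xi> \<lfloor>real n * t\<rfloor> \<omega>)"

lemma dist_path_measurable: "n \<ge> 1 \<Longrightarrow> dist_path n \<in> borel_measurable M"
  unfolding dist_path_def[abs_def]
  by (rule distribution_of_step_measurable[of "\<lambda>k \<omega>. sqrt n * \<xi> k \<omega>"]) auto

lemma AE_represents:
  assumes "n \<ge> 1"
  shows "AE \<omega> in M. represents (dist_path n \<omega>) (\<lambda>t. sqrt n * \<xi> \<lfloor>real n * t\<rfloor> \<omega>)"
  using AE_poly_bounded[of "sqrt n"]
proof eventually_elim
  case (elim \<omega>)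
  then obtain x where "represents x (\<lambda>t. sqrt n * \<xi> \<lfloor>real n * t\<rfloor> \<omega>)"
    using represents_step_iff[OF assms, of "\<lambda>k. sqrt n * \<xi> k \<omega>"] by blast
  then show ?case
    using distribution_of_eq by (simp add: dist_path_def)
qed

lemma pairing_dist_path_tendsto:
  assumes "represents (dist_path n \<omega>) (\<lambda>t. sqrt n * \<xi> \<lfloor>real n * t\<rfloor> \<omega>)"
  shows "(\<lambda>L. \<Sum>k\<in>{- int L..<int L}. (sqrt n * cell_integral n (schwartz_fun \<phi>) k) * \<xi> k \<omega>)
    \<longlonglongrightarrow> pairing (dist_path n \<omega>) \<phi>"
  using pairing_step_tendsto[of "dist_path n \<omega>" "\<lambda>k. sqrt n * \<xi> k \<omega>" n \<phi>] assms
  by (simp add: mult_ac)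

text \<open>The powers of \<open>n\<close> cancel: sqrt n from the normalisation, n^(-2) from the
  differences of cell integrals, and n^(3/2) from the bound on the path sums. The polar is therefore
  independent of \<open>n\<close>. The constant 64 is 32 for each half-line.\<close>

lemma dist_path_in_polar:
  assumes n: "n \<ge> 1" and rep: "represents (dist_path n \<omega>) (\<lambda>t. sqrt n * \<xi> \<lfloor>real n * t\<rfloor> \<omega>)"
    and R: "path_sum n int \<omega> \<le> ennreal (C * (real n * sqrt n))"
      "path_sum n (\<lambda>j. - int j - 1) \<omega> \<le> ennreal (C * (real n * sqrt n))"
    and C: "C \<ge> 0" and q: "4 \<le> q" "64 * C \<le> real q"
  shows "dist_path n \<omega> \<in> polar q"
proof (rule mem_polarI[OF _ q])
  fix \<phi>
  let ?a = "cell_integral n (schwartz_fun \<phi>)"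
  define A where "A = 32 * schwartz_norm 4 \<phi>"
  define R where "R = C * (real n * sqrt n)"
  have A: "A \<ge> 0" unfolding A_def using schwartz_norm_nonneg[of 4 \<phi>] by simp
  have R0: "R \<ge> 0" using C by (simp add: R_def)
  have 1: "\<bar>\<Sum>j<Suc L. \<xi> (int j) \<omega> * ?a (int j)\<bar> \<le> A * R / n / (1 + L / n) + A * R / (real n)\<^sup>2" for L
  proof (rule abel_summation_bound[OF n A R0])
    show "\<bar>?a (int j) - ?a (int (Suc j))\<bar> \<le> A / (1 + real j / real n) ^ 3 / (real n)\<^sup>2" for j
      using cell_integral_diff_decay[OF n, of "int j" j \<phi>] by (simp add: A_def add.commute)
    show "\<bar>?a (int j)\<bar> \<le> A / (1 + real j / real n) ^ 4 / n" for j
      unfolding A_def by (rule cell_integral_decay[OF n]) simp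
    show "(\<Sum>j<J. \<bar>\<Sum>i<Suc j. \<xi> (int i) \<omega>\<bar> / (1 + j / n) ^ 3) \<le> R" for J
      using assms(3) R0 unfolding R_def by (rule path_sum_leD)
  qed
  have 2: "\<bar>\<Sum>j<Suc L. \<xi> (- int j - 1) \<omega> * ?a (- int j - 1)\<bar> \<le> A * R / n / (1 + L / n) + A * R / (real n)\<^sup>2" for L
  proof (rule abel_summation_bound[OF n A R0])
    show "\<bar>?a (- int j - 1) - ?a (- int (Suc j) - 1)\<bar> \<le> A / (1 + real j / real n) ^ 3 / (real n)\<^sup>2" for j
    proof -
      have "- int j - 2 + 1 = - int j - 1" "- int (Suc j) - 1 = - int j - 2" by auto
      then show ?thesis
        using cell_integral_diff_decay[OF n, of "- int j - 2" j \<phi>] by (simp only: A_def abs_minus_commute simp_thms)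
    qed
    show "\<bar>?a (- int j - 1)\<bar> \<le> A / (1 + real j / real n) ^ 4 / n" for j
      unfolding A_def by (rule cell_integral_decay[OF n]) simp
    show "(\<Sum>j<J. \<bar>\<Sum>i<Suc j. \<xi> (- int i - 1) \<omega>\<bar> / (1 + j / n) ^ 3) \<le> R" for J
      using assms(4) R0 unfolding R_def by (rule path_sum_leD)
  qed
  have le: "\<bar>\<Sum>k\<in>{- int (Suc L)..<int (Suc L)}. (sqrt n * ?a k) * \<xi> k \<omega>\<bar>
      \<le> sqrt n * (2 * (A * R / n / (1 + L / n) + A * R / (real n)\<^sup>2))" for L
  proof -
    have eq: "(\<Sum>k\<in>{- int (Suc L)..<int (Suc L)}. (sqrt n * ?a k) * \<xi> k \<omega>) =
        sqrt n * ((\<Sum>j<Suc L. \<xi> (int j) \<omega> * ?a (int j)) + (\<Sum>j<Suc L. \<xi> (- int j - 1) \<omega> * ?a (- int j - 1)))"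
      unfolding sum_symmetric_int[symmetric, of "\<lambda>k. \<xi> k \<omega> * ?a k"] sum_distrib_left
      by (simp only: mult_ac)
    show ?thesis
      unfolding eq abs_mult using 1[of L] 2[of L] by (simp del: sum.lessThan_Suc add: mult_left_mono)
  qed
  \<comment> \<open>With \<open>n\<close> fixed, letting the number of cells grow removes the
    boundary terms of both half-lines.\<close>
  have "(\<lambda>L. sqrt n * (2 * (A * R / n / (1 + real L / n) + A * R / (real n)\<^sup>2))) \<longlonglongrightarrow>
      sqrt n * (2 * (0 + A * R / (real n)\<^sup>2))"
    by (intro tendsto_mult tendsto_add tendsto_const tendsto_divide_linear[OF n])
  moreover have "(\<lambda>L. \<bar>\<Sum>k\<in>{- int (Suc L)..<int (Suc L)}. (sqrt n * ?a k) * \<xi> k \<omega>\<bar>) \<longlonglongrightarrow>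
      \<bar>pairing (dist_path n \<omega>) \<phi>\<bar>"
    by (rule tendsto_rabs[OF LIMSEQ_Suc[OF pairing_dist_path_tendsto[OF rep]]])
  ultimately have "\<bar>pairing (dist_path n \<omega>) \<phi>\<bar> \<le> sqrt n * (2 * (0 + A * R / (real n)\<^sup>2))"
    using le by (intro LIMSEQ_le) auto
  also have "\<dots> = (sqrt n * sqrt n) * real n * (2 * (A * C)) / (real n)\<^sup>2"
    by (simp add: R_def mult_ac)
  also have "\<dots> = 64 * C * schwartz_norm 4 \<phi>"
    using n by (simp add: A_def power2_eq_square)
  finally show "\<bar>pairing (dist_path n \<omega>) \<phi>\<bar> \<le> 64 * C * schwartz_norm 4 \<phi>" .
qed

lemma path_sum_tail:
  assumes "inj f" "n \<ge> 1" "C > 0"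
  shows "emeasure M {\<omega> \<in> space M. \<not> path_sum n f \<omega> \<le> ennreal (C * (real n * sqrt n))} \<le> ennreal (2 / C)"
proof -
  define s where "s = real n * sqrt n"
  have s: "s > 0" using assms by (simp add: s_def)
  have "emeasure M {\<omega> \<in> space M. \<not> path_sum n f \<omega> \<le> ennreal (C * s)} \<le>
      emeasure M {\<omega> \<in> space M. 1 \<le> ennreal (1 / (C * s)) * path_sum n f \<omega>}"
  proof (rule emeasure_mono)
    show "{\<omega> \<in> space M. \<not> path_sum n f \<omega> \<le> ennreal (C * s)} \<subseteq>
        {\<omega> \<in> space M. 1 \<le> ennreal (1 / (C * s)) * path_sum n f \<omega>}"
    proof safe
      fix \<omega> assume "\<not> path_sum n f \<omega> \<le> ennreal (C * s)"
      then have "ennreal (1 / (C * s)) * ennreal (C * s) \<le> ennreal (1 / (C * s)) * path_sum n f \<omega>"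
        by (intro mult_left_mono) auto
      then show "1 \<le> ennreal (1 / (C * s)) * path_sum n f \<omega>"
        using assms s by (simp add: ennreal_mult[symmetric])
    qed
  qed measurable
  also have "\<dots> \<le> ennreal (1 / (C * s)) * (\<integral>\<^sup>+\<omega>. path_sum n f \<omega> * indicator (space M) \<omega> \<partial>M)"
    by (rule nn_integral_Markov_inequality) auto
  also have "\<dots> = ennreal (1 / (C * s)) * (\<integral>\<^sup>+\<omega>. path_sum n f \<omega> \<partial>M)"
    by (simp add: nn_integral_indicator_singleton cong: nn_integral_cong)
  also have "\<dots> \<le> ennreal (1 / (C * s)) * ennreal (2 * s)"
    unfolding s_def by (intro mult_left_mono nn_integral_path_sum assms) auto
  also have "\<dots> = ennreal (2 / C)"
    using assms s by (simp add: ennreal_mult[symmetric])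
  finally show ?thesis by (simp add: s_def)
qed

lemma tight:
  assumes "\<delta> > 0"
  shows "\<exists>q. \<forall>n\<ge>1. measure (distr M borel (dist_path n)) (- polar q) \<le> \<delta>"
proof -
  \<comment> \<open>Markov's inequality gives 2/C for each half-line, hence \<open>\<delta>\<close>
    / 2 twice.\<close>
  define C where "C = 4 / \<delta>"
  have C: "C > 0" using assms by (simp add: C_def)
  define q where "q = max 4 (nat \<lceil>64 * C\<rceil>)"
  have q: "4 \<le> q" "64 * C \<le> real q"
    unfolding q_def by (auto intro: order_trans[OF real_nat_ceiling_ge])
  have "measure (distr M borel (dist_path n)) (- polar q) \<le> \<delta>" if n: "n \<ge> 1" for n
  proof -
    let ?B = "\<lambda>f. {\<omega> \<in> space M. \<not> path_sum n f \<omega> \<le> ennreal (C * (real n * sqrt n))}"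
    have pol: "- polar q \<in> sets borel" using closed_polar by (auto intro: borel_closed)
    have "emeasure (distr M borel (dist_path n)) (- polar q) = emeasure M (dist_path n -` (- polar q) \<inter> space M)"
      using dist_path_measurable[OF n] pol by (rule emeasure_distr)
    also have "\<dots> \<le> emeasure M (?B int \<union> ?B (\<lambda>j. - int j - 1))"
    proof (rule emeasure_mono_AE)
      show "AE \<omega> in M. \<omega> \<in> dist_path n -` (- polar q) \<inter> space M \<longrightarrow> \<omega> \<in> ?B int \<union> ?B (\<lambda>j. - int j - 1)"
        using AE_represents[OF n]
      proof eventually_elim
        case (elim \<omega>)
        then show ?case using dist_path_in_polar[OF n elim _ _ _ q] C by auto
      qed
    qed measurable
    also have "\<dots> \<le> emeasure M (?B int) + emeasure M (?B (\<lambda>j. - int j - 1))"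
      by (intro emeasure_subadditive) measurable
    also have "\<dots> \<le> ennreal (2 / C) + ennreal (2 / C)"
      using n C by (intro add_mono path_sum_tail) (auto simp: inj_def)
    also have "\<dots> = ennreal \<delta>"
      using C assms by (simp add: ennreal_plus[symmetric] C_def del: ennreal_plus)
    finally show ?thesis
      using assms by (simp add: measure_def enn2real_leI)
  qed
  then show ?thesis by blast
qed

end

section \<open>Convergence of characteristic functions\<close>

text \<open>For the upper bound, (1 - x + x^2/2)(1 + x + x^2/2) = 1 + x^4/4 is at least 1, and the
  second factor is at most exp x.\<close>

lemma exp_minus_quadratic:
  assumes "0 \<le> (x::real)"
  shows "\<bar>exp (- x) - (1 - x)\<bar> \<le> x\<^sup>2 / 2"
proof -
  have "1 - x \<le> exp (- x)" using exp_ge_add_one_self[of "- x"] by simp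
  moreover have "exp (- x) \<le> 1 - x + x\<^sup>2 / 2"
  proof -
    have pos: "0 < 1 - x + x\<^sup>2 / 2"
    proof -
      have eq: "1 - x + x\<^sup>2 / 2 = ((1 - x)\<^sup>2 + 1) / 2" by (simp add: power2_eq_square field_simps)
      show ?thesis unfolding eq by (intro divide_pos_pos add_nonneg_pos) auto
    qed
    have "1 \<le> 1 + x ^ 4 / 4" by simp
    also have "\<dots> = (1 - x + x\<^sup>2 / 2) * (1 + x + x\<^sup>2 / 2)"
      by (simp add: power2_eq_square power4_eq_xxxx field_simps)
    also have "\<dots> \<le> (1 - x + x\<^sup>2 / 2) * exp x"
      using exp_lower_Taylor_quadratic[OF assms] pos by (intro mult_left_mono) auto
    finally show ?thesis by (simp add: exp_minus field_simps)
  qed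
  ultimately show ?thesis by linarith
qed

lemma exp_minus_lipschitz:
  assumes "0 \<le> (a::real)" "0 \<le> b"
  shows "\<bar>exp (- a) - exp (- b)\<bar> \<le> \<bar>a - b\<bar>"
proof -
  have *: "\<bar>exp (- a) - exp (- b)\<bar> \<le> \<bar>a - b\<bar>" if "0 \<le> a" "a \<le> b" for a b :: real
  proof -
    have "exp (- a) - exp (- b) = exp (- a) * (1 - exp (a - b))"
      by (simp add: right_diff_distrib exp_add[symmetric])
    also have "\<dots> \<le> 1 * (b - a)"
    proof (rule mult_mono)
      show "1 - exp (a - b) \<le> b - a" using exp_ge_add_one_self[of "a - b"] by linarith
    qed (use that in auto)
    finally show ?thesis using that by simp
  qed
  show ?thesis
    using *[of a b] *[of b a] assms by (cases "a \<le> b") (auto simp: abs_minus_commute)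
qed

context iid_standardized
begin

text \<open>The first summand is the error of the second-order expansion of the characteristic function of
  \<open>\<xi>\<^sub>0\<close>, the second that of \<open>exp (- t\<^sup>2 / 2)\<close>, both relative to \<open>t\<^sup>2\<close>.\<close>

definition clt_error :: "real \<Rightarrow> real" where
  "clt_error s = expectation (\<lambda>\<omega>. min (6 * (\<xi> 0 \<omega>)\<^sup>2) (s * \<bar>\<xi> 0 \<omega>\<bar> ^ 3)) / 6 + s\<^sup>2 / 8"

lemma clt_error_integrable:
  "0 \<le> s \<Longrightarrow> integrable M (\<lambda>\<omega>. min (6 * (\<xi> 0 \<omega>)\<^sup>2) (s * \<bar>\<xi> 0 \<omega>\<bar> ^ 3))"
  by (rule Bochner_Integration.integrable_bound[OF integrable_mult_right[OF var(1)[of 0], of 6]])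
    (auto intro!: AE_I2)

lemma clt_error_mono:
  assumes "0 \<le> s" "s \<le> s'"
  shows "clt_error s \<le> clt_error s'"
proof -
  have "expectation (\<lambda>\<omega>. min (6 * (\<xi> 0 \<omega>)\<^sup>2) (s * \<bar>\<xi> 0 \<omega>\<bar> ^ 3)) \<le>
      expectation (\<lambda>\<omega>. min (6 * (\<xi> 0 \<omega>)\<^sup>2) (s' * \<bar>\<xi> 0 \<omega>\<bar> ^ 3))"
    using assms by (intro integral_mono clt_error_integrable min.mono mult_right_mono) auto
  moreover have "s\<^sup>2 \<le> s'\<^sup>2" using assms by (intro power_mono)
  ultimately show ?thesis by (simp add: clt_error_def)
qed

text \<open>The minimum with 6 times the square supplies an integrable majorant from the second
  moment alone, while the cubic term tends to 0 pointwise.\<close>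

lemma clt_error_tendsto:
  assumes "0 \<le> B"
  shows "(\<lambda>n. clt_error (B / sqrt (real n))) \<longlonglongrightarrow> 0"
proof -
  have lim: "(\<lambda>n. B / sqrt (real n)) \<longlonglongrightarrow> 0"
    by (intro real_tendsto_divide_at_top[OF tendsto_const] filterlim_compose[OF sqrt_at_top]
        filterlim_real_sequentially)
  have "(\<lambda>n. expectation (\<lambda>\<omega>. min (6 * (\<xi> 0 \<omega>)\<^sup>2) (B / sqrt (real n) * \<bar>\<xi> 0 \<omega>\<bar> ^ 3)))
      \<longlonglongrightarrow> expectation (\<lambda>\<omega>. 0)"
  proof (rule integral_dominated_convergence[where w = "\<lambda>\<omega>. 6 * (\<xi> 0 \<omega>)\<^sup>2"])
    show "AE \<omega> in M. (\<lambda>n. min (6 * (\<xi> 0 \<omega>)\<^sup>2) (B / sqrt (real n) * \<bar>\<xi> 0 \<omega>\<bar> ^ 3)) \<longlonglongrightarrow> 0"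
    proof (rule AE_I2)
      fix \<omega>
      have "(\<lambda>n. min (6 * (\<xi> 0 \<omega>)\<^sup>2) (B / sqrt (real n) * \<bar>\<xi> 0 \<omega>\<bar> ^ 3)) \<longlonglongrightarrow>
          min (6 * (\<xi> 0 \<omega>)\<^sup>2) (0 * \<bar>\<xi> 0 \<omega>\<bar> ^ 3)"
        by (intro tendsto_min tendsto_mult tendsto_const lim)
      then show "(\<lambda>n. min (6 * (\<xi> 0 \<omega>)\<^sup>2) (B / sqrt (real n) * \<bar>\<xi> 0 \<omega>\<bar> ^ 3)) \<longlonglongrightarrow> 0"
        by (simp add: min_absorb2)
    qed
  qed (use var assms in auto)
  then have "(\<lambda>n. clt_error (B / sqrt (real n))) \<longlonglongrightarrow> expectation (\<lambda>\<omega>. 0) / 6 + 0\<^sup>2 / 8"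
    unfolding clt_error_def by (intro tendsto_intros lim) auto
  then show ?thesis by simp
qed

lemma char_error: "cmod (char (distr M borel (\<xi> 0)) t - exp (- t\<^sup>2 / 2)) \<le> t\<^sup>2 * clt_error \<bar>t\<bar>"
proof -
  have "cmod (char (distr M borel (\<xi> 0)) t - (1 - t\<^sup>2 * 1 / 2)) \<le>
      t\<^sup>2 / 6 * expectation (\<lambda>\<omega>. min (6 * (\<xi> 0 \<omega>)\<^sup>2) (\<bar>t\<bar> * \<bar>\<xi> 0 \<omega>\<bar> ^ 3))"
    using mean var by (intro char_approx3') auto
  \<comment> \<open>With x = t^2/2 in \<open>exp_minus_quadratic\<close>, x^2/2 is t^4/8; this is
    the summand s^2/8 of \<open>clt_error\<close> multiplied by t^2.\<close>
  moreover have "cmod (complex_of_real (1 - t\<^sup>2 * 1 / 2) - complex_of_real (exp (- t\<^sup>2 / 2))) \<le> t ^ 4 / 8"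
    unfolding of_real_diff[symmetric] norm_of_real
    using exp_minus_quadratic[of "t\<^sup>2 / 2"] by (simp add: abs_minus_commute power_divide)
  ultimately have "cmod (char (distr M borel (\<xi> 0)) t - exp (- t\<^sup>2 / 2)) \<le>
      t\<^sup>2 / 6 * expectation (\<lambda>\<omega>. min (6 * (\<xi> 0 \<omega>)\<^sup>2) (\<bar>t\<bar> * \<bar>\<xi> 0 \<omega>\<bar> ^ 3)) + t ^ 4 / 8"
    by (intro norm_diff_triangle_le[of _ "complex_of_real (1 - t\<^sup>2 * 1 / 2)"]) auto
  also have "\<dots> = t\<^sup>2 * clt_error \<bar>t\<bar>"
    by (simp add: clt_error_def algebra_simps power2_eq_square power4_eq_xxxx)
  finally show ?thesis .
qed

text \<open>By independence the characteristic function is a product. A difference of products of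
  factors of modulus at most 1 is bounded by the sum of the factorwise differences, and the uniform
  bound \<open>s\<close> on the coefficients plays the part of the Lindeberg condition.\<close>

lemma char_linear_combination:
  assumes b: "\<And>k. k \<in> F \<Longrightarrow> \<bar>b k\<bar> \<le> s" and "s \<ge> 0"
  shows "cmod ((\<integral>\<omega>. iexp (\<Sum>k\<in>F. b k * \<xi> k \<omega>) \<partial>M) - exp (- (\<Sum>k\<in>F. (b k)\<^sup>2) / 2))
    \<le> (\<Sum>k\<in>F. (b k)\<^sup>2) * clt_error s"
proof -
  let ?\<nu> = "distr M borel (\<xi> 0)"
  interpret \<nu>: real_distribution ?\<nu> by (rule real_distribution_distr) simp
  have "(\<integral>\<omega>. iexp (\<Sum>k\<in>F. b k * \<xi> k \<omega>) \<partial>M) = char (distr M borel (\<lambda>\<omega>. \<Sum>k\<in>F. b k * \<xi> k \<omega>)) 1"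
    by (simp add: char_def integral_distr)
  also have "\<dots> = (\<Prod>k\<in>F. char (distr M borel (\<lambda>\<omega>. b k * \<xi> k \<omega>)) 1)"
    by (rule char_distr_sum) (rule indep_vars_compose2[OF indep_vars_subset[OF indep]]; simp)
  also have "\<dots> = (\<Prod>k\<in>F. char ?\<nu> (b k))"
  proof (intro prod.cong refl)
    fix k
    have "char (distr M borel (\<lambda>\<omega>. b k * \<xi> k \<omega>)) 1 = char (distr M borel (\<xi> k)) (b k)"
      by (simp add: char_def integral_distr)
    then show "char (distr M borel (\<lambda>\<omega>. b k * \<xi> k \<omega>)) 1 = char ?\<nu> (b k)"
      by (simp only: ident[of k 0])
  qed
  finally have E: "(\<integral>\<omega>. iexp (\<Sum>k\<in>F. b k * \<xi> k \<omega>) \<partial>M) = (\<Prod>k\<in>F. char ?\<nu> (b k))" .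
  have X: "complex_of_real (exp (- (\<Sum>k\<in>F. (b k)\<^sup>2) / 2)) = (\<Prod>k\<in>F. complex_of_real (exp (- (b k)\<^sup>2 / 2)))"
  proof (cases "finite F")
    case True
    then show ?thesis
      unfolding of_real_prod[symmetric] exp_sum[OF True, symmetric]
      by (simp add: sum_negf sum_divide_distrib)
  qed simp
  have "cmod ((\<Prod>k\<in>F. char ?\<nu> (b k)) - (\<Prod>k\<in>F. complex_of_real (exp (- (b k)\<^sup>2 / 2)))) \<le>
      (\<Sum>k\<in>F. cmod (char ?\<nu> (b k) - complex_of_real (exp (- (b k)\<^sup>2 / 2))))"
    by (rule norm_prod_diff) (auto simp: \<nu>.cmod_char_le_1)
  also have "\<dots> \<le> (\<Sum>k\<in>F. (b k)\<^sup>2 * clt_error s)"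
    by (intro sum_mono order_trans[OF char_error] mult_left_mono clt_error_mono b) auto
  finally show ?thesis unfolding E X by (simp add: sum_distrib_right)
qed

text \<open>The first error term is the central limit error of the coefficients \<open>b k\<close>,
  all at most B/sqrt n in absolute value. The second compares the sum of their squares with the
  integral \<open>S\<close>.\<close>

lemma char_dist_path_error:
  assumes n: "n \<ge> 1" and B: "\<And>t. \<bar>sderiv 0 \<phi> t\<bar> \<le> B" and D: "\<And>t. \<bar>sderiv 1 \<phi> t\<bar> \<le> D"
  defines "S \<equiv> (LBINT t. (schwartz_fun \<phi> t)\<^sup>2)" and "I \<equiv> (LBINT t. \<bar>schwartz_fun \<phi> t\<bar>)"
  shows "cmod ((\<integral>\<omega>. iexp (pairing (dist_path n \<omega>) \<phi>) \<partial>M) - exp (- S / 2))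
    \<le> (S + D / n * I) * clt_error (B / sqrt n) + D / n * I / 2"
proof -
  have "B \<ge> 0" "D \<ge> 0" using B[of 0] D[of 0] by linarith+
  define b where "b k = sqrt n * cell_integral n (schwartz_fun \<phi>) k" for k
  \<comment> \<open>The sum \<open>p L\<close> tends to the target variance \<open>S\<close>,
    \<open>s L\<close> is the variance of the truncated combination, and \<open>r L\<close> controls
    their difference.\<close>
  define p where "p L = (\<Sum>k\<in>{- int L..<int L}. cell_integral n (\<lambda>t. (schwartz_fun \<phi> t)\<^sup>2) k)" for L
  define r where "r L = (\<Sum>k\<in>{- int L..<int L}. cell_integral n (\<lambda>t. \<bar>schwartz_fun \<phi> t\<bar>) k)" for L
  define s where "s L = (\<Sum>k\<in>{- int L..<int L}. (b k)\<^sup>2)" for L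
  have p: "p \<longlonglongrightarrow> S" unfolding p_def S_def
    by (rule sum_cell_integral_tendsto[OF schwartz_square_integrable])
  have r: "r \<longlonglongrightarrow> I" unfolding r_def I_def
    by (rule sum_cell_integral_tendsto[OF integrable_abs[OF schwartz_integrable]])
  have b: "\<bar>b k\<bar> \<le> B / sqrt n" for k
  proof -
    have "\<bar>cell_integral n (schwartz_fun \<phi>) k\<bar> \<le> B / n"
      using B by (intro cell_bounded_integrable(2)[OF n]) auto
    then have "sqrt n * \<bar>cell_integral n (schwartz_fun \<phi>) k\<bar> \<le> sqrt n * (B / n)"
      by (rule mult_left_mono) simp
    then have "\<bar>b k\<bar> \<le> sqrt n * (B / n)" by (simp add: b_def abs_mult)
    also have "\<dots> = B / sqrt n"
    proof -
      have "r * (B / (r * r)) = B / r" if "r > 0" for r :: real using that by simp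
      from this[of "sqrt n"] show ?thesis using n by simp
    qed
    finally show ?thesis .
  qed
  have sp: "\<bar>p L - s L\<bar> \<le> D / n * r L" for L
  proof -
    have "(b k)\<^sup>2 = real n * (cell_integral n (schwartz_fun \<phi>) k)\<^sup>2" for k
      by (simp add: b_def power_mult_distrib)
    then have "p L - s L = (\<Sum>k\<in>{- int L..<int L}. cell_integral n (\<lambda>t. (schwartz_fun \<phi> t)\<^sup>2) k -
        real n * (cell_integral n (schwartz_fun \<phi>) k)\<^sup>2)"
      by (simp add: p_def s_def sum_subtractf)
    then have "\<bar>p L - s L\<bar> \<le> (\<Sum>k\<in>{- int L..<int L}. \<bar>cell_integral n (\<lambda>t. (schwartz_fun \<phi> t)\<^sup>2) k -
        real n * (cell_integral n (schwartz_fun \<phi>) k)\<^sup>2\<bar>)"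
      by (simp only: sum_abs)
    also have "\<dots> \<le> D / n * r L"
      unfolding r_def sum_distrib_left by (intro sum_mono cell_integral_square n D)
    finally show ?thesis .
  qed
  have nonneg: "p L \<ge> 0" "s L \<ge> 0" for L
    by (auto simp: p_def s_def cell_integral_def intro!: sum_nonneg Bochner_Integration.integral_nonneg)
  \<comment> \<open>Nonnegativity of the error is obtained from monotonicity and its value at
    0.\<close>
  have "clt_error 0 \<le> clt_error (B / sqrt n)" using \<open>B \<ge> 0\<close> by (intro clt_error_mono) auto
  moreover have "clt_error 0 = 0" by (simp add: clt_error_def min_absorb2)
  ultimately have err: "clt_error (B / sqrt n) \<ge> 0" by simp
  let ?T = "\<lambda>L \<omega>. \<Sum>k\<in>{- int L..<int L}. b k * \<xi> k \<omega>"
  have le: "cmod ((\<integral>\<omega>. iexp (?T L \<omega>) \<partial>M) - complex_of_real (exp (- p L / 2))) \<le>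
      (p L + D / n * r L) * clt_error (B / sqrt n) + D / n * r L / 2" for L
  proof -
    have "cmod ((\<integral>\<omega>. iexp (?T L \<omega>) \<partial>M) - complex_of_real (exp (- s L / 2))) \<le> s L * clt_error (B / sqrt n)"
      unfolding s_def using b \<open>B \<ge> 0\<close> by (intro char_linear_combination) auto
    also have "\<dots> \<le> (p L + D / n * r L) * clt_error (B / sqrt n)"
      using sp[of L] err by (intro mult_right_mono) auto
    finally have 1: "cmod ((\<integral>\<omega>. iexp (?T L \<omega>) \<partial>M) - complex_of_real (exp (- s L / 2))) \<le>
        (p L + D / n * r L) * clt_error (B / sqrt n)" .
    have "cmod (complex_of_real (exp (- s L / 2)) - complex_of_real (exp (- p L / 2))) \<le> D / n * r L / 2"
      unfolding of_real_diff[symmetric] norm_of_real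
      using exp_minus_lipschitz[of "s L / 2" "p L / 2"] nonneg[of L] sp[of L] by auto
    with 1 show ?thesis by (rule norm_diff_triangle_le)
  qed
  have "(\<lambda>L. \<integral>\<omega>. iexp (?T L \<omega>) \<partial>M) \<longlonglongrightarrow> (\<integral>\<omega>. iexp (pairing (dist_path n \<omega>) \<phi>) \<partial>M)"
  proof (rule integral_dominated_convergence[where w = "\<lambda>_. 1"])
    show "(\<lambda>\<omega>. iexp (pairing (dist_path n \<omega>) \<phi>)) \<in> borel_measurable M"
      using measurable_compose[OF dist_path_measurable[OF n] pairing_measurable[of \<phi>]] by measurable
    show "AE \<omega> in M. (\<lambda>L. iexp (?T L \<omega>)) \<longlonglongrightarrow> iexp (pairing (dist_path n \<omega>) \<phi>)"
      using AE_represents[OF n]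
    proof eventually_elim
      case (elim \<omega>)
      from pairing_dist_path_tendsto[OF elim, of \<phi>] show ?case
        unfolding b_def by (intro tendsto_intros)
    qed
  qed auto
  then have "(\<lambda>L. cmod ((\<integral>\<omega>. iexp (?T L \<omega>) \<partial>M) - complex_of_real (exp (- p L / 2)))) \<longlonglongrightarrow>
      cmod ((\<integral>\<omega>. iexp (pairing (dist_path n \<omega>) \<phi>) \<partial>M) - complex_of_real (exp (- S / 2)))"
    by (intro tendsto_intros p) auto
  moreover have "(\<lambda>L. (p L + D / n * r L) * clt_error (B / sqrt n) + D / n * r L / 2) \<longlonglongrightarrow>
      (S + D / n * I) * clt_error (B / sqrt n) + D / n * I / 2"
    by (intro tendsto_intros p r) auto
  ultimately show ?thesis
    using le by (intro LIMSEQ_le) auto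
qed

lemma char_dist_path_tendsto:
  "(\<lambda>n. \<integral>\<omega>. iexp (pairing (dist_path n \<omega>) \<phi>) \<partial>M) \<longlonglongrightarrow>
    complex_of_real (exp (- (1 / 2) * (LBINT t. (schwartz_fun \<phi> t)\<^sup>2)))"
proof -
  obtain B where "0 \<le> B" and B: "\<And>t. \<bar>sderiv 0 \<phi> t\<bar> \<le> B" using sderiv_bounded by blast
  obtain D where D: "\<And>t. \<bar>sderiv 1 \<phi> t\<bar> \<le> D" using sderiv_bounded by blast
  define S where "S = (LBINT t. (schwartz_fun \<phi> t)\<^sup>2)"
  define I where "I = (LBINT t. \<bar>schwartz_fun \<phi> t\<bar>)"
  have "(\<lambda>n. D / real n) \<longlonglongrightarrow> 0"
    by (intro real_tendsto_divide_at_top[OF tendsto_const] filterlim_real_sequentially)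
  then have "(\<lambda>n. (S + D / real n * I) * clt_error (B / sqrt (real n)) + D / real n * I / 2) \<longlonglongrightarrow>
      (S + 0 * I) * 0 + 0 * I / 2"
    by (intro tendsto_intros clt_error_tendsto \<open>0 \<le> B\<close>) auto
  then have lim: "(\<lambda>n. (S + D / real n * I) * clt_error (B / sqrt (real n)) + D / real n * I / 2) \<longlonglongrightarrow> 0"
    by simp
  have "(\<lambda>n. (\<integral>\<omega>. iexp (pairing (dist_path n \<omega>) \<phi>) \<partial>M) - complex_of_real (exp (- S / 2))) \<longlonglongrightarrow> 0"
  proof (rule Lim_null_comparison[OF _ lim])
    show "\<forall>\<^sub>F n in sequentially. cmod ((\<integral>\<omega>. iexp (pairing (dist_path n \<omega>) \<phi>) \<partial>M) - complex_of_real (exp (- S / 2)))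
        \<le> (S + D / real n * I) * clt_error (B / sqrt (real n)) + D / real n * I / 2"
      using eventually_ge_at_top[of 1]
    proof eventually_elim
      case (elim n)
      then show ?case using char_dist_path_error[OF elim B D] by (simp add: S_def I_def)
    qed
  qed
  then have "(\<lambda>n. \<integral>\<omega>. iexp (pairing (dist_path n \<omega>) \<phi>) \<partial>M) \<longlonglongrightarrow> complex_of_real (exp (- S / 2))"
    by (rule LIM_zero_cancel)
  then show ?thesis by (simp add: S_def)
qed

end

theorem theorem5p3:
  fixes M :: "'a measure" and \<xi> :: "int \<Rightarrow> 'a \<Rightarrow> real"
    and X :: "real \<Rightarrow> 'a \<Rightarrow> real" and Xn :: "nat \<Rightarrow> real \<Rightarrow> 'a \<Rightarrow> real"
    and P :: "nat \<Rightarrow> tempered measure" and \<mu> :: "tempered measure"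
  assumes "prob_space M"
    and indep: "prob_space.indep_vars M (\<lambda>_. borel) \<xi> UNIV"
    and ident: "\<And>i j. distr M borel (\<xi> i) = distr M borel (\<xi> j)"
    and mean: "\<And>j. integrable M (\<xi> j)" "\<And>j. prob_space.expectation M (\<xi> j) = 0"
    and var: "\<And>j. integrable M (\<lambda>\<omega>. (\<xi> j \<omega>)\<^sup>2)" "\<And>j. prob_space.variance M (\<xi> j) = 1"
    and X_def: "\<And>t \<omega>. X t \<omega> = \<xi> \<lfloor>t\<rfloor> \<omega>"
    and Xn_def: "\<And>n t \<omega>. Xn n t \<omega> = sqrt (real n) * X (real n * t) \<omega>"
    and P_def: "\<And>n. n \<ge> 1 \<Longrightarrow> P n = induced_measure M (Xn n)"
    and white_noise: "white_noise_measure \<mu>"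
  shows "(\<forall>n\<ge>1. (AE \<omega> in M. \<exists>x. represents x (\<lambda>t. Xn n t \<omega>)) \<and>
                 (\<lambda>\<omega>. distribution_of (\<lambda>t. Xn n t \<omega>)) \<in> borel_measurable M) \<and>
         converges_weakly P \<mu>"
proof -
  interpret iid_standardized M \<xi>
    using assms by (intro iid_standardized.intro iid_standardized_axioms.intro)
  have Xn: "Xn n t \<omega> = sqrt n * \<xi> \<lfloor>real n * t\<rfloor> \<omega>" for n t \<omega>
    by (simp add: Xn_def X_def)
  have path: "(\<lambda>\<omega>. distribution_of (\<lambda>t. Xn n t \<omega>)) = dist_path n" for n
    by (simp add: fun_eq_iff dist_path_def Xn)
  have P: "P n = distr M borel (dist_path n)" if "n \<ge> 1" for n
    using P_def[OF that] by (simp add: induced_measure_def path)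
  have \<mu>: "prob_space \<mu>" "sets \<mu> = sets borel"
    "\<And>\<phi>. (\<integral>x. iexp (pairing x \<phi>) \<partial>\<mu>) =
      complex_of_real (exp (- (1 / 2) * (LBINT t. (schwartz_fun \<phi> t)\<^sup>2)))"
    using white_noise by (auto simp: white_noise_measure_def)
  have "converges_weakly P \<mu>"
  proof (rule converges_weakly_tempered)
    show "prob_space (P n)" "sets (P n) = sets borel" if "n \<ge> 1" for n
      using that by (auto simp: P intro!: prob_space_distr dist_path_measurable)
    show "\<exists>q. \<forall>n\<ge>1. measure (P n) (- polar q) \<le> \<delta>" if "\<delta> > 0" for \<delta>
      using tight[OF that] by (auto simp: P)
    fix \<phi>
    show "(\<lambda>n. \<integral>x. iexp (pairing x \<phi>) \<partial>P n) \<longlonglongrightarrow> (\<integral>x. iexp (pairing x \<phi>) \<partial>\<mu>)"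
      unfolding \<mu>(3)
    \<comment> \<open>\<open>P 0\<close> is unspecified, so the two sequences are only known to
      agree from index 1 on.\<close>
    proof (rule Lim_transform_eventually[OF char_dist_path_tendsto])
      show "\<forall>\<^sub>F n in sequentially. (\<integral>\<omega>. iexp (pairing (dist_path n \<omega>) \<phi>) \<partial>M) = (\<integral>x. iexp (pairing x \<phi>) \<partial>P n)"
        using eventually_ge_at_top[of 1]
      proof eventually_elim
        case (elim n)
        show ?case
          unfolding P[OF elim]
          by (rule integral_distr[symmetric, OF dist_path_measurable[OF elim]]) measurable
      qed
    qed
  qed (rule \<mu>)+
  moreover have "AE \<omega> in M. \<exists>x. represents x (\<lambda>t. Xn n t \<omega>)" if "n \<ge> 1" for n
    using AE_represents[OF that] by eventually_elim (auto simp: Xn)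
  ultimately show ?thesis
    by (auto simp: path dist_path_measurable)
qed

end
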